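(* Let $K$ be a field and $R=K[x_1,x_2,\ldots]$. There exists an effective algorithm to solve the ideal membership problem for symmetric ideals in $R$: that is, an algorithm which, given polynomials $f_1,\ldots,f_m\in R$ and $f\in R$, decides whether $f\in\langle f_1,\ldots,f_m\rangle_{R[\mathfrak{S}_\infty]}$.
   Context: $X=\{x_1,x_2,\ldots\}$ is an infinite set of indeterminates indexed by the positive integers, $R=K[X]$. $\mathfrak{S}_\infty$ is the group of all permutations of $X$ (equivalently, of the positive integers); it acts on $R$ by $\sigma f(x_1,\ldots,x_n)=f(x_{\sigma 1},\ldots,x_{\sigma n})$. $R[\mathfrak{S}_\infty]$ is the left group ring with multiplication $f\sigma\cdot g\tau = fg(\sigma\tau)$ for $f,g\in R$, $\sigma,\tau\in\mathfrak{S}_\infty$, extended linearly; $R$ is a left $R[\mathfrak{S}_\infty]$-module via the action above. An ideal $I\subseteq R$ is symmetric if $\sigma f\in I$ for all $\sigma\in\mathfrak{S}_\infty$, $f\in I$; symmetric ideals are exactly the $R[\mathfrak{S}_\infty]$-submodules of $R$. Symmetric ideals are given as input by finitely many generators as $R[\mathfrak{S}_\infty]$-modules: $\langle f_1,\ldots,f_m\rangle_{R[\mathfrak{S}_\infty]}$ denotes the $R[\mathfrak{S}_\infty]$-submodule generated by $f_1,\ldots,f_m$, i.e. the ideal of $R$ generated by all $\sigma f_i$. "Effective algorithm" refers to algorithms that operate on polynomials with coefficients in $K$, using the field operations and equality test of $K$. *)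

theory Defs
  imports Complex_Main "HOL-Library.Poly_Mapping"
begin

section \<open>The polynomial ring in countably many indeterminates\<close>

text \<open>
  The index \<open>i :: nat\<close> stands for the indeterminate $x_{i+1}$, so that \<open>nat\<close> plays the role of
  the positive integers.
\<close>

type_synonym monomial = "nat \<Rightarrow>\<^sub>0 nat"
type_synonym 'a mpoly = "monomial \<Rightarrow>\<^sub>0 'a"

text \<open>The action of a permutation is the substitution $x_i \mapsto x_{\sigma i}$.\<close>

definition perm_mon :: "(nat \<Rightarrow> nat) \<Rightarrow> monomial \<Rightarrow> monomial" where
  "perm_mon \<sigma> m =
     (\<Sum>i\<in>Poly_Mapping.keys m. Poly_Mapping.single (\<sigma> i) (Poly_Mapping.lookup m i))"

definition perm_poly :: "(nat \<Rightarrow> nat) \<Rightarrow> 'a::field mpoly \<Rightarrow> 'a mpoly" where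
  "perm_poly \<sigma> f =
     (\<Sum>m\<in>Poly_Mapping.keys f. Poly_Mapping.single (perm_mon \<sigma> m) (Poly_Mapping.lookup f m))"

section \<open>Submodules over the group ring\<close>

text \<open>
  An element $\sum_\sigma g_\sigma \sigma$ of $R[\mathfrak{S}_\infty]$ is the finitely supported
  map $\sigma \mapsto g_\sigma$, supported on bijections. The product of the group ring does not
  enter into the notion of a submodule of \<open>R\<close>, only its additive structure and its action do.
\<close>

definition group_ring :: "((nat \<Rightarrow> nat) \<Rightarrow>\<^sub>0 'a::field mpoly) set" where
  "group_ring = {a. \<forall>\<sigma>\<in>Poly_Mapping.keys a. bij \<sigma>}"

definition group_ring_act :: "((nat \<Rightarrow> nat) \<Rightarrow>\<^sub>0 'a::field mpoly) \<Rightarrow> 'a mpoly \<Rightarrow> 'a mpoly" where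
  "group_ring_act a f = (\<Sum>\<sigma>\<in>Poly_Mapping.keys a. Poly_Mapping.lookup a \<sigma> * perm_poly \<sigma> f)"

definition group_ring_submodule :: "'a::field mpoly set \<Rightarrow> bool" where
  "group_ring_submodule M \<longleftrightarrow>
     0 \<in> M \<and> (\<forall>f\<in>M. \<forall>g\<in>M. f + g \<in> M) \<and> (\<forall>a\<in>group_ring. \<forall>f\<in>M. group_ring_act a f \<in> M)"

definition group_ring_span :: "'a::field mpoly set \<Rightarrow> 'a mpoly set" where
  "group_ring_span F = group_ring_submodule hull F"

definition symmetric_ideal :: "'a::field mpoly set \<Rightarrow> bool" where
  "symmetric_ideal I \<longleftrightarrow>
     0 \<in> I \<and> (\<forall>f\<in>I. \<forall>g\<in>I. f + g \<in> I) \<and> (\<forall>g. \<forall>f\<in>I. g * f \<in> I) \<and>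
     (\<forall>\<sigma>. bij \<sigma> \<longrightarrow> (\<forall>f\<in>I. perm_poly \<sigma> f \<in> I))"

lemma perm_mon_id: "perm_mon id m = m"
  by (rule poly_mapping_eqI)
    (auto simp: perm_mon_def lookup_sum lookup_single when_def in_keys_iff)

lemma perm_poly_id: "perm_poly id f = f"
  by (rule poly_mapping_eqI)
    (auto simp: perm_poly_def perm_mon_id lookup_sum lookup_single when_def in_keys_iff)

lemma perm_poly_var:
  "perm_poly \<sigma> (Poly_Mapping.single (Poly_Mapping.single i 1) 1) =
     (Poly_Mapping.single (Poly_Mapping.single (\<sigma> i) 1) 1 :: 'a::field mpoly)"
  by (simp add: perm_poly_def perm_mon_def)

lemma group_ring_submodule_iff_symmetric_ideal: "group_ring_submodule M \<longleftrightarrow> symmetric_ideal M"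
proof
  assume M: "group_ring_submodule M"
  have act: "g * perm_poly \<sigma> f \<in> M" if "bij \<sigma>" "f \<in> M" for \<sigma> g f
  proof -
    have "Poly_Mapping.single \<sigma> g \<in> group_ring"
      using that(1) by (simp add: group_ring_def)
    then have "group_ring_act (Poly_Mapping.single \<sigma> g) f \<in> M"
      using M that(2) unfolding group_ring_submodule_def by blast
    then show ?thesis by (simp add: group_ring_act_def split: if_splits)
  qed
  have "g * f \<in> M" if "f \<in> M" for g f
    using act[OF bij_id that, of g] by (simp only: perm_poly_id)
  moreover have "perm_poly \<sigma> f \<in> M" if "bij \<sigma>" "f \<in> M" for \<sigma> f
    using act[OF that, of 1] by simp
  ultimately show "symmetric_ideal M"
    using M unfolding symmetric_ideal_def group_ring_submodule_def by blast
next
  assume M: "symmetric_ideal M"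
  have "(\<Sum>x\<in>A. h x) \<in> M" if "\<And>x. x \<in> A \<Longrightarrow> h x \<in> M" for A and h :: "(nat \<Rightarrow> nat) \<Rightarrow> 'a mpoly"
    using that M by (induction A rule: infinite_finite_induct) (auto simp: symmetric_ideal_def)
  with M show "group_ring_submodule M"
    by (auto simp: symmetric_ideal_def group_ring_submodule_def group_ring_def group_ring_act_def)
qed

section \<open>Effective algorithms over a field\<close>

text \<open>
  Data are finite binary trees whose leaves may carry scalars. A program is a finite term that
  contains no scalars and no functions: it can build and dissect trees, branch, iterate, and
  apply the field operations and the equality test to scalars. These are Moschovakis' prime
  computable functions over the structure $(K; 0, 1, +, \cdot, -, {}^{-1}, =)$, equivalently
  machines in the style of Blum, Shub and Smale over \<open>K\<close> that have equality as the only test and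
  no built-in constants except 0 and 1.
\<close>

datatype 'a tree = Leaf | Scalar 'a | Node "'a tree" "'a tree"

datatype prog =
    Ident | MkLeaf | Left | Right
  | ZeroOp | OneOp | AddOp | MultOp | NegOp | InvOp | EqOp
  | Pairing prog prog
  | Then prog prog
  | Cond prog prog prog
  | Loop prog prog

fun left :: "'a tree \<Rightarrow> 'a tree" where
  "left (Node s t) = s" | "left _ = Leaf"

fun right :: "'a tree \<Rightarrow> 'a tree" where
  "right (Node s t) = t" | "right _ = Leaf"

fun unary_op :: "('a \<Rightarrow> 'a) \<Rightarrow> 'a tree \<Rightarrow> 'a tree" where
  "unary_op h (Scalar a) = Scalar (h a)" | "unary_op h _ = Leaf"

fun binary_op :: "('a \<Rightarrow> 'a \<Rightarrow> 'a) \<Rightarrow> 'a tree \<Rightarrow> 'a tree" where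
  "binary_op h (Node (Scalar a) (Scalar b)) = Scalar (h a b)" | "binary_op h _ = Leaf"

definition tree_of_bool :: "bool \<Rightarrow> 'a tree" where
  "tree_of_bool b = (if b then Node Leaf Leaf else Leaf)"

fun scalar_eq :: "'a tree \<Rightarrow> 'a tree" where
  "scalar_eq (Node (Scalar a) (Scalar b)) = tree_of_bool (a = b)" | "scalar_eq _ = Leaf"

text \<open>
  \<open>runs P s t\<close> means that \<open>P\<close> halts on input \<open>s\<close> with output \<open>t\<close>, which is then its
  only output. \<open>Leaf\<close> is the truth value false in tests, every other tree is true. Inverting 0
  yields 0, by the library convention for \<open>inverse\<close>; a program can avoid this by testing for 0 first.
\<close>

inductive runs :: "prog \<Rightarrow> 'a::field tree \<Rightarrow> 'a tree \<Rightarrow> bool" where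
  "runs Ident s s"
| "runs MkLeaf s Leaf"
| "runs Left s (left s)"
| "runs Right s (right s)"
| "runs ZeroOp s (Scalar 0)"
| "runs OneOp s (Scalar 1)"
| "runs AddOp s (binary_op (+) s)"
| "runs MultOp s (binary_op (*) s)"
| "runs NegOp s (unary_op uminus s)"
| "runs InvOp s (unary_op inverse s)"
| "runs EqOp s (scalar_eq s)"
| "runs P s t \<Longrightarrow> runs Q s u \<Longrightarrow> runs (Pairing P Q) s (Node t u)"
| "runs P s t \<Longrightarrow> runs Q t u \<Longrightarrow> runs (Then P Q) s u"
| "runs C s c \<Longrightarrow> c \<noteq> Leaf \<Longrightarrow> runs P s t \<Longrightarrow> runs (Cond C P Q) s t"
| "runs C s Leaf \<Longrightarrow> runs Q s t \<Longrightarrow> runs (Cond C P Q) s t"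
| "runs C s Leaf \<Longrightarrow> runs (Loop C P) s s"
| "runs C s c \<Longrightarrow> c \<noteq> Leaf \<Longrightarrow> runs P s t \<Longrightarrow> runs (Loop C P) t u \<Longrightarrow> runs (Loop C P) s u"

inductive_cases runs_elims:
  "runs Ident s t" "runs MkLeaf s t" "runs Left s t" "runs Right s t"
  "runs ZeroOp s t" "runs OneOp s t" "runs AddOp s t" "runs MultOp s t" "runs NegOp s t"
  "runs InvOp s t" "runs EqOp s t" "runs (Pairing P Q) s t" "runs (Then P Q) s t"
  "runs (Cond C P Q) s t" "runs (Loop C P) s t"

lemma runs_deterministic: "runs P s t \<Longrightarrow> runs P s u \<Longrightarrow> t = u"
proof (induction arbitrary: u rule: runs.induct)
  case (12 P s t Q v)
  from "12.prems" "12.IH" show ?case by (blast elim: runs_elims(12))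
next
  case (13 P s t Q v)
  from "13.prems" "13.IH" show ?case by (blast elim: runs_elims(13))
next
  case (14 C s c P t Q)
  from "14.prems" "14.IH" "14.hyps" show ?case by (blast elim: runs_elims(14))
next
  case (15 C s Q t P)
  from "15.prems" "15.IH" show ?case by (blast elim: runs_elims(14))
next
  case (16 C s P)
  from "16.prems" "16.IH" show ?case by (blast elim: runs_elims(15))
next
  case (17 C s c P t v)
  from "17.IH"(1)[of Leaf] "17.hyps"(2) have "\<not> runs C s Leaf" by blast
  with "17.prems" obtain t' where "runs P s t'" "runs (Loop C P) t' u"
    by (auto elim: runs_elims(15))
  with "17.IH"(2,3) show ?case by blast
qed (auto elim: runs_elims(1-11))

section \<open>Polynomials as input data\<close>

text \<open>
  A polynomial is written as a finite sum of terms $c\, x_1^{e_1} \cdots x_k^{e_k}$, each given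
  by \<open>c\<close> and the list $[e_1, \ldots, e_k]$. Neither the order of the terms nor their being
  collected is prescribed, so a polynomial has many such expressions, and an algorithm has to
  cope with all of them.
\<close>

type_synonym 'a poly_expr = "('a \<times> nat list) list"

definition poly_of_expr :: "'a::field poly_expr \<Rightarrow> 'a mpoly" where
  "poly_of_expr ts = (\<Sum>(c, es)\<leftarrow>ts. Poly_Mapping.single (Poly_Mapping.nth es) c)"

lemma ex_poly_expr: "\<exists>ts. poly_of_expr ts = f"
proof -
  obtain ms where ms: "set ms = Poly_Mapping.keys f" "distinct ms"
    using finite_distinct_list[OF finite_keys[of f]] by auto
  define es :: "monomial \<Rightarrow> nat list" where
    "es = (\<lambda>m. map (Poly_Mapping.lookup m) [0..<Poly_Mapping.degree m])"
  have es: "Poly_Mapping.nth (es m) = m" for m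
    unfolding es_def by (rule nth_idem)
  have "poly_of_expr (map (\<lambda>m. (Poly_Mapping.lookup f m, es m)) ms) =
      (\<Sum>m\<leftarrow>ms. Poly_Mapping.single m (Poly_Mapping.lookup f m))"
    unfolding poly_of_expr_def map_map o_def case_prod_conv es ..
  also have "\<dots> = (\<Sum>m\<in>Poly_Mapping.keys f. Poly_Mapping.single m (Poly_Mapping.lookup f m))"
    unfolding ms(1)[symmetric] using ms(2) by (rule sum_list_distinct_conv_sum_set)
  also have "\<dots> = f"
    using perm_poly_id[of f] by (simp only: perm_poly_def perm_mon_id)
  finally show ?thesis by blast
qed

fun tree_of_list :: "('b \<Rightarrow> 'a tree) \<Rightarrow> 'b list \<Rightarrow> 'a tree" where
  "tree_of_list enc [] = Leaf"
| "tree_of_list enc (x # xs) = Node (enc x) (tree_of_list enc xs)"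

fun tree_of_nat :: "nat \<Rightarrow> 'a tree" where
  "tree_of_nat 0 = Leaf"
| "tree_of_nat (Suc n) = Node Leaf (tree_of_nat n)"

definition tree_of_expr :: "'a poly_expr \<Rightarrow> 'a tree" where
  "tree_of_expr = tree_of_list (\<lambda>(c, es). Node (Scalar c) (tree_of_list tree_of_nat es))"

definition membership_input :: "'a poly_expr list \<Rightarrow> 'a poly_expr \<Rightarrow> 'a tree" where
  "membership_input tss ts = Node (tree_of_list tree_of_expr tss) (tree_of_expr ts)"

end

theory Submission
  imports Defs "HOL-Library.Multiset_Order" "HOL-Library.Product_Lexorder" "HOL-Library.Sublist"
    "HOL-Library.Infinite_Set" "HOL-Combinatorics.Cycles"
begin

text \<open>
  Compare monomials by degree and then by the exponent of the largest index in which they differ.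
  This well-order is compatible with products and with all increasing maps of the indices. Let
  \<open>trunc F k\<close> be the least space of polynomials in the first \<open>k\<close> indeterminates, of degree at most
  \<open>k\<close>, that contains the generators and is closed under permutations of these indeterminates and under
  those multiplications that keep the degree at most \<open>k\<close>. It is computed by linear algebra.
  If the leading monomials of \<open>trunc F (2 * k)\<close> are multiples of images of those of
  \<open>trunc F k\<close> under increasing maps, then \<open>trunc F k\<close> is a Groebner basis up to increasing maps: an
  S-polynomial involves at most \<open>2 * k\<close> indices and has degree at most \<open>2 * k\<close>. By Higman's lemma
  this happens for all large \<open>k\<close>. The algorithm searches for such a \<open>k\<close> for which, moreover, either
  \<open>f\<close> lies in \<open>trunc F k\<close>, or some element of \<open>trunc F k + K f\<close> has a leading monomial that is not a
  multiple of an image of one of \<open>trunc F k\<close>, which excludes that \<open>f\<close> is in the ideal.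
\<close>

text \<open>No total order of the monomials survives a swap of two indeterminates, so leading
  monomials can be followed only along increasing maps. Nothing is lost: an injective map on the
  first k indices is a permutation of these indices followed by an increasing map, and
  \<open>trunc F k\<close> absorbs the permutation. The second obstacle is that
  \<open>trunc F k\<close> may be smaller than the part of the ideal in its box, because generators
  or intermediate results may fall outside. Failing to find f there proves nothing, so a refutation
  needs its own certificate. An element of least leading monomial in the coset of f provides it: if
  this monomial were a multiple of an image of a leading monomial of the truncation, one division
  step would lower it. Conversely, at a stable k whose box contains the generators, every nonzero
  element of the ideal has a leading monomial of that kind. No bound for the decisive k is derived,
  so the search is unbounded. Each single test is finite, since maps with values below
  \<open>2 * k\<close> suffice even where all increasing maps are meant.\<close>

abbreviation "lk \<equiv> Poly_Mapping.lookup"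
abbreviation "mkeys \<equiv> Poly_Mapping.keys"
abbreviation "sg \<equiv> Poly_Mapping.single"

section \<open>Monomials and polynomials\<close>

definition mset_of_mon :: "monomial \<Rightarrow> nat multiset" where
  "mset_of_mon m = Abs_multiset (lk m)"

lemma count_mset_of_mon [simp]: "count (mset_of_mon m) i = lk m i"
  unfolding mset_of_mon_def by (subst count_Abs_multiset) auto

lemma mset_of_mon_add: "mset_of_mon (u + v) = mset_of_mon u + mset_of_mon v"
  by (rule multiset_eqI) (simp add: lookup_add)

lemma mset_of_mon_inject: "mset_of_mon u = mset_of_mon v \<longleftrightarrow> u = v"
  by (metis count_mset_of_mon poly_mapping_eqI)

text \<open>The degree is compared first, then the exponents, the largest index being decisive: the
  multiset order is a well-order that is compatible with sums and with increasing maps.\<close>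

definition mkey :: "monomial \<Rightarrow> nat \<times> nat multiset" where
  "mkey m = (size (mset_of_mon m), mset_of_mon m)"

abbreviation "tdeg m \<equiv> size (mset_of_mon m)"

lemma mkey_inject: "mkey u = mkey v \<longleftrightarrow> u = v"
  by (auto simp: mkey_def mset_of_mon_inject)

lemma mkey_add_less: "mkey (w + u) < mkey (w + v) \<longleftrightarrow> mkey u < mkey v"
  by (auto simp: mkey_def mset_of_mon_add)

lemma mkey_add_le: "mkey (w + u) \<le> mkey (w + v) \<longleftrightarrow> mkey u \<le> mkey v"
  by (metis mkey_add_less linorder_not_less)

lemma mkey_le_tdeg: "mkey u \<le> mkey v \<Longrightarrow> tdeg u \<le> tdeg v"
  by (auto simp: mkey_def)

definition Mon :: "nat \<Rightarrow> monomial set" where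
  "Mon k = {m. mkeys m \<subseteq> {..<k}}"

lemma Mon_lookup: "m \<in> Mon k \<Longrightarrow> k \<le> i \<Longrightarrow> lk m i = 0"
  using in_keys_iff[of i m] by (auto simp: Mon_def)

lemma MonI:
  assumes "\<And>i. k \<le> i \<Longrightarrow> lk m i = 0"
  shows "m \<in> Mon k"
  unfolding Mon_def
proof (intro CollectI subsetI)
  fix i assume "i \<in> mkeys m"
  then have "lk m i \<noteq> 0" by (simp add: in_keys_iff)
  with assms[of i] show "i \<in> {..<k}" by (cases "k \<le> i") auto
qed

lemma Mon_add_iff: "u + v \<in> Mon k \<longleftrightarrow> u \<in> Mon k \<and> v \<in> Mon k"
proof
  assume uv: "u + v \<in> Mon k"
  show "u \<in> Mon k \<and> v \<in> Mon k"
    using Mon_lookup[OF uv] by (auto intro!: MonI simp: lookup_add)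
qed (auto intro!: MonI simp: lookup_add Mon_lookup)

lemma Mon_mono: "u \<in> Mon k \<Longrightarrow> k \<le> l \<Longrightarrow> u \<in> Mon l"
  by (auto simp: Mon_def)

section \<open>Index maps acting on monomials\<close>

lemma perm_mon_superset:
  assumes "finite A" "mkeys m \<subseteq> A"
  shows "perm_mon \<sigma> m = (\<Sum>i\<in>A. sg (\<sigma> i) (lk m i))"
  unfolding perm_mon_def
  by (rule sum.mono_neutral_left) (use assms in \<open>auto simp: in_keys_iff\<close>)

lemma perm_mon_add: "perm_mon \<sigma> (u + v) = perm_mon \<sigma> u + perm_mon \<sigma> v"
proof -
  let ?A = "mkeys u \<union> mkeys v"
  have "mkeys (u + v) \<subseteq> ?A" by (rule keys_add)
  then show ?thesis
    by (simp add: perm_mon_superset[of ?A] lookup_add single_add sum.distrib)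
qed

lemma perm_mon_0 [simp]: "perm_mon \<sigma> 0 = 0"
  by (simp add: perm_mon_def)

lemma perm_mon_single [simp]: "perm_mon \<sigma> (sg i e) = sg (\<sigma> i) e"
  by (simp add: perm_mon_def)

lemma perm_mon_sum: "perm_mon \<sigma> (\<Sum>i\<in>A. f i) = (\<Sum>i\<in>A. perm_mon \<sigma> (f i))"
  by (induction A rule: infinite_finite_induct) (auto simp: perm_mon_add)

lemma perm_mon_comp: "perm_mon \<sigma> (perm_mon \<tau> m) = perm_mon (\<sigma> \<circ> \<tau>) m"
  by (simp add: perm_mon_def[of \<tau>] perm_mon_sum) (simp add: perm_mon_def)

lemma perm_mon_cong: "m \<in> Mon k \<Longrightarrow> (\<And>i. i < k \<Longrightarrow> \<sigma> i = \<tau> i) \<Longrightarrow> perm_mon \<sigma> m = perm_mon \<tau> m"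
  unfolding perm_mon_def by (rule sum.cong) (auto simp: Mon_def)

lemma lookup_perm_mon:
  assumes "inj_on \<sigma> {..<k}" "m \<in> Mon k" "i < k"
  shows "lk (perm_mon \<sigma> m) (\<sigma> i) = lk m i"
proof -
  have "perm_mon \<sigma> m = (\<Sum>j<k. sg (\<sigma> j) (lk m j))"
    using assms(2) by (intro perm_mon_superset) (auto simp: Mon_def)
  then have "lk (perm_mon \<sigma> m) (\<sigma> i) = (\<Sum>j<k. if j = i then lk m j else 0)"
    using assms(1,3) 
    by (simp only: lookup_sum lookup_single) (rule sum.cong, auto simp: when_def dest: inj_onD)
  then show ?thesis using assms(3) by simp
qed

lemma lookup_perm_mon_notin:
  assumes "m \<in> Mon k" "j \<notin> \<sigma> ` {..<k}"
  shows "lk (perm_mon \<sigma> m) j = 0"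
  using assms unfolding perm_mon_def lookup_sum
  by (intro sum.neutral) (auto simp: lookup_single when_def Mon_def)

lemma perm_mon_in_Mon:
  assumes "m \<in> Mon k" "\<And>i. i < k \<Longrightarrow> \<sigma> i < n"
  shows "perm_mon \<sigma> m \<in> Mon n"
  by (rule MonI, rule lookup_perm_mon_notin[OF assms(1)]) (use assms(2) in fastforce)

lemma perm_mon_inj:
  assumes "inj_on \<sigma> {..<k}" "u \<in> Mon k" "v \<in> Mon k" "perm_mon \<sigma> u = perm_mon \<sigma> v"
  shows "u = v"
proof (rule poly_mapping_eqI)
  fix i show "lk u i = lk v i"
  proof (cases "i < k")
    case True
    show ?thesis
      using lookup_perm_mon[OF assms(1,2) True] lookup_perm_mon[OF assms(1,3) True] assms(4) by simp
  next
    case False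
    with assms(2,3) show ?thesis by (simp add: Mon_lookup)
  qed
qed

lemma mset_of_mon_single: "mset_of_mon (sg i e) = replicate_mset e i"
  by (rule multiset_eqI) (simp add: lookup_single when_def)

lemma mset_of_mon_perm: "mset_of_mon (perm_mon \<sigma> m) = image_mset \<sigma> (mset_of_mon m)"
proof -
  have su: "mset_of_mon (\<Sum>i\<in>A. f i) = (\<Sum>i\<in>A. mset_of_mon (f i))" for A :: "nat set" and f
    by (induction A rule: infinite_finite_induct)
      (auto simp: mset_of_mon_add intro: multiset_eqI)
  have im: "image_mset \<sigma> (\<Sum>i\<in>A. f i) = (\<Sum>i\<in>A. image_mset \<sigma> (f i))" for A :: "nat set" and f
    by (induction A rule: infinite_finite_induct) auto
  have "mset_of_mon m = mset_of_mon (perm_mon id m)" by (simp add: perm_mon_id)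
  then show ?thesis by (simp add: perm_mon_def su mset_of_mon_single im)
qed

lemma tdeg_perm_mon [simp]: "tdeg (perm_mon \<sigma> m) = tdeg m"
  by (simp add: mset_of_mon_perm)

lemma tdeg_add: "tdeg (u + v) = tdeg u + tdeg v"
  by (simp add: mset_of_mon_add)

lemma tdeg_0 [simp]: "tdeg 0 = 0"
  by (metis add_cancel_left_right add_0 tdeg_add)

lemma set_mset_of_mon: "set_mset (mset_of_mon m) = mkeys m"
  by (auto simp: in_keys_iff simp flip: count_greater_zero_iff)

text \<open>An increasing map relabels positions without reordering them, so the largest index where
  u and v differ goes to the largest index where their images differ. Only its values below k
  matter, as the exponents beyond are zero.\<close>

lemma mkey_perm_less:
  assumes \<sigma>: "strict_mono_on {..<k} \<sigma>" and uv: "u \<in> Mon k" "v \<in> Mon k" and less: "mkey u < mkey v"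
  shows "mkey (perm_mon \<sigma> u) < mkey (perm_mon \<sigma> v)"
proof -
  have inj: "inj_on \<sigma> {..<k}" using \<sigma> by (rule strict_mono_on_imp_inj_on)
  have "mset_of_mon (perm_mon \<sigma> u) < mset_of_mon (perm_mon \<sigma> v)" if l: "mset_of_mon u < mset_of_mon v"
    unfolding less_multiset\<^sub>H\<^sub>O
  proof (intro conjI allI impI)
    show "mset_of_mon (perm_mon \<sigma> u) \<noteq> mset_of_mon (perm_mon \<sigma> v)"
      using l perm_mon_inj[OF inj uv] by (auto simp: mset_of_mon_inject)
    fix y assume "count (mset_of_mon (perm_mon \<sigma> v)) y < count (mset_of_mon (perm_mon \<sigma> u)) y"
    then have y: "lk (perm_mon \<sigma> v) y < lk (perm_mon \<sigma> u) y" by simp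
    then obtain i where i: "i < k" "y = \<sigma> i"
      using lookup_perm_mon_notin[OF uv(1), of y \<sigma>] by fastforce
    with y have "lk v i < lk u i" using lookup_perm_mon[OF inj] uv by simp
    with l obtain j where j: "i < j" "lk u j < lk v j"
      unfolding less_multiset\<^sub>H\<^sub>O by auto
    then have "j < k" using Mon_lookup[OF uv(2), of j] by (cases "j < k") auto
    with i j have "y < \<sigma> j" using \<sigma> by (auto simp: strict_mono_on_def)
    moreover have "lk (perm_mon \<sigma> u) (\<sigma> j) < lk (perm_mon \<sigma> v) (\<sigma> j)"
      using j \<open>j < k\<close> lookup_perm_mon[OF inj] uv by simp
    ultimately show "\<exists>x>y. count (mset_of_mon (perm_mon \<sigma> u)) x < count (mset_of_mon (perm_mon \<sigma> v)) x"
      by auto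
  qed
  with less show ?thesis by (auto simp: mkey_def mset_of_mon_perm)
qed

lemma mkey_perm_le:
  assumes \<sigma>: "strict_mono_on {..<k} \<sigma>" and uv: "u \<in> Mon k" "v \<in> Mon k" and le: "mkey u \<le> mkey v"
  shows "mkey (perm_mon \<sigma> u) \<le> mkey (perm_mon \<sigma> v)"
  using mkey_perm_less[OF \<sigma> uv] le by (metis mkey_inject order.order_iff_strict)

section \<open>Polynomials as a vector space with the action of index maps\<close>

lemma poly_mapping_sum_single: "(\<Sum>m\<in>mkeys p. sg m (lk p m)) = (p::'a::field mpoly)"
  using perm_poly_id[of p] by (simp add: perm_poly_def perm_mon_id)

text \<open>Scalars act as constant polynomials; the named function lets the vector space locale
  supply spans and subspaces.\<close>

definition scl :: "'a::field \<Rightarrow> 'a mpoly \<Rightarrow> 'a mpoly" where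
  "scl c p = sg 0 c * p"

lemma
  fixes c :: "'a::field" and p :: "'a mpoly"
  shows keys_sg_mult: "mkeys (sg m c * p) = (if c = 0 then {} else (+) m ` mkeys p)"
    and lookup_sg_mult: "lk (sg m c * p) (m + s) = c * lk p s"
proof -
  have *: "sg m c * p = (\<Sum>t\<in>mkeys p. sg (m + t) (c * lk p t))"
    by (subst poly_mapping_sum_single[symmetric]) (simp add: sum_distrib_left mult_single)
  show l: "lk (sg m c * p) (m + s) = c * lk p s" for s
    unfolding * lookup_sum lookup_single
    by (simp add: when_def in_keys_iff)
  have "lk (sg m c * p) r = 0" if "r \<notin> range ((+) m)" for r
    unfolding * lookup_sum lookup_single using that
    by (intro sum.neutral) (auto simp: when_def)
  then have "r \<in> mkeys (sg m c * p) \<longleftrightarrow> (\<exists>s. r = m + s \<and> c * lk p s \<noteq> 0)" for r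
    using l by (cases "r \<in> range ((+) m)") (auto simp: in_keys_iff)
  then show "mkeys (sg m c * p) = (if c = 0 then {} else (+) m ` mkeys p)"
    by (auto simp: in_keys_iff)
qed

lemma lookup_scl [simp]: "lk (scl c p) m = c * lk p m"
  using lookup_sg_mult[of 0 c p m] by (simp add: scl_def)

interpretation mp: vector_space scl
  by unfold_locales (auto intro!: poly_mapping_eqI simp: lookup_add algebra_simps)

lemma scl_mult: "scl c (p * q) = p * scl c q"
  by (simp add: scl_def algebra_simps)

lemma sg_eq_scl: "sg m c = scl c (sg m 1)"
  by (simp add: scl_def mult_single)

lemma perm_poly_superset:
  assumes "finite A" "mkeys f \<subseteq> A"
  shows "perm_poly \<sigma> f = (\<Sum>m\<in>A. sg (perm_mon \<sigma> m) (lk f m))"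
  unfolding perm_poly_def
  by (rule sum.mono_neutral_left) (use assms in \<open>auto simp: in_keys_iff\<close>)

lemma perm_poly_add: "perm_poly \<sigma> (f + g) = perm_poly \<sigma> f + perm_poly \<sigma> g"
proof -
  let ?A = "mkeys f \<union> mkeys g"
  have "mkeys (f + g) \<subseteq> ?A" by (rule keys_add)
  then show ?thesis
    by (simp add: perm_poly_superset[of ?A] lookup_add single_add sum.distrib)
qed

lemma perm_poly_0 [simp]: "perm_poly \<sigma> 0 = 0"
  by (simp add: perm_poly_def)

lemma perm_poly_single [simp]: "perm_poly \<sigma> (sg m c) = sg (perm_mon \<sigma> m) c"
  by (simp add: perm_poly_def)

lemma perm_poly_sum: "perm_poly \<sigma> (\<Sum>i\<in>A. f i) = (\<Sum>i\<in>A. perm_poly \<sigma> (f i))"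
  by (induction A rule: infinite_finite_induct) (auto simp: perm_poly_add)

lemma perm_poly_sg_mult: "perm_poly \<sigma> (sg m c * p) = sg (perm_mon \<sigma> m) c * perm_poly \<sigma> p"
proof -
  have "sg m c * p = (\<Sum>t\<in>mkeys p. sg (m + t) (c * lk p t))"
    by (subst poly_mapping_sum_single[symmetric]) (simp add: sum_distrib_left mult_single)
  then show ?thesis
    by (simp add: perm_poly_sum perm_mon_add) (simp add: perm_poly_def sum_distrib_left mult_single)
qed

lemma perm_poly_scl: "perm_poly \<sigma> (scl c p) = scl c (perm_poly \<sigma> p)"
  by (simp add: scl_def perm_poly_sg_mult)

lemma perm_poly_comp: "perm_poly \<sigma> (perm_poly \<tau> f) = perm_poly (\<sigma> \<circ> \<tau>) f"
  by (simp add: perm_poly_def[of \<tau>] perm_poly_sum perm_mon_comp) (simp add: perm_poly_def)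

definition Pol :: "nat \<Rightarrow> 'a::field mpoly set" where
  "Pol k = {p. mkeys p \<subseteq> Mon k}"

lemma perm_poly_cong:
  "p \<in> Pol k \<Longrightarrow> (\<And>i. i < k \<Longrightarrow> \<sigma> i = \<tau> i) \<Longrightarrow> perm_poly \<sigma> p = perm_poly \<tau> p"
  unfolding perm_poly_def
  by (rule sum.cong[OF refl]) (auto simp: Pol_def intro!: arg_cong2[where f=sg] perm_mon_cong)

text \<open>Injectivity below k keeps the images of distinct monomials distinct, so no coefficients
  are merged.\<close>

lemma
  assumes inj: "inj_on \<sigma> {..<k}" and p: "p \<in> Pol k"
  shows lookup_perm_poly: "s \<in> Mon k \<Longrightarrow> lk (perm_poly \<sigma> p) (perm_mon \<sigma> s) = lk p s"
    and keys_perm_poly: "mkeys (perm_poly \<sigma> p) = perm_mon \<sigma> ` mkeys p"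
proof -
  have sub: "mkeys p \<subseteq> Mon k" using p by (simp add: Pol_def)
  show l: "lk (perm_poly \<sigma> p) (perm_mon \<sigma> s) = lk p s" if s: "s \<in> Mon k" for s
  proof -
    have "lk (perm_poly \<sigma> p) (perm_mon \<sigma> s) = (\<Sum>t\<in>mkeys p. if t = s then lk p t else 0)"
      unfolding perm_poly_def lookup_sum lookup_single
      by (rule sum.cong) (use sub s perm_mon_inj[OF inj] in \<open>auto simp: when_def\<close>)
    then show ?thesis by (simp add: in_keys_iff)
  qed
  have "lk (perm_poly \<sigma> p) r = 0" if "r \<notin> perm_mon \<sigma> ` mkeys p" for r
    unfolding perm_poly_def lookup_sum lookup_single using that
    by (intro sum.neutral) (auto simp: when_def)
  then have "mkeys (perm_poly \<sigma> p) \<subseteq> perm_mon \<sigma> ` mkeys p"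
    by (auto simp: in_keys_iff)
  moreover have "perm_mon \<sigma> t \<in> mkeys (perm_poly \<sigma> p)" if "t \<in> mkeys p" for t
    using l[of t] sub that by (auto simp: in_keys_iff)
  ultimately show "mkeys (perm_poly \<sigma> p) = perm_mon \<sigma> ` mkeys p"
    by blast
qed

section \<open>Leading monomials\<close>

definition lm :: "'a::field mpoly \<Rightarrow> monomial" where
  "lm p = (SOME t. t \<in> mkeys p \<and> (\<forall>s\<in>mkeys p. mkey s \<le> mkey t))"

lemma lm_props:
  assumes "p \<noteq> 0"
  shows "lm p \<in> mkeys p \<and> (\<forall>s\<in>mkeys p. mkey s \<le> mkey (lm p))"
proof -
  have ne: "mkey ` mkeys p \<noteq> {}" "finite (mkey ` mkeys p)"
    using assms by (auto simp: keys_eq_empty)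
  from Max_in[OF ne(2,1)] obtain t where "t \<in> mkeys p" "mkey t = Max (mkey ` mkeys p)" by auto
  with ne(2) have "t \<in> mkeys p \<and> (\<forall>s\<in>mkeys p. mkey s \<le> mkey t)" by simp
  then show ?thesis unfolding lm_def by (rule someI)
qed

lemmas lm_in = lm_props[THEN conjunct1]
lemmas lm_max = lm_props[THEN conjunct2, rule_format]

lemma lm_eqI:
  assumes "t \<in> mkeys p" "\<And>s. s \<in> mkeys p \<Longrightarrow> mkey s \<le> mkey t"
  shows "lm p = t"
proof -
  have "p \<noteq> 0" using assms(1) by auto
  with assms lm_props[OF this] have "mkey (lm p) = mkey t" by (meson order_antisym)
  then show ?thesis by (simp add: mkey_inject)
qed

lemma lookup_lm: "p \<noteq> 0 \<Longrightarrow> lk p (lm p) \<noteq> 0"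
  using lm_in by (auto simp: in_keys_iff)

lemma lm_sg_mult: assumes "p \<noteq> 0" "c \<noteq> 0" shows "lm (sg m c * p) = m + lm p"
  by (rule lm_eqI) (use assms lm_props[OF assms(1)] in \<open>auto simp: keys_sg_mult mkey_add_le\<close>)

lemma sg_mult_neq_0: "p \<noteq> 0 \<Longrightarrow> c \<noteq> 0 \<Longrightarrow> sg m c * p \<noteq> (0::'a::field mpoly)"
  using keys_sg_mult[of m c p] by auto

lemma lm_perm_poly:
  assumes "strict_mono_on {..<k} \<sigma>" "p \<in> Pol k" "p \<noteq> 0"
  shows "lm (perm_poly \<sigma> p) = perm_mon \<sigma> (lm p)"
proof (rule lm_eqI)
  have "inj_on \<sigma> {..<k}" using assms(1) by (rule strict_mono_on_imp_inj_on)
  then have k: "mkeys (perm_poly \<sigma> p) = perm_mon \<sigma> ` mkeys p"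
    using assms(2) by (rule keys_perm_poly)
  show "perm_mon \<sigma> (lm p) \<in> mkeys (perm_poly \<sigma> p)"
    using lm_in[OF assms(3)] by (simp add: k)
  show "mkey s \<le> mkey (perm_mon \<sigma> (lm p))" if "s \<in> mkeys (perm_poly \<sigma> p)" for s
  proof -
    from that obtain t where t: "t \<in> mkeys p" "s = perm_mon \<sigma> t" by (auto simp: k)
    with assms(2) lm_in[OF assms(3)] show ?thesis
      by (auto simp: Pol_def intro!: mkey_perm_le[OF assms(1)] lm_max[OF assms(3)])
  qed
qed

lemma perm_poly_neq_0:
  assumes "inj_on \<sigma> {..<k}" "p \<in> Pol k" "p \<noteq> 0"
  shows "perm_poly \<sigma> p \<noteq> 0"
  using keys_perm_poly[OF assms(1,2)] assms(3) by auto

text \<open>One step of division. The leading terms cancel and every other monomial is smaller;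
  \<open>q = 0\<close> is listed separately because \<open>lm 0\<close> is an unspecified
  monomial.\<close>

lemma lm_reduce:
  assumes "p \<noteq> 0" "h \<noteq> 0" "lm h = lm p"
  defines "q \<equiv> p - scl (lk p (lm p) / lk h (lm h)) h"
  shows "q = 0 \<or> mkey (lm q) < mkey (lm p)"
proof (cases "q = 0")
  case False
  have l0: "lk q (lm p) = 0"
    using lookup_lm[OF assms(2)] by (simp add: q_def lookup_minus assms(3))
  have le: "mkey s \<le> mkey (lm p)" if "s \<in> mkeys q" for s
  proof -
    have "s \<in> mkeys p \<or> s \<in> mkeys h" using that by (auto simp: q_def in_keys_iff lookup_minus)
    then show ?thesis
      using lm_max[OF assms(1), of s] lm_max[OF assms(2), of s] unfolding assms(3) by blast
  qed
  from lm_in[OF False] l0 have "lm q \<noteq> lm p" by (auto simp: in_keys_iff)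
  with le[OF lm_in[OF False]] have "mkey (lm q) < mkey (lm p)"
    by (simp add: order.strict_iff_order mkey_inject)
  then show ?thesis ..
qed (rule disjI1)

section \<open>Higman's lemma for words of natural numbers\<close>

abbreviation emb :: "nat list \<Rightarrow> nat list \<Rightarrow> bool" where
  "emb \<equiv> list_emb (\<le>)"

definition bad :: "(nat \<Rightarrow> nat list) \<Rightarrow> bool" where
  "bad f \<longleftrightarrow> (\<forall>i j. i < j \<longrightarrow> \<not> emb (f i) (f j))"

definition bad_ext :: "nat list list \<Rightarrow> bool" where
  "bad_ext ws \<longleftrightarrow> (\<exists>f. bad f \<and> map f [0..<length ws] = ws)"

text \<open>Nash-Williams' minimal bad sequence: each word has least length among the possible
  continuations of the preceding words.\<close>

fun min_bad :: "nat \<Rightarrow> nat list list" where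
  "min_bad 0 = []"
| "min_bad (Suc n) = min_bad n @
     [arg_min length (\<lambda>w. bad_ext (min_bad n @ [w]))]"

lemma length_min_bad [simp]: "length (min_bad n) = n"
  by (induction n) auto

text \<open>The next word \<open>g n\<close> of a bad sequence g that extends the list is a
  candidate for \<open>arg_min\<close>, so the shortest choice again begins a bad sequence.\<close>

lemma bad_ext_min_bad:
  assumes "bad f"
  shows "bad_ext (min_bad n)"
proof (induction n)
  case 0
  show ?case using assms by (auto simp: bad_ext_def)
next
  case (Suc n)
  then obtain g where g: "bad g" "map g [0..<n] = min_bad n" by (auto simp: bad_ext_def)
  then have "bad_ext (min_bad n @ [g n])" by (auto simp: bad_ext_def intro!: exI[of _ g])
  then show ?case using arg_min_natI[of "\<lambda>w. bad_ext (min_bad n @ [w])" "g n" length] by simp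
qed

lemma min_bad_nth: "i < n \<Longrightarrow> min_bad n ! i = min_bad (Suc i) ! i"
  by (induction n) (auto simp: nth_append less_Suc_eq)

text \<open>A non-increasing sequence of naturals is constant from the point where it attains its
  minimum; this settles the other kind of monotone subsequence.\<close>

lemma mono_subseq_nat:
  fixes f :: "nat \<Rightarrow> nat"
  shows "\<exists>r. strict_mono r \<and> (\<forall>n. f (r n) \<le> f (r (Suc n)))"
proof -
  obtain r where r: "strict_mono r" "monoseq (\<lambda>n. f (r n))" using seq_monosub by metis
  show ?thesis
  proof (cases "\<forall>n. f (r n) \<le> f (r (Suc n))")
    case False
    then have d: "\<forall>m. \<forall>n\<ge>m. f (r n) \<le> f (r m)" using r(2) unfolding monoseq_def by (meson lessI less_imp_le)
    define l where "l = (LEAST v. \<exists>n. f (r n) = v)"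
    have "\<exists>n. f (r n) = l" unfolding l_def by (rule LeastI_ex) auto
    then obtain n0 where n0: "f (r n0) = l" by blast
    have eq: "f (r n) = l" if "n \<ge> n0" for n
      using d[rule_format, OF that] n0 by (auto simp: l_def intro!: antisym Least_le)
    have "strict_mono (\<lambda>n. r (n0 + n))" using r(1) by (simp add: strict_mono_def)
    then show ?thesis using eq by (intro exI[of _ "\<lambda>n. r (n0 + n)"]) auto
  qed (use r in blast)
qed

text \<open>Along r the heads of the minimal words do not decrease, so an embedding between their
  tails extends to the words themselves. Replacing the words from place \<open>r 0\<close> on by
  these tails therefore keeps the sequence bad and shortens the word at place \<open>r 0\<close>,
  against minimality.\<close>

lemma no_bad: "\<not> bad f"
proof
  assume f: "bad f"
  define m where "m i = min_bad (Suc i) ! i" for i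
  have mb: "min_bad n = map m [0..<n]" for n
  proof (rule nth_equalityI)
    fix i assume "i < length (min_bad n)"
    then show "min_bad n ! i = map m [0..<n] ! i"
      using min_bad_nth[of i n] by (simp add: m_def del: min_bad.simps)
  qed simp
  have bad_m: "bad m"
    unfolding bad_def
  proof (intro allI impI)
    fix i j :: nat assume "i < j"
    from bad_ext_min_bad[OF f, of "Suc j"] obtain g
      where g: "bad g" "map g [0..<Suc j] = map m [0..<Suc j]"
      unfolding bad_ext_def mb by auto
    from g(2) \<open>i < j\<close> have "g i = m i" "g j = m j" by (auto simp: map_eq_conv)
    then show "\<not> emb (m i) (m j)" using g(1) \<open>i < j\<close> by (metis bad_def)
  qed
  \<comment> \<open>The empty word embeds in every word and so cannot occur in a bad
    sequence.\<close>
  have ne: "m i \<noteq> []" for i using bad_m[unfolded bad_def, rule_format, of i "Suc i"] by auto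
  obtain r where r: "strict_mono r" "\<And>n. hd (m (r n)) \<le> hd (m (r (Suc n)))"
    using mono_subseq_nat[of "\<lambda>i. hd (m i)"] by auto
  have hd: "hd (m (r i)) \<le> hd (m (r j))" if "i \<le> j" for i j
    using lift_Suc_mono_le[of "\<lambda>n. hd (m (r n))"] r(2) that by auto
  define g where "g i = (if i < r 0 then m i else tl (m (r (i - r 0))))" for i
  have emb_tl: "emb u (m i)" if "emb u (tl (m i))" for u i
    using that ne[of i] by (metis list.collapse list_emb_Cons)
  have rge: "r 0 \<le> r i" for i using r(1) by (simp add: strict_mono_less_eq)
  have "bad g"
    unfolding bad_def
  proof (intro allI impI notI)
    fix i j :: nat assume ij: "i < j" and e: "emb (g i) (g j)"
    consider "j < r 0" | "i < r 0" "\<not> j < r 0" | "\<not> i < r 0" "\<not> j < r 0" using ij by linarith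
    then show False
    proof cases
      case 1
      then show False using ij e bad_m by (auto simp: g_def bad_def)
    next
      case 2
      then have "emb (m i) (m (r (j - r 0)))" using e by (auto simp: g_def intro: emb_tl)
      moreover have "i < r (j - r 0)" using 2 rge[of "j - r 0"] by linarith
      ultimately show False using bad_m by (auto simp: bad_def)
    next
      case 3
      define a b where "a = i - r 0" and "b = j - r 0"
      have ab: "a < b" using 3 ij by (simp add: a_def b_def)
      have "emb (tl (m (r a))) (tl (m (r b)))" using e 3 by (auto simp: g_def a_def b_def)
      then have "emb (hd (m (r a)) # tl (m (r a))) (hd (m (r b)) # tl (m (r b)))"
        using hd[of a b] ab by (intro list_emb_Cons2) auto
      then have "emb (m (r a)) (m (r b))" using ne by simp
      moreover have "r a < r b" using r(1) ab by (simp add: strict_mono_def)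
      ultimately show False using bad_m by (auto simp: bad_def)
    qed
  qed
  moreover have "map g [0..<Suc (r 0)] = min_bad (r 0) @ [tl (m (r 0))]"
    by (auto simp: mb g_def)
  ultimately have "bad_ext (min_bad (r 0) @ [tl (m (r 0))])"
    unfolding bad_ext_def by (intro exI[of _ g]) auto
  then have "length (arg_min length (\<lambda>w. bad_ext (min_bad (r 0) @ [w]))) \<le> length (tl (m (r 0)))"
    by (rule arg_min_nat_le)
  moreover have "m (r 0) = arg_min length (\<lambda>w. bad_ext (min_bad (r 0) @ [w]))"
    by (simp add: m_def nth_append)
  ultimately have le: "length (m (r 0)) \<le> length (tl (m (r 0)))" by (simp only:)
  have "w = []" if "length w \<le> length (tl w)" for w :: "nat list"
    using that by (cases w) auto
  from this[OF le] ne[of "r 0"] show False by blast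
qed

text \<open>Otherwise every finite subset of U leaves some word of U uncovered, and adding such
  words one after the other yields a bad sequence.\<close>

lemma finite_emb_basis:
  fixes U :: "nat list set"
  shows "\<exists>B\<subseteq>U. finite B \<and> (\<forall>v\<in>U. \<exists>u\<in>B. emb u v)"
proof (rule ccontr)
  assume no: "\<not> ?thesis"
  have "\<exists>v. v \<in> U \<and> (\<forall>u\<in>B. \<not> emb u v)" if "B \<subseteq> U" "finite B" for B
  proof (rule ccontr)
    assume "\<not> ?thesis"
    then have "\<forall>v\<in>U. \<exists>u\<in>B. emb u v" by auto
    with that have "\<exists>B\<subseteq>U. finite B \<and> (\<forall>v\<in>U. \<exists>u\<in>B. emb u v)"
      by (intro exI[of _ B] conjI)
    with no show False ..
  qed
  then obtain pick where pick: "\<And>B. B \<subseteq> U \<Longrightarrow> finite B \<Longrightarrow> pick B \<in> U \<and> (\<forall>u\<in>B. \<not> emb u (pick B))"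
    by metis
  define B where "B = rec_nat {} (\<lambda>_ B. insert (pick B) B)"
  have B: "B 0 = {}" "B (Suc n) = insert (pick (B n)) (B n)" for n by (auto simp: B_def)
  have fB: "B n \<subseteq> U \<and> finite (B n)" for n by (induction n) (use B pick in auto)
  have "pick (B i) \<in> B j" if "i < j" for i j
    using that by (induction j) (auto simp: B less_Suc_eq)
  then have "bad (\<lambda>i. pick (B i))"
    unfolding bad_def using pick fB by blast
  then show False using no_bad by blast
qed

section \<open>Increasing maps\<close>

lemma ex_increasing_enum:
  fixes B :: "nat set"
  assumes "finite B" "card B = b"
  shows "\<exists>\<theta>. strict_mono_on {..<b} \<theta> \<and> \<theta> ` {..<b} = B"
proof (intro exI conjI)
  show sm: "strict_mono_on {..<b} (enumerate B)"
    using assms by (auto intro!: strict_mono_onI finite_enumerate_mono)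
  have "enumerate B ` {..<b} \<subseteq> B" using assms finite_enumerate_in_set by blast
  moreover have "card (enumerate B ` {..<b}) = b"
    using strict_mono_on_imp_inj_on[OF sm] by (simp add: card_image)
  ultimately show "enumerate B ` {..<b} = B" using assms by (metis card_subset_eq)
qed

lemma increasing_factor:
  fixes \<theta> \<pi> :: "nat \<Rightarrow> nat"
  assumes \<theta>: "strict_mono_on {..<b} \<theta>" and \<pi>: "strict_mono_on {..<a} \<pi>" and sub: "\<pi> ` {..<a} \<subseteq> \<theta> ` {..<b}"
  shows "\<exists>\<rho>. strict_mono_on {..<a} \<rho> \<and> \<rho> ` {..<a} \<subseteq> {..<b} \<and> (\<forall>i<a. \<theta> (\<rho> i) = \<pi> i)"
proof -
  have "\<forall>i<a. \<exists>j<b. \<theta> j = \<pi> i" using sub by (force simp: image_iff)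
  then obtain \<rho> where \<rho>: "\<And>i. i < a \<Longrightarrow> \<rho> i < b \<and> \<theta> (\<rho> i) = \<pi> i" by metis
  have "strict_mono_on {..<a} \<rho>"
  proof (rule strict_mono_onI)
    fix i j assume ij: "i \<in> {..<a}" "j \<in> {..<a}" "i < j"
    then have "\<theta> (\<rho> i) < \<theta> (\<rho> j)" using \<rho> \<pi> by (auto simp: strict_mono_on_def)
    then show "\<rho> i < \<rho> j"
      using \<rho>[of i] \<rho>[of j] ij strict_mono_on_less[OF \<theta>, of "\<rho> i" "\<rho> j"] by auto
  qed
  with \<rho> show ?thesis by (intro exI[of _ \<rho>]) auto
qed

text \<open>Domain and image have complements of equal size in \<open>{..<n}\<close>, and any
  bijection between these completes \<pi>. Closure under permutations of finitely many indices thus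
  takes care of injections, in particular of increasing maps.\<close>

lemma extend_to_permutation:
  fixes \<pi> :: "nat \<Rightarrow> nat"
  assumes "inj_on \<pi> {..<k}" "\<pi> ` {..<k} \<subseteq> {..<n}"
  shows "\<exists>\<sigma>. \<sigma> permutes {..<n} \<and> (\<forall>i<k. \<sigma> i = \<pi> i)"
proof -
  have c: "card (\<pi> ` {..<k}) = k" using assms(1) by (simp add: card_image)
  then have kn: "k \<le> n" using card_mono[OF _ assms(2)] by simp
  have "card ({..<n} - {..<k}) = card ({..<n} - \<pi> ` {..<k})"
    using kn assms(2) c by (simp add: card_Diff_subset)
  then obtain h where h: "bij_betw h ({..<n} - {..<k}) ({..<n} - \<pi> ` {..<k})"
    using finite_same_card_bij[of "{..<n} - {..<k}" "{..<n} - \<pi> ` {..<k}"] by blast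
  define \<sigma> where "\<sigma> i = (if i < k then \<pi> i else if i < n then h i else i)" for i
  have "bij_betw \<sigma> {..<k} (\<pi> ` {..<k})"
    using assms(1) by (subst bij_betw_cong[of _ _ \<pi>]) (auto simp: \<sigma>_def bij_betw_def)
  moreover have "bij_betw \<sigma> ({..<n} - {..<k}) ({..<n} - \<pi> ` {..<k})"
    by (subst bij_betw_cong[of _ _ h]) (use h in \<open>auto simp: \<sigma>_def\<close>)
  ultimately have "bij_betw \<sigma> ({..<k} \<union> ({..<n} - {..<k})) (\<pi> ` {..<k} \<union> ({..<n} - \<pi> ` {..<k}))"
    by (rule bij_betw_combine) blast
  moreover have "{..<k} \<union> ({..<n} - {..<k}) = {..<n}" "\<pi> ` {..<k} \<union> ({..<n} - \<pi> ` {..<k}) = {..<n}"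
    using kn assms(2) by auto
  ultimately have "bij_betw \<sigma> {..<n} {..<n}" by simp
  then have "\<sigma> permutes {..<n}"
    by (rule bij_imp_permutes) (use kn in \<open>auto simp: \<sigma>_def\<close>)
  then show ?thesis by (intro exI[of _ \<sigma>]) (auto simp: \<sigma>_def)
qed

text \<open>Links Higman's order to index maps. In the converse direction the first letter of the
  long word is used for the first letter of xs if \<open>\<pi> 0 = 0\<close> and is skipped
  otherwise; in both cases \<pi> then moves down by one.\<close>

lemma emb_iff_increasing:
  "emb xs ys \<longleftrightarrow> (\<exists>\<pi>. strict_mono_on {..<length xs} \<pi> \<and> \<pi> ` {..<length xs} \<subseteq> {..<length ys} \<and>
     (\<forall>i<length xs. xs ! i \<le> ys ! \<pi> i))" (is "_ \<longleftrightarrow> (\<exists>\<pi>. ?P xs ys \<pi>)")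
proof
  assume "emb xs ys"
  then show "\<exists>\<pi>. ?P xs ys \<pi>"
  proof induction
    case (list_emb_Nil ys)
    show ?case by (auto simp: strict_mono_on_def)
  next
    case (list_emb_Cons xs ys y)
    then obtain \<pi> where "?P xs ys \<pi>" by blast
    then show ?case by (intro exI[of _ "\<lambda>i. Suc (\<pi> i)"]) (auto simp: strict_mono_on_def)
  next
    case (list_emb_Cons2 x y xs ys)
    then obtain \<pi> where "?P xs ys \<pi>" by blast
    with list_emb_Cons2.hyps show ?case
      by (intro exI[of _ "\<lambda>i. case i of 0 \<Rightarrow> 0 | Suc j \<Rightarrow> Suc (\<pi> j)"])
        (auto simp: strict_mono_on_def image_subset_iff less_Suc_eq_0_disj split: nat.splits)
  qed
next
  assume "\<exists>\<pi>. ?P xs ys \<pi>"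
  then obtain \<pi> where "?P xs ys \<pi>" by blast
  then show "emb xs ys"
  proof (induction ys arbitrary: xs \<pi>)
    case Nil
    then show ?case by (cases xs) auto
  next
    case (Cons y ys)
    show ?case
    proof (cases xs)
      case xs: (Cons x xs')
      have lt: "\<pi> i < \<pi> j" if "i < j" "j < length xs" for i j
        using Cons.prems that by (auto simp: strict_mono_on_def)
      have bd: "\<pi> i < Suc (length ys)" if "i < length xs" for i using Cons.prems that by auto
      show ?thesis
      proof (cases "\<pi> 0")
        case 0
        have pos: "0 < \<pi> (Suc i)" if "i < length xs'" for i using lt[of 0 "Suc i"] that xs by auto
        have "?P xs' ys (\<lambda>i. \<pi> (Suc i) - 1)"
        proof (intro conjI)
          show "strict_mono_on {..<length xs'} (\<lambda>i. \<pi> (Suc i) - 1)"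
          proof (rule strict_mono_onI)
            fix i j assume "i \<in> {..<length xs'}" "j \<in> {..<length xs'}" "i < j"
            then show "\<pi> (Suc i) - 1 < \<pi> (Suc j) - 1"
              using pos[of i] lt[of "Suc i" "Suc j"] xs by auto
          qed
          show "(\<lambda>i. \<pi> (Suc i) - 1) ` {..<length xs'} \<subseteq> {..<length ys}"
            using bd pos xs by fastforce
          show "\<forall>i<length xs'. xs' ! i \<le> ys ! (\<pi> (Suc i) - 1)"
          proof (intro allI impI)
            fix i assume i: "i < length xs'"
            then have "xs ! Suc i \<le> (y # ys) ! \<pi> (Suc i)" using Cons.prems xs by auto
            then show "xs' ! i \<le> ys ! (\<pi> (Suc i) - 1)" using pos[OF i] xs by (simp add: nth_Cons')
          qed
        qed
        then have "emb xs' ys" by (rule Cons.IH)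
        moreover have "x \<le> y" using Cons.prems xs 0 by force
        ultimately show ?thesis unfolding xs by (rule list_emb_Cons2[rotated])
      next
        case (Suc p)
        have pos: "0 < \<pi> i" if "i < length xs" for i
          using lt[of 0 i] that Suc by (cases i) auto
        have "?P xs ys (\<lambda>i. \<pi> i - 1)"
        proof (intro conjI)
          show "strict_mono_on {..<length xs} (\<lambda>i. \<pi> i - 1)"
          proof (rule strict_mono_onI)
            fix i j assume "i \<in> {..<length xs}" "j \<in> {..<length xs}" "i < j"
            then show "\<pi> i - 1 < \<pi> j - 1" using pos[of i] lt[of i j] by auto
          qed
          show "(\<lambda>i. \<pi> i - 1) ` {..<length xs} \<subseteq> {..<length ys}"
            using bd pos by fastforce
          show "\<forall>i<length xs. xs ! i \<le> ys ! (\<pi> i - 1)"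
          proof (intro allI impI)
            fix i assume i: "i < length xs"
            then have "xs ! i \<le> (y # ys) ! \<pi> i" using Cons.prems by auto
            then show "xs ! i \<le> ys ! (\<pi> i - 1)" using pos[OF i] by (simp add: nth_Cons')
          qed
        qed
        then show ?thesis by (intro list_emb_Cons Cons.IH)
      qed
    qed simp
  qed
qed

section \<open>Truncations of a symmetric ideal\<close>

text \<open>A single parameter bounds the number of indeterminates and the degree: each box has
  finite dimension, and every polynomial lies in all large boxes.\<close>

definition Box :: "nat \<Rightarrow> 'a::field mpoly set" where
  "Box k = {p. \<forall>m\<in>mkeys p. m \<in> Mon k \<and> tdeg m \<le> k}"

inductive_set trunc :: "'a::field mpoly set \<Rightarrow> nat \<Rightarrow> 'a mpoly set" for F k where
  zero: "0 \<in> trunc F k"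
| gen: "f \<in> F \<Longrightarrow> f \<in> Box k \<Longrightarrow> f \<in> trunc F k"
| add: "f \<in> trunc F k \<Longrightarrow> g \<in> trunc F k \<Longrightarrow> f + g \<in> trunc F k"
| scl: "f \<in> trunc F k \<Longrightarrow> scl c f \<in> trunc F k"
| mult: "f \<in> trunc F k \<Longrightarrow> j < k \<Longrightarrow> sg (sg j 1) 1 * f \<in> Box k \<Longrightarrow> sg (sg j 1) 1 * f \<in> trunc F k"
| perm: "f \<in> trunc F k \<Longrightarrow> \<sigma> permutes {..<k} \<Longrightarrow> perm_poly \<sigma> f \<in> trunc F k"

lemma Box_Pol: "p \<in> Box k \<Longrightarrow> p \<in> Pol k"
  by (auto simp: Box_def Pol_def)

lemma Box_iff_lm: "p \<noteq> 0 \<Longrightarrow> p \<in> Box k \<longleftrightarrow> p \<in> Pol k \<and> tdeg (lm p) \<le> k"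
  unfolding Box_def Pol_def
  using lm_in[of p] lm_max[of p] by (fastforce dest: mkey_le_tdeg)

lemma Box_mono: "p \<in> Box k \<Longrightarrow> k \<le> l \<Longrightarrow> p \<in> Box l"
  by (auto simp: Box_def intro: Mon_mono)

lemma subspace_Box: "mp.subspace (Box k)"
  unfolding mp.subspace_def Box_def
  by (auto simp: in_keys_iff lookup_add)

lemma Box_perm_poly:
  assumes "inj_on \<pi> {..<k}" "\<pi> ` {..<k} \<subseteq> {..<n}" "k \<le> n" "p \<in> Box k"
  shows "perm_poly \<pi> p \<in> Box n"
proof -
  have "perm_mon \<pi> m \<in> Mon n" if "m \<in> Mon k" for m
    using that by (rule perm_mon_in_Mon) (use assms(2) in auto)
  then show ?thesis
    using assms(3,4) keys_perm_poly[OF assms(1) Box_Pol[OF assms(4)]]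
    by (auto simp: Box_def intro: order_trans)
qed

lemma trunc_Box: "f \<in> trunc F k \<Longrightarrow> f \<in> Box k"
proof (induction rule: trunc.induct)
  case (perm f \<sigma>)
  then show ?case
    using permutes_image[OF perm(2)] permutes_inj_on[OF perm(2)] by (intro Box_perm_poly[of _ k]) auto
qed (auto intro: mp.subspace_0 mp.subspace_add mp.subspace_scale subspace_Box)

lemma subspace_trunc: "mp.subspace (trunc F k)"
  by (auto simp: mp.subspace_def intro: trunc.intros)

lemma trunc_mono: "f \<in> trunc F k \<Longrightarrow> k \<le> l \<Longrightarrow> f \<in> trunc F l"
proof (induction rule: trunc.induct)
  case (perm f \<sigma>)
  then have "\<sigma> permutes {..<l}" by (auto intro: permutes_subset)
  with perm show ?case by (auto intro: trunc.perm)
next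
  case (mult f j)
  then show ?case by (intro trunc.mult) (auto intro: Box_mono simp del: One_nat_def)
qed (auto intro: trunc.intros Box_mono)

lemma trunc_perm_poly:
  assumes "inj_on \<pi> {..<k}" "\<pi> ` {..<k} \<subseteq> {..<n}" "f \<in> trunc F k"
  shows "perm_poly \<pi> f \<in> trunc F n"
proof -
  have "k \<le> n" using card_image[OF assms(1)] card_mono[OF _ assms(2)] by simp
  obtain \<sigma> where \<sigma>: "\<sigma> permutes {..<n}" "\<And>i. i < k \<Longrightarrow> \<sigma> i = \<pi> i"
    using extend_to_permutation[OF assms(1,2)] by blast
  have "perm_poly \<pi> f = perm_poly \<sigma> f"
    by (rule perm_poly_cong[OF Box_Pol[OF trunc_Box[OF assms(3)]]]) (simp add: \<sigma>(2))
  then show ?thesis using trunc.perm[OF trunc_mono[OF assms(3) \<open>k \<le> n\<close>] \<sigma>(1)] by simp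
qed

text \<open>Multiply by one indeterminate at a time. Divisors of monomials of the box lie in the
  box, so no intermediate product leaves it.\<close>

lemma trunc_mult_mon:
  assumes "f \<in> trunc F k" "sg m 1 * f \<in> Box k"
  shows "sg m 1 * f \<in> trunc F k"
  using assms(2)
proof (induction "tdeg m" arbitrary: m)
  case 0
  then have "m = 0" by (auto intro!: poly_mapping_eqI simp: multiset_eq_iff)
  with assms(1) show ?case by simp
next
  case (Suc d)
  show ?case
  proof (cases "f = 0")
    case True
    then show ?thesis by (simp add: trunc.zero)
  next
    case False
    from Suc(2) have "mset_of_mon m \<noteq> {#}" by auto
    then obtain j where j: "j \<in> mkeys m" by (metis multiset_nonemptyE set_mset_of_mon)
    define m' where "m' = m - sg j 1"
    have m: "m = sg j 1 + m'"
      by (rule poly_mapping_eqI)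
        (use j in \<open>auto simp: m'_def lookup_add lookup_minus lookup_single when_def in_keys_iff\<close>)
    have "tdeg (sg j 1) = 1" by (simp add: mset_of_mon_single)
    then have d: "d = tdeg m'" using Suc(2) by (simp add: m tdeg_add)
    have eq: "sg m 1 * f = sg (sg j 1) 1 * (sg m' 1 * f)"
      by (simp add: m mult_single flip: mult.assoc)
    have km: "m + s \<in> Mon k" "tdeg (m + s) \<le> k" if "s \<in> mkeys f" for s
      using Suc.prems that by (auto simp: Box_def keys_sg_mult)
    have "sg m' 1 * f \<in> Box k"
      unfolding Box_def using km by (force simp: keys_sg_mult m tdeg_add Mon_add_iff)
    with d Suc(1) have "sg m' 1 * f \<in> trunc F k" by blast
    moreover have "m \<in> Mon k" using km(1)[OF lm_in[OF False]] by (simp add: Mon_add_iff)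
    then have "j < k" using j by (auto simp: Mon_def)
    ultimately show ?thesis using Suc.prems unfolding eq by (intro trunc.mult)
  qed
qed

lemma symmetric_ideal_span: "symmetric_ideal (group_ring_span F)"
proof -
  have "group_ring_submodule (group_ring_submodule hull F)"
    by (rule hull_in) (auto simp: group_ring_submodule_def)
  then show ?thesis
    by (simp add: group_ring_span_def group_ring_submodule_iff_symmetric_ideal)
qed

lemma trunc_subset_span: "f \<in> trunc F k \<Longrightarrow> f \<in> group_ring_span F"
proof (induction rule: trunc.induct)
  case (gen f)
  show ?case unfolding group_ring_span_def using gen(1) by (rule hull_inc)
next
  case (perm f \<sigma>)
  then show ?case using symmetric_ideal_span permutes_bij by (metis symmetric_ideal_def)
qed (use symmetric_ideal_span[of F] in \<open>auto simp: symmetric_ideal_def scl_def\<close>)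

section \<open>Leading monomials and Buchberger's criterion\<close>

definition LM :: "'a::field mpoly set \<Rightarrow> monomial set" where
  "LM W = lm ` (W - {0})"

text \<open>The set A grades the relation. For monomials in the first k indeterminates,
  \<open>{..<k}\<close> leaves only the identity and hence plain divisibility;
  \<open>{..<2 * k}\<close> serves for stability and \<open>UNIV\<close> for the whole
  ideal.\<close>

definition covers :: "nat \<Rightarrow> nat set \<Rightarrow> monomial \<Rightarrow> monomial \<Rightarrow> bool" where
  "covers k A u v \<longleftrightarrow>
     (\<exists>\<pi> m. strict_mono_on {..<k} \<pi> \<and> \<pi> ` {..<k} \<subseteq> A \<and> v = m + perm_mon \<pi> u)"

definition covered :: "nat \<Rightarrow> nat set \<Rightarrow> monomial set \<Rightarrow> monomial set \<Rightarrow> bool" where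
  "covered k A U W \<longleftrightarrow> (\<forall>v\<in>W. \<exists>u\<in>U. covers k A u v)"

definition stable :: "'a::field mpoly set \<Rightarrow> nat \<Rightarrow> bool" where
  "stable F k \<longleftrightarrow> covered k {..<2 * k} (LM (trunc F k)) (LM (trunc F (2 * k)))"

text \<open>If p lies in the span for \<open>T = {..mkey (lm p)}\<close>, it has a standard
  representation in the sense of Groebner bases: no summand has a leading monomial above that of p.
  Sets T allow weak and strict bounds alike.\<close>

definition prods ::
    "'a::field mpoly set \<Rightarrow> nat \<Rightarrow> nat set \<Rightarrow> (nat \<times> nat multiset) set \<Rightarrow> 'a mpoly set" where
  "prods F k A T = {sg m 1 * perm_poly \<pi> g | m \<pi> g. g \<in> trunc F k \<and> g \<noteq> 0 \<and> mkeys m \<subseteq> A \<and>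
     strict_mono_on {..<k} \<pi> \<and> \<pi> ` {..<k} \<subseteq> A \<and> mkey (m + perm_mon \<pi> (lm g)) \<in> T}"

lemma prodsI:
  assumes "g \<in> trunc F k" "g \<noteq> 0" "mkeys m \<subseteq> A" "strict_mono_on {..<k} \<pi>" "\<pi> ` {..<k} \<subseteq> A"
    "mkey (m + perm_mon \<pi> (lm g)) \<in> T"
  shows "sg m 1 * perm_poly \<pi> g \<in> prods F k A T"
  unfolding prods_def using assms by (intro CollectI exI[of _ m] exI[of _ \<pi>] exI[of _ g]) simp

lemma prodsE:
  assumes "p \<in> prods F k A T"
  obtains m \<pi> g where "p = sg m 1 * perm_poly \<pi> g" "g \<in> trunc F k" "g \<noteq> 0" "mkeys m \<subseteq> A"
    "strict_mono_on {..<k} \<pi>" "\<pi> ` {..<k} \<subseteq> A" "mkey (m + perm_mon \<pi> (lm g)) \<in> T"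
  using assms unfolding prods_def by (elim CollectE exE conjE)

lemma prods_mono: "A \<subseteq> A' \<Longrightarrow> T \<subseteq> T' \<Longrightarrow> prods F k A T \<subseteq> prods F k A' T'"
  by (rule subsetI) (auto elim!: prodsE intro!: prodsI)

lemma prods_Un: "prods F k A (S \<union> T) = prods F k A S \<union> prods F k A T"
  by (auto elim!: prodsE intro!: prodsI)

lemma lm_prod:
  assumes "strict_mono_on {..<k} \<pi>" "g \<in> trunc F k" "g \<noteq> 0"
  shows "sg m 1 * perm_poly \<pi> g \<noteq> 0" "lm (sg m 1 * perm_poly \<pi> g) = m + perm_mon \<pi> (lm g)"
proof -
  note g = Box_Pol[OF trunc_Box[OF assms(2)]]
  have nz: "perm_poly \<pi> g \<noteq> 0"
    using strict_mono_on_imp_inj_on[OF assms(1)] g assms(3) by (rule perm_poly_neq_0)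
  then show "sg m 1 * perm_poly \<pi> g \<noteq> 0" by (rule sg_mult_neq_0) simp
  show "lm (sg m 1 * perm_poly \<pi> g) = m + perm_mon \<pi> (lm g)"
    using lm_perm_poly[OF assms(1) g assms(3)] nz by (simp add: lm_sg_mult)
qed

section \<open>Division by products\<close>

lemma Pol_sg_mult: "m \<in> Mon k \<Longrightarrow> p \<in> Pol k \<Longrightarrow> sg m c * p \<in> Pol k"
  by (auto simp: Pol_def keys_sg_mult Mon_add_iff)

lemma Pol_perm_poly:
  assumes "inj_on \<pi> {..<k}" "\<pi> ` {..<k} \<subseteq> {..<n}" "p \<in> Pol k"
  shows "perm_poly \<pi> p \<in> Pol n"
proof -
  have "perm_mon \<pi> m \<in> Mon n" if "m \<in> Mon k" for m
    using that by (rule perm_mon_in_Mon) (use assms(2) in auto)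
  then show ?thesis
    using assms(3) keys_perm_poly[OF assms(1,3)] by (auto simp: Pol_def)
qed

lemma prod_in_trunc:
  assumes \<pi>: "strict_mono_on {..<k} \<pi>" "\<pi> ` {..<k} \<subseteq> {..<n}" and g: "g \<in> trunc F k" "g \<noteq> 0"
    and m: "m \<in> Mon n" and d: "tdeg (m + perm_mon \<pi> (lm g)) \<le> n"
  shows "sg m 1 * perm_poly \<pi> g \<in> trunc F n"
proof (rule trunc_mult_mon)
  note inj = strict_mono_on_imp_inj_on[OF \<pi>(1)]
  show "perm_poly \<pi> g \<in> trunc F n" by (rule trunc_perm_poly[OF inj \<pi>(2) g(1)])
  show "sg m 1 * perm_poly \<pi> g \<in> Box n"
    unfolding Box_iff_lm[OF lm_prod(1)[OF \<pi>(1) g]] lm_prod(2)[OF \<pi>(1) g]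
    using d Pol_sg_mult[OF m Pol_perm_poly[OF inj \<pi>(2) Box_Pol[OF trunc_Box[OF g(1)]]]] by blast
qed

lemma Box_LM: "W \<subseteq> Box n \<Longrightarrow> v \<in> LM W \<Longrightarrow> v \<in> Mon n \<and> tdeg v \<le> n"
  by (auto simp: LM_def Box_def dest!: lm_in)

text \<open>Division algorithm. Each subtracted product has the leading monomial of an element of W,
  hence of \<open>Box n\<close>, so it stays in \<open>trunc F n\<close>. The space W is arbitrary
  because the division treats not only \<open>trunc F (2 * k)\<close> but also the truncation
  enlarged by f.\<close>

lemma covered_reduce:
  assumes W: "mp.subspace W" "W \<subseteq> Box n" "trunc F n \<subseteq> W"
    and cov: "covered k {..<n} (LM (trunc F k)) (LM W)"
    and p: "p \<in> W" "p \<noteq> 0"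
  shows "p \<in> mp.span (prods F k {..<n} {..mkey (lm p)}) \<inter> trunc F n"
  using p
proof (induction "mkey (lm p)" arbitrary: p rule: less_induct)
  case less
  let ?P = "\<lambda>p. prods F k {..<n} {..mkey (lm p)}"
  have v: "lm p \<in> LM W" using less.prems by (auto simp: LM_def)
  with cov obtain g \<pi> m where g: "g \<in> trunc F k" "g \<noteq> 0" and \<pi>: "strict_mono_on {..<k} \<pi>" "\<pi> ` {..<k} \<subseteq> {..<n}"
    and lmp: "lm p = m + perm_mon \<pi> (lm g)"
    unfolding covered_def covers_def LM_def by blast
  from Box_LM[OF W(2) v] have m: "m \<in> Mon n" and d: "tdeg (m + perm_mon \<pi> (lm g)) \<le> n"
    by (auto simp: lmp Mon_add_iff)
  define h where "h = sg m 1 * perm_poly \<pi> g"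
  have h: "h \<noteq> 0" "lm h = lm p" using lm_prod[OF \<pi>(1) g] by (auto simp: h_def lmp)
  have hV: "h \<in> trunc F n" unfolding h_def by (rule prod_in_trunc[OF \<pi> g m d])
  have hP: "h \<in> ?P p"
    unfolding h_def using g \<pi> m by (intro prodsI) (auto simp: Mon_def simp flip: lmp)
  define c where "c = lk p (lm p) / lk h (lm h)"
  define q where "q = p - scl c h"
  have pq: "p = q + scl c h" by (simp add: q_def)
  have q: "q = 0 \<or> mkey (lm q) < mkey (lm p)"
    unfolding q_def c_def by (rule lm_reduce) (use h less.prems in auto)
  have "q \<in> W"
    unfolding q_def using W hV less.prems by (auto intro!: mp.subspace_diff mp.subspace_scale)
  have "q \<in> mp.span (?P p) \<inter> trunc F n"
  proof (cases "q = 0")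
    case True
    then show ?thesis by (simp add: mp.span_zero trunc.zero)
  next
    case False
    with q have lt: "mkey (lm q) < mkey (lm p)" by blast
    from less.hyps[OF lt \<open>q \<in> W\<close> False] show ?thesis
      using subsetD[OF mp.span_mono[OF prods_mono[of "{..<n}" "{..<n}" "{..mkey (lm q)}" "{..mkey (lm p)}" F k]]]
        less_imp_le[OF lt] by simp
  qed
  then have "q + scl c h \<in> mp.span (?P p) \<inter> trunc F n"
    by (auto intro: mp.span_add mp.span_scale mp.span_base hP trunc.add trunc.scl hV)
  then show ?case by (simp only: pq[symmetric])
qed

lemma covered_imp_eq_trunc:
  assumes "mp.subspace W" "W \<subseteq> Box n" "trunc F n \<subseteq> W"
    and "covered n {..<n} (LM (trunc F n)) (LM W)"
  shows "W = trunc F n"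
  using covered_reduce[OF assms] assms(3) trunc.zero by blast

section \<open>S-polynomials\<close>

lemma perm_mon_minus_mon:
  fixes a b :: monomial
  shows "a + (b - a) = b + (a - b)"
  by (rule poly_mapping_eqI) (simp add: lookup_add lookup_minus)

text \<open>Increasing maps compose, so products go to products; the comparison of leading monomials
  enters only through T and T'.\<close>

lemma span_image_prods:
  assumes \<theta>: "strict_mono_on {..<n} \<theta>" and T: "\<And>s. s \<in> Mon n \<Longrightarrow> mkey s \<in> T \<Longrightarrow> mkey (m0 + perm_mon \<theta> s) \<in> T'"
    and p: "p \<in> mp.span (prods F k {..<n} T)"
  shows "sg m0 1 * perm_poly \<theta> p \<in> mp.span (prods F k UNIV T')"
  using p
proof (induction rule: mp.span_induct_alt)
  case (step c b q)
  from step(1) obtain m \<pi> g where b: "b = sg m 1 * perm_poly \<pi> g" and g: "g \<in> trunc F k" "g \<noteq> 0"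
    and m: "mkeys m \<subseteq> {..<n}" and \<pi>: "strict_mono_on {..<k} \<pi>" "\<pi> ` {..<k} \<subseteq> {..<n}"
    and t: "mkey (m + perm_mon \<pi> (lm g)) \<in> T"
    by (rule prodsE)
  have eq: "sg m0 1 * perm_poly \<theta> b = sg (m0 + perm_mon \<theta> m) 1 * perm_poly (\<theta> \<circ> \<pi>) g"
    by (simp add: b perm_poly_sg_mult perm_poly_comp mult_single flip: mult.assoc)
  have "perm_mon \<pi> (lm g) \<in> Mon n"
  proof (rule perm_mon_in_Mon)
    show "lm g \<in> Mon k" using trunc_Box[OF g(1)] lm_in[OF g(2)] by (auto simp: Box_def)
  qed (use \<pi>(2) in auto)
  then have "m + perm_mon \<pi> (lm g) \<in> Mon n" using m by (simp add: Mon_add_iff) (simp add: Mon_def)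
  from T[OF this t] have "mkey ((m0 + perm_mon \<theta> m) + perm_mon (\<theta> \<circ> \<pi>) (lm g)) \<in> T'"
    by (simp add: perm_mon_add perm_mon_comp add.assoc)
  moreover have "strict_mono_on {..<k} (\<theta> \<circ> \<pi>)"
  proof (rule strict_mono_onI)
    fix i j assume "i \<in> {..<k}" "j \<in> {..<k}" "i < j"
    then show "(\<theta> \<circ> \<pi>) i < (\<theta> \<circ> \<pi>) j"
      using strict_mono_onD[OF \<pi>(1), of i j] strict_mono_onD[OF \<theta>, of "\<pi> i" "\<pi> j"] \<pi>(2) by auto
  qed
  ultimately have "sg m0 1 * perm_poly \<theta> b \<in> prods F k UNIV T'"
    unfolding eq using g by (intro prodsI) auto
  then have "scl c (sg m0 1 * perm_poly \<theta> b) \<in> mp.span (prods F k UNIV T')"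
    by (intro mp.span_scale mp.span_base)
  with step(2) show ?case
    by (simp add: perm_poly_add perm_poly_scl distrib_left mp.span_add flip: scl_mult)
qed (simp add: mp.span_zero)

text \<open>The S-polynomial of two multiples involves at most \<open>2 * k\<close> indices and, up to an increasing
  map and a monomial factor, has degree at most \<open>2 * k\<close>, so that stability applies to it.\<close>

lemma S_poly_in_span:
  assumes st: "stable F k"
    and g: "g \<in> trunc F k" "g \<noteq> 0" and h: "h \<in> trunc F k" "h \<noteq> 0"
    and \<pi>: "strict_mono_on {..<k} \<pi>" and \<rho>: "strict_mono_on {..<k} \<rho>"
    and eq: "m + perm_mon \<pi> (lm g) = m' + perm_mon \<rho> (lm h)"
  shows "sg m 1 * perm_poly \<pi> g - scl (lk g (lm g) / lk h (lm h)) (sg m' 1 * perm_poly \<rho> h)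
    \<in> mp.span (prods F k UNIV {..<mkey (m + perm_mon \<pi> (lm g))})"
proof -
  \<comment> \<open>The images of \<pi> and \<rho> together have at most \<open>2 * k\<close>
    indices. Padding A to exactly \<open>2 * k\<close> lets both maps factor through one increasing
    enumeration \<theta>.\<close>
  define A where "A = \<pi> ` {..<k} \<union> \<rho> ` {..<k}"
  have "card A \<le> 2 * k"
    unfolding A_def using add_mono[OF card_image_le[of "{..<k}" \<pi>] card_image_le[of "{..<k}" \<rho>]]
    by (intro order_trans[OF card_Un_le]) simp
  moreover have "2 * k \<le> card (A \<union> {..<2 * k})"
    using card_mono[of "A \<union> {..<2 * k}" "{..<2 * k}"] by (simp add: A_def)
  ultimately obtain B where B: "A \<subseteq> B" "card B = 2 * k" "finite B"
    using exists_subset_between[of A "2 * k" "A \<union> {..<2 * k}"] finite_subset[of _ "A \<union> {..<2 * k}"]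
    by (auto simp: A_def)
  obtain \<theta> where \<theta>: "strict_mono_on {..<2 * k} \<theta>" "\<theta> ` {..<2 * k} = B"
    using ex_increasing_enum[OF B(3,2)] by blast
  have "\<pi> ` {..<k} \<subseteq> \<theta> ` {..<2 * k}" "\<rho> ` {..<k} \<subseteq> \<theta> ` {..<2 * k}"
    using B(1) \<theta>(2) by (auto simp: A_def)
  then obtain \<pi>' \<rho>' where
    \<pi>': "strict_mono_on {..<k} \<pi>'" "\<pi>' ` {..<k} \<subseteq> {..<2 * k}" "\<And>i. i < k \<Longrightarrow> \<theta> (\<pi>' i) = \<pi> i" and
    \<rho>': "strict_mono_on {..<k} \<rho>'" "\<rho>' ` {..<k} \<subseteq> {..<2 * k}" "\<And>i. i < k \<Longrightarrow> \<theta> (\<rho>' i) = \<rho> i"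
    using increasing_factor[OF \<theta>(1) \<pi>] increasing_factor[OF \<theta>(1) \<rho>] by metis
  note inj = strict_mono_on_imp_inj_on[OF \<theta>(1)]
  have gh: "g \<in> Pol k" "h \<in> Pol k" using g h trunc_Box Box_Pol by blast+
  have lgh: "lm g \<in> Mon k" "tdeg (lm g) \<le> k" "lm h \<in> Mon k" "tdeg (lm h) \<le> k"
    using g h trunc_Box lm_in by (fastforce simp: Box_def)+
  define a b where "a = perm_mon \<pi>' (lm g)" and "b = perm_mon \<rho>' (lm h)"
  have ab: "a \<in> Mon (2 * k)" "b \<in> Mon (2 * k)"
    unfolding a_def b_def using \<pi>'(2) \<rho>'(2) lgh by (auto intro!: perm_mon_in_Mon)
  have \<theta>a: "perm_mon \<theta> a = perm_mon \<pi> (lm g)" and \<theta>b: "perm_mon \<theta> b = perm_mon \<rho> (lm h)"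
    unfolding a_def b_def perm_mon_comp using lgh \<pi>'(3) \<rho>'(3) by (auto intro!: perm_mon_cong)
  have diff: "b - a \<in> Mon (2 * k)" "a - b \<in> Mon (2 * k)"
    using ab by (auto intro!: MonI simp: lookup_minus Mon_lookup)
  \<comment> \<open>Subtraction of exponents is truncated, so w is the least common multiple of a
    and b. Its degree is at most the sum of theirs, which gives the bound
    \<open>2 * k\<close>.\<close>
  define w where "w = (b - a) + a"
  have w': "w = (a - b) + b" using perm_mon_minus_mon[of a b] by (simp add: w_def ac_simps)
  have wM: "w \<in> Mon (2 * k)" using ab diff by (simp add: w_def Mon_add_iff)
  have "tdeg (b - a) \<le> tdeg b"
    by (intro size_mset_mono mset_subset_eqI) (simp add: lookup_minus)
  then have wd: "tdeg w \<le> 2 * k" using lgh by (simp add: w_def tdeg_add a_def b_def)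
  \<comment> \<open>The given common multiple is the image of w times m0. Off the image of \<theta>
    nothing is subtracted; on it, \<open>eq\<close> forces m to contain the excess of b over
    a.\<close>
  define m0 where "m0 = m - perm_mon \<theta> (b - a)"
  have ge: "lk (perm_mon \<theta> (b - a)) i \<le> lk m i" "lk (perm_mon \<theta> (b - a)) i + lk (perm_mon \<theta> a) i
      = lk (perm_mon \<theta> (a - b)) i + lk (perm_mon \<theta> b) i" for i
  proof -
    show "lk (perm_mon \<theta> (b - a)) i + lk (perm_mon \<theta> a) i = lk (perm_mon \<theta> (a - b)) i + lk (perm_mon \<theta> b) i"
      using w' unfolding w_def by (metis perm_mon_add lookup_add)
    show "lk (perm_mon \<theta> (b - a)) i \<le> lk m i"
    proof (cases "i \<in> \<theta> ` {..<2 * k}")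
      case True
      then obtain j where j: "j < 2 * k" "i = \<theta> j" by auto
      have "lk m i + lk a j = lk m' i + lk b j"
        using arg_cong[OF eq, of "\<lambda>t. lk t i"] lookup_perm_mon[OF inj ab(1) j(1)] lookup_perm_mon[OF inj ab(2) j(1)]
        by (simp add: lookup_add j(2) flip: \<theta>a \<theta>b)
      then show ?thesis
        using lookup_perm_mon[OF inj diff(1) j(1)] by (simp add: j(2) lookup_minus)
    qed (simp add: lookup_perm_mon_notin[OF diff(1)])
  qed
  have m: "m = m0 + perm_mon \<theta> (b - a)"
    by (rule poly_mapping_eqI) (use ge(1) in \<open>simp add: m0_def lookup_add lookup_minus\<close>)
  have m': "m' = m0 + perm_mon \<theta> (a - b)"
  proof (rule poly_mapping_eqI)
    fix i
    have "lk m i + lk (perm_mon \<theta> a) i = lk m' i + lk (perm_mon \<theta> b) i"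
      using arg_cong[OF eq, of "\<lambda>t. lk t i"] by (simp add: \<theta>a \<theta>b lookup_add)
    with ge[of i] show "lk m' i = lk (m0 + perm_mon \<theta> (a - b)) i"
      by (simp add: m0_def lookup_add lookup_minus)
  qed
  have t: "m + perm_mon \<pi> (lm g) = m0 + perm_mon \<theta> w"
    by (simp add: m w_def perm_mon_add \<theta>a add.assoc)
  define P Q where "P = sg (b - a) 1 * perm_poly \<pi>' g" and "Q = sg (a - b) 1 * perm_poly \<rho>' h"
  have P: "P \<noteq> 0" "lm P = w" and Q: "Q \<noteq> 0" "lm Q = w"
    using lm_prod[OF \<pi>'(1) g] lm_prod[OF \<rho>'(1) h] by (auto simp: P_def Q_def w_def a_def b_def)
      (metis a_def b_def w' w_def)
  have PV: "P \<in> trunc F (2 * k)"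
    unfolding P_def using wd by (intro prod_in_trunc[OF \<pi>'(1,2) g diff(1)]) (simp add: w_def flip: a_def)
  have QV: "Q \<in> trunc F (2 * k)"
    unfolding Q_def using wd by (intro prod_in_trunc[OF \<rho>'(1,2) h diff(2)]) (simp add: w' flip: b_def)
  have lcP: "lk P (lm P) = lk g (lm g)"
    unfolding P(2) unfolding P_def w_def lookup_sg_mult a_def
    using lookup_perm_poly[OF strict_mono_on_imp_inj_on[OF \<pi>'(1)] gh(1) lgh(1)] by simp
  have lcQ: "lk Q (lm Q) = lk h (lm h)"
    unfolding Q(2) unfolding Q_def w' lookup_sg_mult b_def
    using lookup_perm_poly[OF strict_mono_on_imp_inj_on[OF \<rho>'(1)] gh(2) lgh(3)] by simp
  define S where "S = P - scl (lk g (lm g) / lk h (lm h)) Q"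
  have S0: "S = 0 \<or> mkey (lm S) < mkey w"
    using lm_reduce[OF P(1) Q(1)] P(2) Q(2) by (simp add: lcP[unfolded P(2)] lcQ[unfolded Q(2)] S_def)
  have SV: "S \<in> trunc F (2 * k)"
    unfolding S_def using PV QV subspace_trunc by (intro mp.subspace_diff mp.subspace_scale)
  \<comment> \<open>Stability gives the small S-polynomial a representation strictly below w;
    \<theta> and m0 carry it over to the original one.\<close>
  have S1: "S \<in> mp.span (prods F k {..<2 * k} {..<mkey w})"
  proof (cases "S = 0")
    case False
    have "S \<in> mp.span (prods F k {..<2 * k} {..mkey (lm S)})"
      using covered_reduce[OF subspace_trunc _ order_refl st[unfolded stable_def] SV False] trunc_Box
      by blast
    moreover have "prods F k {..<2 * k} {..mkey (lm S)} \<subseteq> prods F k {..<2 * k} {..<mkey w}"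
      using S0 False by (intro prods_mono) auto
    ultimately show ?thesis using mp.span_mono by blast
  qed (simp add: mp.span_zero)
  have "sg m0 1 * perm_poly \<theta> S \<in> mp.span (prods F k UNIV {..<mkey (m0 + perm_mon \<theta> w)})"
    by (rule span_image_prods[OF \<theta>(1) _ S1])
      (use mkey_perm_less[OF \<theta>(1) _ wM] in \<open>auto simp: mkey_add_less\<close>)
  moreover have "sg m0 1 * perm_poly \<theta> P = sg m 1 * perm_poly \<pi> g"
    using perm_poly_cong[OF gh(1), of "\<theta> \<circ> \<pi>'" \<pi>] \<pi>'(3)
    by (simp add: P_def m perm_poly_sg_mult perm_poly_comp mult_single flip: mult.assoc)
  moreover have "sg m0 1 * perm_poly \<theta> Q = sg m' 1 * perm_poly \<rho> h"
    using perm_poly_cong[OF gh(2), of "\<theta> \<circ> \<rho>'" \<rho>] \<rho>'(3)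
    by (simp add: Q_def m' perm_poly_sg_mult perm_poly_comp mult_single flip: mult.assoc)
  moreover have "perm_poly \<theta> S = perm_poly \<theta> P - scl (lk g (lm g) / lk h (lm h)) (perm_poly \<theta> Q)"
  proof -
    have "P = S + scl (lk g (lm g) / lk h (lm h)) Q" by (simp add: S_def)
    then have "perm_poly \<theta> P = perm_poly \<theta> S + scl (lk g (lm g) / lk h (lm h)) (perm_poly \<theta> Q)"
      by (metis perm_poly_add perm_poly_scl)
    then show ?thesis by simp
  qed
  ultimately show ?thesis by (simp add: t right_diff_distrib flip: scl_mult)
qed

section \<open>Buchberger's criterion for truncations\<close>

lemma span_prods_bounded:
  assumes "p \<in> mp.span (prods F k A T)"
  shows "p = 0 \<or> (\<exists>t\<in>T. p \<in> mp.span (prods F k A {..t}))"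
  using assms
proof (induction rule: mp.span_induct_alt)
  case (step c b q)
  from step(1) obtain s where s: "s \<in> T" "b \<in> prods F k A {..s}"
  proof (rule prodsE)
    fix m \<pi> g
    assume "mkey (m + perm_mon \<pi> (lm g)) \<in> T" "b = sg m 1 * perm_poly \<pi> g" "g \<in> trunc F k" "g \<noteq> 0"
      "mkeys m \<subseteq> A" "strict_mono_on {..<k} \<pi>" "\<pi> ` {..<k} \<subseteq> A"
    then show thesis by (intro that[of "mkey (m + perm_mon \<pi> (lm g))"]) (auto intro: prodsI)
  qed
  show ?case
  proof (cases "q = 0")
    case True
    have "scl c b \<in> mp.span (prods F k A {..s})"
      using s(2) by (intro mp.span_scale mp.span_base)
    with True s(1) show ?thesis by auto
  next
    case False
    with step(2) obtain t where t: "t \<in> T" "q \<in> mp.span (prods F k A {..t})" by blast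
    have "prods F k A {..s} \<subseteq> prods F k A {..max s t}" "prods F k A {..t} \<subseteq> prods F k A {..max s t}"
      by (rule prods_mono; simp)+
    then have "scl c b + q \<in> mp.span (prods F k A {..max s t})"
      using s(2) t(2) by (meson mp.span_add mp.span_base mp.span_mono mp.span_scale subsetD)
    with s(1) t(1) show ?thesis by (auto intro!: bexI[of _ "max s t"] simp: max_def)
  qed
qed simp

lemma lm_in_span_prods:
  assumes "p \<in> mp.span (prods F k UNIV {..<t})" "s \<in> mkeys p"
  shows "mkey s < t"
proof -
  have "mp.span (prods F k UNIV {..<t}) \<subseteq> {p. \<forall>s\<in>mkeys p. mkey s < t}"
  proof (rule mp.span_minimal)
    show "mp.subspace {p. \<forall>s\<in>mkeys p. mkey s < t}"
      unfolding mp.subspace_def by (auto simp: in_keys_iff lookup_add)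
    show "prods F k UNIV {..<t} \<subseteq> {p. \<forall>s\<in>mkeys p. mkey s < t}"
    proof (intro subsetI CollectI ballI)
      fix p s assume p: "p \<in> prods F k UNIV {..<t}" and s: "s \<in> mkeys p"
      from p obtain m \<pi> g where *: "p = sg m 1 * perm_poly \<pi> g" "g \<in> trunc F k" "g \<noteq> 0"
        "strict_mono_on {..<k} \<pi>" "mkey (m + perm_mon \<pi> (lm g)) < t"
        using lessThan_iff by (auto elim: prodsE)
      from lm_prod[OF *(4,2,3)] have "p \<noteq> 0" "lm p = m + perm_mon \<pi> (lm g)"
        unfolding *(1) by blast+
      with lm_max[OF _ s] *(5) show "mkey s < t" by (metis le_less_trans)
    qed
  qed
  with assms show ?thesis by blast
qed

text \<open>By \<open>S_poly_in_span\<close>, all products with key t agree up to scalars modulo the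
  span of the smaller ones, so one of them, b, suffices at this level. Either p then has the leading
  monomial of b, or its representation is lower and the induction hypothesis applies.\<close>

lemma lm_span_prods_covered:
  assumes st: "stable F k" and p: "p \<in> mp.span (prods F k UNIV {..t})" "p \<noteq> 0"
  shows "\<exists>u\<in>LM (trunc F k). covers k UNIV u (lm p)"
  using p
proof (induction t arbitrary: p rule: less_induct)
  case (less t)
  let ?Y = "mp.span (prods F k UNIV {..<t})"
  have low: ?case if y: "p \<in> ?Y"
  proof -
    \<comment> \<open>A finite combination has a largest leading monomial, so the strict bound t can
      be replaced by a weak bound s below t.\<close>
    obtain s where "s < t" "p \<in> mp.span (prods F k UNIV {..s})"
      using span_prods_bounded[OF y] less.prems(2) by auto
    then show ?thesis using less.prems(2) by (rule less.IH)
  qed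
  show ?case
  proof (cases "prods F k UNIV {t} = {}")
    case True
    have "prods F k UNIV {..t} = prods F k UNIV {..<t} \<union> prods F k UNIV {t}"
      unfolding prods_Un[symmetric] by (rule arg_cong) auto
    with True less.prems(1) have "p \<in> ?Y" by simp
    then show ?thesis by (rule low)
  next
    case False
    then obtain m \<pi> g where g: "g \<in> trunc F k" "g \<noteq> 0" and \<pi>: "strict_mono_on {..<k} \<pi>"
      and t: "t = mkey (m + perm_mon \<pi> (lm g))"
      by (auto elim!: prodsE)
    define b where "b = sg m 1 * perm_poly \<pi> g"
    have b: "b \<noteq> 0" "lm b = m + perm_mon \<pi> (lm g)" using lm_prod[OF \<pi> g] by (auto simp: b_def)
    let ?Z = "{y + scl c b | y c. y \<in> ?Y}"
    have "mp.subspace ?Z"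
      unfolding mp.subspace_def
    proof (intro conjI allI ballI)
      show "0 \<in> ?Z" using mp.span_zero by (auto intro!: exI[of _ 0])
    next
      fix x y assume "x \<in> ?Z" "y \<in> ?Z"
      then obtain x' y' c d where *: "x = x' + scl c b" "y = y' + scl d b" "x' \<in> ?Y" "y' \<in> ?Y" by blast
      then have "x + y = (x' + y') + scl (c + d) b" by (simp add: mp.scale_left_distrib)
      with * show "x + y \<in> ?Z" using mp.span_add by blast
    next
      fix c x assume "x \<in> ?Z"
      then obtain x' d where *: "x = x' + scl d b" "x' \<in> ?Y" by blast
      then have "scl c x = scl c x' + scl (c * d) b" by (simp add: mp.scale_right_distrib)
      with * show "scl c x \<in> ?Z" using mp.span_scale by blast
    qed
    moreover have "prods F k UNIV {..t} \<subseteq> ?Z"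
    proof
      fix x assume "x \<in> prods F k UNIV {..t}"
      then obtain m' \<rho> h where x: "x = sg m' 1 * perm_poly \<rho> h" and h: "h \<in> trunc F k" "h \<noteq> 0"
        and \<rho>: "strict_mono_on {..<k} \<rho>" and le: "mkey (m' + perm_mon \<rho> (lm h)) \<le> t"
        by (auto elim!: prodsE)
      show "x \<in> ?Z"
      proof (cases "mkey (m' + perm_mon \<rho> (lm h)) = t")
        case True
        then have "m' + perm_mon \<rho> (lm h) = m + perm_mon \<pi> (lm g)" by (simp add: t mkey_inject)
        from S_poly_in_span[OF st h g \<rho> \<pi> this] True
        have "x - scl (lk h (lm h) / lk g (lm g)) b \<in> ?Y" by (simp add: x b_def)
        then show ?thesis
          by (intro CollectI exI[of _ "x - scl (lk h (lm h) / lk g (lm g)) b"] exI[of _ "lk h (lm h) / lk g (lm g)"]) simp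
      next
        case False
        with le have "x \<in> prods F k UNIV {..<t}"
          unfolding x using h \<rho> by (intro prodsI) auto
        then show ?thesis
          by (intro CollectI exI[of _ x] exI[of _ 0]) (simp add: mp.span_base)
      qed
    qed
    ultimately have "p \<in> ?Z" using less.prems(1) mp.span_minimal by blast
    then obtain y c where p: "p = y + scl c b" and y: "y \<in> ?Y" by blast
    show ?thesis
    proof (cases "c = 0")
      case True
      with p y low show ?thesis by simp
    next
      case False
      have yt: "mkey s < t" if "s \<in> mkeys y" for s using lm_in_span_prods[OF y that] .
      \<comment> \<open>All monomials of y lie strictly below t, so they cannot cancel the leading
        term of b.\<close>
      have "lk y (lm b) = 0" using yt[of "lm b"] by (auto simp: t b in_keys_iff)
      with False b(1) have "lm b \<in> mkeys p" by (simp add: p in_keys_iff lookup_add lookup_lm)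
      moreover have "mkey s \<le> mkey (lm b)" if "s \<in> mkeys p" for s
      proof -
        have "s \<in> mkeys y \<or> s \<in> mkeys b" using that by (auto simp: p in_keys_iff lookup_add)
        then show ?thesis using yt[of s] lm_max[OF b(1), of s] by (auto simp: t b(2))
      qed
      ultimately have "lm p = lm b" by (rule lm_eqI)
      then show ?thesis
        using g \<pi> b(2) unfolding LM_def covers_def
        by (intro bexI[of _ "lm g"] exI[of _ \<pi>] exI[of _ m]) auto
    qed
  qed
qed

text \<open>The span is closed under all permutations although products involve only increasing
  maps: on \<open>{..<k}\<close> the injection \<open>\<sigma> \<circ> \<pi>\<close> is an
  increasing enumeration \<theta> of its image after a permutation \<tau> of \<open>{..<k}\<close>,
  and \<tau> maps \<open>trunc F k\<close> to itself.\<close>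

lemma ideal_subset_span_prods:
  assumes "F \<subseteq> Box k"
  shows "group_ring_span F \<subseteq> mp.span (prods F k UNIV UNIV)"
proof -
  let ?J = "mp.span (prods F k UNIV UNIV)"
  have mult: "sg m c * p \<in> ?J" if "p \<in> ?J" for m c p
    using that
  proof (induction rule: mp.span_induct_alt)
    case (step d b q)
    from step(1) obtain m' \<pi> g where b: "b = sg m' 1 * perm_poly \<pi> g" "g \<in> trunc F k" "g \<noteq> 0"
      "strict_mono_on {..<k} \<pi>" by (rule prodsE)
    have "sg m 1 * b = sg (m + m') 1 * perm_poly \<pi> g" by (simp add: b mult_single flip: mult.assoc)
    moreover have "sg (m + m') 1 * perm_poly \<pi> g \<in> prods F k UNIV UNIV"
      using b by (intro prodsI) auto
    ultimately have "sg m 1 * b \<in> prods F k UNIV UNIV" by (simp only:)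
    moreover have "sg m c * scl d b = scl (c * d) (sg m 1 * b)"
      by (subst sg_eq_scl) (simp add: scl_def mult_single ac_simps flip: mult.assoc)
    ultimately show ?case using step(2) by (simp add: distrib_left mp.span_add mp.span_scale mp.span_base)
  qed (simp add: mp.span_zero)
  have perm: "perm_poly \<sigma> p \<in> ?J" if "p \<in> ?J" "bij \<sigma>" for \<sigma> p
    using that(1)
  proof (induction rule: mp.span_induct_alt)
    case (step d b q)
    from step(1) obtain m \<pi> g where b: "b = sg m 1 * perm_poly \<pi> g" and g: "g \<in> trunc F k" "g \<noteq> 0"
      and \<pi>: "strict_mono_on {..<k} \<pi>" by (rule prodsE)
    have inj: "inj_on (\<sigma> \<circ> \<pi>) {..<k}"
      using strict_mono_on_imp_inj_on[OF \<pi>] that(2) by (auto intro: comp_inj_on inj_on_subset simp: bij_def)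
    define B where "B = (\<sigma> \<circ> \<pi>) ` {..<k}"
    have "finite B" "card B = k" using card_image[OF inj] by (auto simp only: B_def finite_imageI finite_lessThan card_lessThan)
    then obtain \<theta> where \<theta>: "strict_mono_on {..<k} \<theta>" "\<theta> ` {..<k} = B"
      using ex_increasing_enum by blast
    have "\<forall>i<k. \<exists>j<k. \<theta> j = \<sigma> (\<pi> i)" using \<theta>(2) by (force simp: B_def image_iff)
    then obtain \<tau> where \<tau>: "\<And>i. i < k \<Longrightarrow> \<tau> i < k \<and> \<theta> (\<tau> i) = \<sigma> (\<pi> i)" by metis
    have "inj_on \<tau> {..<k}" 
    proof (rule inj_onI)
      fix i j assume ij: "i \<in> {..<k}" "j \<in> {..<k}" "\<tau> i = \<tau> j"
      then have "(\<sigma> \<circ> \<pi>) i = (\<sigma> \<circ> \<pi>) j" using \<tau>[of i] \<tau>[of j] by simp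
      with inj ij(1,2) show "i = j" by (auto dest: inj_onD simp del: o_apply)
    qed
    then have "perm_poly \<tau> g \<in> trunc F k" "perm_poly \<tau> g \<noteq> 0"
      using \<tau> g(1) perm_poly_neq_0[OF _ Box_Pol[OF trunc_Box[OF g(1)]] g(2)]
      by (auto intro!: trunc_perm_poly)
    moreover have "perm_poly \<sigma> b = sg (perm_mon \<sigma> m) 1 * perm_poly \<theta> (perm_poly \<tau> g)"
      using perm_poly_cong[OF Box_Pol[OF trunc_Box[OF g(1)]], of "\<sigma> \<circ> \<pi>" "\<theta> \<circ> \<tau>"] \<tau>
      by (simp add: b perm_poly_sg_mult perm_poly_comp)
    ultimately have "perm_poly \<sigma> b \<in> prods F k UNIV UNIV" using \<theta>(1) by (simp only:) (rule prodsI, auto)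
    then show ?case using step(2) by (simp add: perm_poly_add perm_poly_scl mp.span_add mp.span_scale mp.span_base)
  qed (simp add: mp.span_zero)
  have "symmetric_ideal ?J"
    unfolding symmetric_ideal_def
  proof (intro conjI allI ballI impI)
    fix g p assume p: "p \<in> ?J"
    have "g * p = (\<Sum>t\<in>mkeys g. sg t (lk g t) * p)"
      by (subst (1) poly_mapping_sum_single[symmetric]) (simp add: sum_distrib_right)
    then show "g * p \<in> ?J" using mult[OF p] by (simp add: mp.span_sum)
  qed (auto simp: mp.span_zero mp.span_add intro: perm)
  moreover have "F \<subseteq> ?J"
  proof
    fix f assume f: "f \<in> F"
    show "f \<in> ?J"
    proof (cases "f = 0")
      case False
      have "f \<in> trunc F k" using f assms by (auto intro: trunc.gen)
      then have "sg 0 1 * perm_poly id f \<in> prods F k UNIV UNIV"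
        using False by (intro prodsI) (auto simp: strict_mono_on_def)
      then have "f \<in> prods F k UNIV UNIV" by (simp add: perm_poly_id)
      then show ?thesis by (rule mp.span_base)
    qed (simp add: mp.span_zero)
  qed
  ultimately show ?thesis
    unfolding group_ring_span_def by (intro hull_minimal) (auto simp: group_ring_submodule_iff_symmetric_ideal)
qed

lemma stable_imp_ideal_covered:
  assumes "F \<subseteq> Box k" "stable F k" "p \<in> group_ring_span F" "p \<noteq> 0"
  shows "\<exists>u\<in>LM (trunc F k). covers k UNIV u (lm p)"
proof -
  have "p \<in> mp.span (prods F k UNIV UNIV)" using ideal_subset_span_prods assms by blast
  then obtain t where "p \<in> mp.span (prods F k UNIV {..t})" using span_prods_bounded assms(4) by blast
  then show ?thesis using lm_span_prods_covered assms by blast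
qed

section \<open>Eventual stability\<close>

definition word :: "nat \<Rightarrow> monomial \<Rightarrow> nat list" where
  "word k m = map (lk m) [0..<k]"

lemma length_word [simp]: "length (word k m) = k"
  by (simp add: word_def)

lemma nth_word [simp]: "i < k \<Longrightarrow> word k m ! i = lk m i"
  by (simp add: word_def)

text \<open>Turns divisibility up to increasing maps into Higman's order on exponent words. In the
  converse the cofactor is an exact difference of exponents: off the image of \<pi> nothing is
  subtracted.\<close>

lemma covers_iff_emb:
  assumes u: "u \<in> Mon k" and v: "v \<in> Mon n"
  shows "covers k {..<n} u v \<longleftrightarrow> emb (word k u) (word n v)"
proof
  assume "covers k {..<n} u v"
  then obtain \<pi> m where \<pi>: "strict_mono_on {..<k} \<pi>" "\<pi> ` {..<k} \<subseteq> {..<n}" and v: "v = m + perm_mon \<pi> u"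
    unfolding covers_def by blast
  have "lk u i \<le> lk v (\<pi> i)" if "i < k" for i
    using lookup_perm_mon[OF strict_mono_on_imp_inj_on[OF \<pi>(1)] u that] by (simp add: v lookup_add)
  moreover have "\<pi> i < n" if "i < k" for i using \<pi>(2) that by auto
  ultimately show "emb (word k u) (word n v)"
    unfolding emb_iff_increasing using \<pi> by (intro exI[of _ \<pi>]) simp
next
  assume "emb (word k u) (word n v)"
  then obtain \<pi> where \<pi>: "strict_mono_on {..<k} \<pi>" "\<pi> ` {..<k} \<subseteq> {..<n}"
    and le: "\<And>i. i < k \<Longrightarrow> word k u ! i \<le> word n v ! \<pi> i"
    unfolding emb_iff_increasing by auto
  have lt: "\<pi> i < n" if "i < k" for i using \<pi>(2) that by auto
  have le': "lk u i \<le> lk v (\<pi> i)" if "i < k" for i using le[OF that] lt[OF that] that by simp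
  have "lk (perm_mon \<pi> u) j \<le> lk v j" for j
  proof (cases "j \<in> \<pi> ` {..<k}")
    case True
    then obtain i where i: "i < k" "j = \<pi> i" by auto
    then show ?thesis
      using lookup_perm_mon[OF strict_mono_on_imp_inj_on[OF \<pi>(1)] u i(1)] le'[OF i(1)] by simp
  qed (simp add: lookup_perm_mon_notin[OF u])
  then have "v = (v - perm_mon \<pi> u) + perm_mon \<pi> u"
    by (intro poly_mapping_eqI) (simp add: lookup_add lookup_minus)
  with \<pi> show "covers k {..<n} u v" unfolding covers_def by blast
qed

text \<open>Makes the unrestricted relation testable. An index i that \<pi> sends to n or beyond has
  exponent zero in u; sending it to \<open>n + i\<close> instead keeps the map increasing and the
  image of u unchanged.\<close>

lemma covers_UNIV_iff:
  assumes u: "u \<in> Mon k" and v: "v \<in> Mon n"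
  shows "covers k UNIV u v \<longleftrightarrow> covers k {..<n + k} u v"
proof
  assume "covers k UNIV u v"
  then obtain \<pi> m where \<pi>: "strict_mono_on {..<k} \<pi>" and eq: "v = m + perm_mon \<pi> u"
    unfolding covers_def by blast
  define \<pi>' where "\<pi>' i = (if \<pi> i < n then \<pi> i else n + i)" for i
  have "strict_mono_on {..<k} \<pi>'"
  proof (rule strict_mono_onI)
    fix i j assume "i \<in> {..<k}" "j \<in> {..<k}" "i < j"
    then show "\<pi>' i < \<pi>' j" using strict_mono_onD[OF \<pi>, of i j] by (auto simp: \<pi>'_def)
  qed
  moreover have "\<pi>' ` {..<k} \<subseteq> {..<n + k}" by (auto simp: \<pi>'_def)
  moreover have "perm_mon \<pi>' u = perm_mon \<pi> u"
    unfolding perm_mon_def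
  proof (rule sum.cong)
    fix i assume i: "i \<in> mkeys u"
    then have "i < k" using u by (auto simp: Mon_def)
    have "lk (perm_mon \<pi> u) (\<pi> i) = lk u i"
      by (rule lookup_perm_mon[OF strict_mono_on_imp_inj_on[OF \<pi>] u \<open>i < k\<close>])
    moreover have "perm_mon \<pi> u \<in> Mon n" using v by (simp add: eq Mon_add_iff)
    ultimately have "\<pi> i < n" using i Mon_lookup[of "perm_mon \<pi> u" n "\<pi> i"] by (cases "\<pi> i < n") (auto simp: in_keys_iff)
    then show "sg (\<pi>' i) (lk u i) = sg (\<pi> i) (lk u i)" by (simp add: \<pi>'_def)
  qed simp
  ultimately show "covers k {..<n + k} u v" unfolding covers_def eq by metis
qed (auto simp: covers_def)

lemma word_add: "v \<in> Mon n \<Longrightarrow> word (n + k) v = word n v @ replicate k 0"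
  by (rule nth_equalityI) (auto simp: nth_append Mon_lookup)

lemma LM_trunc_Mon: "u \<in> LM (trunc F k) \<Longrightarrow> u \<in> Mon k"
  using Box_LM[of "trunc F k" k u] trunc_Box by blast

lemma covers_self: "covers k {..<k} u u"
proof -
  have "u = 0 + perm_mon id u" by (simp add: perm_mon_id)
  then show ?thesis unfolding covers_def by (intro exI[of _ id] exI[of _ 0]) (auto simp: strict_mono_on_def)
qed

text \<open>By Higman's lemma the leading monomials of all truncations together are covered by
  finitely many of them, which occur in a single truncation.\<close>

lemma eventually_stable: "\<exists>K. \<forall>k\<ge>K. stable F k"
proof -
  let ?U = "{word k u | k u. u \<in> LM (trunc F k)}"
  obtain B where B: "B \<subseteq> ?U" "finite B" "\<forall>v\<in>?U. \<exists>b\<in>B. emb b v"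
    using finite_emb_basis[of ?U] by (elim exE conjE)
  show ?thesis
  proof (intro exI allI impI)
    \<comment> \<open>Each basis word thus comes from a truncation with parameter at most k; the
      inserted 0 covers an empty basis.\<close>
    fix k assume k: "Max (insert 0 (length ` B)) \<le> k"
    show "stable F k"
      unfolding stable_def covered_def
    proof
      fix v assume v: "v \<in> LM (trunc F (2 * k))"
      then have "word (2 * k) v \<in> ?U" by blast
      then obtain b where b: "b \<in> B" "emb b (word (2 * k) v)" using B(3) by blast
      with B(1) obtain l u where bu: "b = word l u" and u: "u \<in> LM (trunc F l)" by blast
      have l: "l \<le> k"
        using b(1) B(2) k bu by (auto simp: Max_le_iff)
      from b(2) have "covers l {..<2 * k} u v"
        unfolding bu by (subst covers_iff_emb) (use u v LM_trunc_Mon in auto)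
      then obtain \<pi> m where \<pi>: "strict_mono_on {..<l} \<pi>" "\<pi> ` {..<l} \<subseteq> {..<2 * k}" and eq: "v = m + perm_mon \<pi> u"
        unfolding covers_def by blast
      have cl: "card (\<pi> ` {..<l}) = l" using strict_mono_on_imp_inj_on[OF \<pi>(1)] by (simp add: card_image)
      \<comment> \<open>Enlarging the image of \<pi> to exactly k places factors \<pi> through
        \<open>{..<k}\<close>: the inner map \<rho> moves u into \<open>LM (trunc F k)\<close>, and
        the outer map \<theta> does the covering.\<close>
      obtain C where C: "\<pi> ` {..<l} \<subseteq> C" "C \<subseteq> {..<2 * k}" "card C = k"
        using exists_subset_between[of "\<pi> ` {..<l}" k "{..<2 * k}"] \<pi>(2) cl l by auto
      have "finite C" using C(2) finite_subset by blast
      then obtain \<theta> where \<theta>: "strict_mono_on {..<k} \<theta>" "\<theta> ` {..<k} = C"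
        using ex_increasing_enum[OF _ C(3)] by blast
      obtain \<rho> where \<rho>: "strict_mono_on {..<l} \<rho>" "\<rho> ` {..<l} \<subseteq> {..<k}" "\<And>i. i < l \<Longrightarrow> \<theta> (\<rho> i) = \<pi> i"
        using increasing_factor[OF \<theta>(1) \<pi>(1)] C(1) \<theta>(2) by auto
      from u obtain g where g: "g \<in> trunc F l" "g \<noteq> 0" "u = lm g" unfolding LM_def by auto
      note gP = Box_Pol[OF trunc_Box[OF g(1)]]
      have "perm_poly \<rho> g \<in> trunc F k"
        using strict_mono_on_imp_inj_on[OF \<rho>(1)] \<rho>(2) g(1) by (rule trunc_perm_poly)
      moreover have "perm_poly \<rho> g \<noteq> 0"
        using strict_mono_on_imp_inj_on[OF \<rho>(1)] gP g(2) by (rule perm_poly_neq_0)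
      moreover have "lm (perm_poly \<rho> g) = perm_mon \<rho> u"
        unfolding g(3) using \<rho>(1) gP g(2) by (rule lm_perm_poly)
      ultimately have mem: "perm_mon \<rho> u \<in> LM (trunc F k)"
        using imageI[of "perm_poly \<rho> g" "trunc F k - {0}" lm] unfolding LM_def by simp
      have "perm_mon \<pi> u = perm_mon \<theta> (perm_mon \<rho> u)"
        unfolding perm_mon_comp using LM_trunc_Mon[OF u] \<rho>(3) by (intro perm_mon_cong) auto
      then have "covers k {..<2 * k} (perm_mon \<rho> u) v"
        unfolding covers_def eq using \<theta> C(2) by (intro exI[of _ \<theta>] exI[of _ m]) auto
      with mem show "\<exists>u\<in>LM (trunc F k). covers k {..<2 * k} u v" by blast
    qed
  qed
qed

section \<open>The test for membership\<close>

lemma subspace_ideal: "mp.subspace (group_ring_span F)"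
  using symmetric_ideal_span[of F] unfolding symmetric_ideal_def mp.subspace_def scl_def by blast

text \<open>On the finitely many indices below k, the map \<pi> agrees with a permutation of some
  \<open>{..<n}\<close>.\<close>

lemma increasing_multiple_in_ideal:
  assumes "strict_mono_on {..<k} \<pi>" "g \<in> trunc F k"
  shows "sg m c * perm_poly \<pi> g \<in> group_ring_span F"
proof -
  obtain n where "\<pi> ` {..<k} \<subseteq> {..<n}"
    using finite_nat_iff_bounded[of "\<pi> ` {..<k}"] by auto
  then have "perm_poly \<pi> g \<in> trunc F n"
    by (rule trunc_perm_poly[OF strict_mono_on_imp_inj_on[OF assms(1)] _ assms(2)])
  then show ?thesis
    using trunc_subset_span symmetric_ideal_span[of F] unfolding symmetric_ideal_def by blast
qed

text \<open>An element of the ideal arises in finitely many steps, which fit into one large box.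
  Together with eventual stability this ends the search if f is in the ideal.\<close>

lemma ideal_eq_Union_trunc:
  assumes "F \<subseteq> Box k0"
  shows "f \<in> group_ring_span F \<longleftrightarrow> (\<exists>k. f \<in> trunc F k)"
proof
  let ?J = "\<Union>k. trunc F k"
  assume f: "f \<in> group_ring_span F"
  have add: "f + g \<in> ?J" if fg: "f \<in> ?J" "g \<in> ?J" for f g
  proof -
    from fg obtain k l where "f \<in> trunc F k" "g \<in> trunc F l" by blast
    then have "f \<in> trunc F (max k l)" "g \<in> trunc F (max k l)" by (auto intro: trunc_mono)
    then show ?thesis by (blast intro: trunc.add)
  qed
  have mult: "sg t c * f \<in> ?J" if f: "f \<in> ?J" for t c f
  proof -
    from f obtain k where k: "f \<in> trunc F k" by blast
    obtain l where l: "mkeys t \<subseteq> {..<l}" using finite_nat_iff_bounded[of "mkeys t"] by auto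
    \<comment> \<open>Room for the indices of t and for the degree of the product.\<close>
    define n where "n = max l (k + tdeg t)"
    have "t \<in> Mon n" using l by (auto simp: Mon_def n_def)
    then have "sg t 1 * f \<in> Box n"
      using trunc_Box[OF k] by (fastforce simp: Box_def keys_sg_mult Mon_add_iff tdeg_add n_def intro: Mon_mono)
    moreover have "f \<in> trunc F n" using k by (rule trunc_mono) (simp add: n_def)
    ultimately have "sg t 1 * f \<in> trunc F n" by (intro trunc_mult_mon)
    then have "scl c (sg t 1 * f) \<in> ?J" by (auto intro: trunc.scl)
    moreover have "scl c (sg t 1 * f) = sg t c * f"
      by (simp add: scl_def mult_single flip: mult.assoc)
    ultimately show ?thesis by simp
  qed
  have "symmetric_ideal ?J"
    unfolding symmetric_ideal_def
  proof (intro conjI allI ballI impI)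
    show "0 \<in> ?J" by (auto intro: trunc.zero)
    fix f assume f: "f \<in> ?J"
    fix g
    have "(\<Sum>t\<in>A. sg t (lk g t) * f) \<in> ?J" for A
      by (induction A rule: infinite_finite_induct) (use add mult[OF f] in \<open>auto intro: trunc.zero\<close>)
    moreover have "g * f = (\<Sum>t\<in>mkeys g. sg t (lk g t) * f)"
      by (subst (1) poly_mapping_sum_single[symmetric]) (simp add: sum_distrib_right)
    ultimately show "g * f \<in> ?J" by simp
  next
    fix f and \<sigma> :: "nat \<Rightarrow> nat" assume "f \<in> ?J" "bij \<sigma>"
    then obtain k where k: "f \<in> trunc F k" by blast
    obtain n where "\<sigma> ` {..<k} \<subseteq> {..<n}" using finite_nat_iff_bounded[of "\<sigma> ` {..<k}"] by auto
    moreover have "inj_on \<sigma> {..<k}" using \<open>bij \<sigma>\<close> by (auto simp: bij_def intro: inj_on_subset)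
    ultimately have "perm_poly \<sigma> f \<in> trunc F n" using k by (intro trunc_perm_poly)
    then show "perm_poly \<sigma> f \<in> ?J" by blast
  qed (rule add)
  moreover have "F \<subseteq> ?J" using assms by (auto intro: trunc.gen)
  ultimately have "group_ring_span F \<subseteq> ?J"
    unfolding group_ring_span_def by (intro hull_minimal) (auto simp: group_ring_submodule_iff_symmetric_ideal)
  with f show "\<exists>k. f \<in> trunc F k" by blast
qed (auto intro: trunc_subset_span)

abbreviation ext_trunc :: "'a::field mpoly set \<Rightarrow> 'a mpoly \<Rightarrow> nat \<Rightarrow> 'a mpoly set" where
  "ext_trunc F f k \<equiv> mp.span (insert f (trunc F k))"

text \<open>The first alternative certifies membership, the second one refutes it. If all leading
  monomials are covered over \<open>UNIV\<close> but not all within \<open>{..<k}\<close>, neither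
  holds and a larger k is tried.\<close>

definition conclusive :: "'a::field mpoly set \<Rightarrow> 'a mpoly \<Rightarrow> nat \<Rightarrow> bool" where
  "conclusive F f k \<longleftrightarrow> stable F k \<and>
     (covered k {..<k} (LM (trunc F k)) (LM (ext_trunc F f k)) \<or>
      \<not> covered k UNIV (LM (trunc F k)) (LM (ext_trunc F f k)))"

text \<open>For f in the ideal, stability covers all leading monomials over \<open>UNIV\<close>, so
  only the first alternative can hold; that alternative in turn lets division put f into
  \<open>trunc F k\<close>.\<close>

lemma conclusive_correct:
  assumes F: "F \<subseteq> Box k" and f: "f \<in> Box k" and c: "conclusive F f k"
  shows "covered k {..<k} (LM (trunc F k)) (LM (ext_trunc F f k)) \<longleftrightarrow> f \<in> group_ring_span F"
proof
  let ?W = "ext_trunc F f k"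
  have W: "?W \<subseteq> Box k"
    by (rule mp.span_minimal) (use f trunc_Box subspace_Box in auto)
  have sub: "trunc F k \<subseteq> ?W" using mp.span_superset by blast
  assume "covered k {..<k} (LM (trunc F k)) (LM ?W)"
  then have "?W = trunc F k" using covered_imp_eq_trunc[OF mp.subspace_span W sub] by blast
  then have "f \<in> trunc F k" using mp.span_base[of f "insert f (trunc F k)"] by blast
  then show "f \<in> group_ring_span F" by (rule trunc_subset_span)
next
  let ?W = "ext_trunc F f k"
  assume "f \<in> group_ring_span F"
  then have "?W \<subseteq> group_ring_span F"
    by (intro mp.span_minimal subspace_ideal) (auto intro: trunc_subset_span)
  then have "covered k UNIV (LM (trunc F k)) (LM ?W)"
    using stable_imp_ideal_covered[OF F] c by (auto simp: covered_def LM_def conclusive_def)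
  then show "covered k {..<k} (LM (trunc F k)) (LM ?W)" using c by (simp add: conclusive_def)
qed

text \<open>If \<open>f\<close> is not in the ideal, then an element of the coset of \<open>f\<close> with least leading monomial
  shows that from some stage on the second alternative holds.\<close>

lemma ex_conclusive:
  assumes F: "F \<subseteq> Box k0"
  shows "\<exists>k\<ge>k0. conclusive F f k"
proof -
  obtain K where K: "\<And>k. k \<ge> K \<Longrightarrow> stable F k" using eventually_stable by blast
  show ?thesis
  proof (cases "f \<in> group_ring_span F")
    case True
    then obtain l where l: "f \<in> trunc F l" using ideal_eq_Union_trunc[OF F] by blast
    define k where "k = max l (max K k0)"
    have "f \<in> trunc F k" using l by (rule trunc_mono) (simp add: k_def)
    then have "ext_trunc F f k = trunc F k"
      using subspace_trunc by (simp add: insert_absorb mp.span_eq_iff)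
    then have "conclusive F f k"
      using K[of k] covers_self unfolding conclusive_def covered_def by (auto simp: k_def)
    then show ?thesis by (intro exI[of _ k]) (simp add: k_def)
  next
    case False
    \<comment> \<open>The coset of f. It omits 0, as f is not in the ideal, so each of its elements
      has a genuine leading monomial.\<close>
    define C where "C = {p. p - f \<in> group_ring_span F}"
    have "f \<in> C" by (simp add: C_def mp.subspace_0[OF subspace_ideal])
    then obtain p where p: "p \<in> C" "\<And>q. mkey (lm q) < mkey (lm p) \<Longrightarrow> q \<notin> C"
      using exists_least_iff[of "\<lambda>t. \<exists>p\<in>C. t = mkey (lm p)"] by blast
    have nz: "q \<noteq> 0" if "q \<in> C" for q
      using that False mp.subspace_neg[OF subspace_ideal, of "- f" F] by (auto simp: C_def)
    from p(1) obtain l where l: "p - f \<in> trunc F l"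
      using ideal_eq_Union_trunc[OF F] by (auto simp: C_def)
    define k where "k = max l (max K k0)"
    have "p - f \<in> trunc F k" using l by (rule trunc_mono) (simp add: k_def)
    then have "(p - f) + f \<in> ext_trunc F f k" by (intro mp.span_add mp.span_base) auto
    then have lmp: "lm p \<in> LM (ext_trunc F f k)" using nz[OF p(1)] by (auto simp: LM_def)
    have "\<not> covers k UNIV u (lm p)" if u: "u \<in> LM (trunc F k)" for u
    proof
      assume "covers k UNIV u (lm p)"
      then obtain \<pi> m where \<pi>: "strict_mono_on {..<k} \<pi>" and eq: "lm p = m + perm_mon \<pi> u"
        unfolding covers_def by blast
      from u obtain g where g: "g \<in> trunc F k" "g \<noteq> 0" "u = lm g" unfolding LM_def by auto
      define h where "h = sg m 1 * perm_poly \<pi> g"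
      have h: "h \<noteq> 0" "lm h = lm p" using lm_prod[OF \<pi> g(1,2)] by (simp_all add: h_def eq g(3))
      define q where "q = p - scl (lk p (lm p) / lk h (lm h)) h"
      have hI: "h \<in> group_ring_span F" unfolding h_def by (rule increasing_multiple_in_ideal[OF \<pi> g(1)])
      have "p - f \<in> group_ring_span F" using p(1) by (simp add: C_def)
      then have "(p - f) - scl (lk p (lm p) / lk h (lm h)) h \<in> group_ring_span F"
        by (rule mp.subspace_diff[OF subspace_ideal _ mp.subspace_scale[OF subspace_ideal hI]])
      then have "q \<in> C" by (simp add: C_def q_def algebra_simps)
      moreover have "q = 0 \<or> mkey (lm q) < mkey (lm p)"
        unfolding q_def by (rule lm_reduce[OF nz[OF p(1)] h])
      ultimately show False using nz p(2) by blast
    qed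
    with lmp have "\<not> covered k UNIV (LM (trunc F k)) (LM (ext_trunc F f k))"
      unfolding covered_def by blast
    then have "conclusive F f k" using K[of k] unfolding conclusive_def by (auto simp: k_def)
    then show ?thesis by (intro exI[of _ k]) (simp add: k_def)
  qed
qed

section \<open>Generating a truncation by three operations\<close>

text \<open>The index map that \<open>rotate1\<close> induces on exponent words of length k: each
  letter moves one place down and the first goes to the end.\<close>

definition cyc :: "nat \<Rightarrow> nat \<Rightarrow> nat" where
  "cyc k i = (if i = 0 then k - 1 else if i < k then i - 1 else i)"

lemma cyc_permutes: "0 < k \<Longrightarrow> cyc k permutes {..<k}"
proof (rule bij_imp_permutes)
  assume "0 < k"
  show "bij_betw (cyc k) {..<k} {..<k}"
    by (rule bij_betw_byWitness[of _ "\<lambda>i. if Suc i = k then 0 else Suc i"])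
      (use \<open>0 < k\<close> in \<open>auto simp: cyc_def\<close>)
qed (auto simp: cyc_def)

text \<open>A permutation of finite order has a power as its inverse, so closure under composition
  alone yields inverses.\<close>

lemma ex_inverse_power:
  assumes "p permutes {..<k::nat}"
  shows "\<exists>n. \<forall>x. (p ^^ n) (p x) = x"
proof -
  have "permutation p" using assms permutation_permutes by blast
  then obtain n where n: "(p ^^ n) = id" "n > 0" by (rule permutation_is_nilpotent)
  then obtain m where "n = Suc m" by (cases n) auto
  with n(1) have "(p ^^ m) (p x) = x" for x by (metis funpow_Suc_right comp_apply id_apply)
  then show ?thesis by blast
qed

text \<open>A k-cycle and one adjacent transposition generate all permutations: conjugation by the
  cycle shifts \<open>transpose j (Suc j)\<close> to the next pair, and conjugation by adjacent
  transpositions widens it to any pair.\<close>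

lemma closed_permutes:
  fixes H :: "(nat \<Rightarrow> nat) \<Rightarrow> bool"
  assumes k: "2 \<le> k" and id: "H id" and comp: "\<And>\<sigma> \<tau>. H \<sigma> \<Longrightarrow> H \<tau> \<Longrightarrow> H (\<sigma> \<circ> \<tau>)"
    and cyc: "H (cyc k)" and swap: "H (transpose 0 1)"
    and \<sigma>: "\<sigma> permutes {..<k}"
  shows "H \<sigma>"
proof -
  have pow: "H (cyc k ^^ n)" for n
  proof (induction n)
    case (Suc n)
    then show ?case using comp[OF cyc] by (simp only: funpow.simps)
  qed (use id in \<open>simp only: funpow.simps\<close>)
  have "0 < k" using k by simp
  from ex_inverse_power[OF cyc_permutes[OF this]]
  obtain n where n: "\<And>x. (cyc k ^^ n) (cyc k x) = x" by blast
  define r where "r = cyc k ^^ n"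
  have Hr: "H r" unfolding r_def by (rule pow)
  have r: "r i = Suc i" if "Suc i < k" for i using n[of "Suc i"] that by (simp add: cyc_def r_def)
  have rc: "r (cyc k x) = x" for x by (simp add: r_def n)
  have "bij (cyc k)" using cyc_permutes[of k] k permutes_bij by auto
  then have inj_r: "r x = r y \<longleftrightarrow> x = y" for x y
    using rc by (metis bij_pointE)
  have adj: "H (transpose j (Suc j))" if "Suc j < k" for j
    using that
  proof (induction j)
    case (Suc j)
    have "transpose (Suc j) (Suc (Suc j)) = r \<circ> transpose j (Suc j) \<circ> cyc k"
    proof
      fix x
      have "r (transpose j (Suc j) y) = transpose (Suc j) (Suc (Suc j)) (r y)" for y
        using r[of j] r[of "Suc j"] inj_r[of y j] inj_r[of y "Suc j"] Suc.prems
        by (auto simp: transpose_def)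
      from this[of "cyc k x"] show "transpose (Suc j) (Suc (Suc j)) x = (r \<circ> transpose j (Suc j) \<circ> cyc k) x"
        by (simp add: rc)
    qed
    moreover have "H (r \<circ> transpose j (Suc j) \<circ> cyc k)" using Suc by (intro comp Hr cyc) auto
    ultimately show ?case by (simp only:)
  qed (use swap in simp)
  have up: "H (transpose a (Suc (a + d)))" if "Suc (a + d) < k" for a d
    using that
  proof (induction d)
    case (Suc d)
    let ?t = "transpose (Suc (a + d)) (Suc (a + Suc d))"
    have "transpose a (Suc (a + Suc d)) = transpose (Suc (a + d)) (Suc (a + Suc d)) \<circ>
        transpose a (Suc (a + d)) \<circ> transpose (Suc (a + d)) (Suc (a + Suc d))"
      by (auto simp: fun_eq_iff transpose_def)
    moreover have "H (?t \<circ> transpose a (Suc (a + d)) \<circ> ?t)"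
      using Suc adj[of "Suc (a + d)"] by (intro comp) auto
    ultimately show ?case by (simp only:)
  qed (use adj in simp)
  have tr: "H (transpose a b)" if "a < b" "b < k" for a b
    using up[of a "b - a - 1"] that by simp
  show ?thesis
    using \<sigma> finite_lessThan
  proof (induction rule: permutes_induct)
    case (swap a b p)
    then have "H (transpose a b)"
      using tr[of a b] tr[of b a] by (cases "a < b") (auto simp: transpose_commute[of b a] not_less order.order_iff_strict)
    with swap comp show ?case by blast
  qed (rule id)
qed

text \<open>The three operations rotate a word of exponents, swap its first two letters and increment the
  first.\<close>

definition op_closure :: "nat \<Rightarrow> 'a::field mpoly set \<Rightarrow> 'a mpoly set" where
  "op_closure k W = mp.span (W \<union> perm_poly (cyc k) ` W \<union> perm_poly (transpose 0 1) ` W \<union>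
     (\<lambda>p. sg (sg 0 1) 1 * p) ` W) \<inter> Box k"

lemma subspace_op_closure: "mp.subspace (op_closure k W)"
  unfolding op_closure_def by (intro mp.subspace_inter mp.subspace_span subspace_Box)

lemma op_closure_superset: "W \<subseteq> Box k \<Longrightarrow> W \<subseteq> op_closure k W"
  unfolding op_closure_def by (auto intro: mp.span_base)

lemma perm_poly_transpose_cancel: "perm_poly (transpose a b) (perm_poly (transpose a b) p) = p"
  by (simp add: perm_poly_comp perm_poly_id)

lemma op_closed_imp_trunc:
  assumes k: "2 \<le> k" and W: "mp.subspace W" "W \<subseteq> Box k" "op_closure k W = W" and F: "F \<subseteq> W"
  shows "trunc F k \<subseteq> W"
proof
  have mem: "p \<in> W" if "p \<in> Box k" "p \<in> perm_poly (cyc k) ` W \<union> perm_poly (transpose 0 1) ` W \<union> (\<lambda>p. sg (sg 0 1) 1 * p) ` W" for p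
  proof -
    have "p \<in> op_closure k W" using that unfolding op_closure_def by (auto intro!: mp.span_base)
    then show ?thesis using W(3) by simp
  qed
  have box: "perm_poly \<sigma> p \<in> Box k" if "\<sigma> permutes {..<k}" "p \<in> W" for \<sigma> p
    using that W(2) permutes_image[OF that(1)] permutes_inj_on[OF that(1)] by (intro Box_perm_poly[of _ k]) auto
  have t: "transpose a b permutes {..<k}" if "a < k" "b < k" for a b
    using that by (auto intro: permutes_swap_id)
  have perm: "\<forall>p\<in>W. perm_poly \<sigma> p \<in> W" if "\<sigma> permutes {..<k}" for \<sigma>
  proof (rule closed_permutes[OF k _ _ _ _ that])
    show "\<forall>p\<in>W. perm_poly id p \<in> W" by (simp add: perm_poly_id)
    show "\<forall>p\<in>W. perm_poly (\<sigma> \<circ> \<tau>) p \<in> W" if "\<forall>p\<in>W. perm_poly \<sigma> p \<in> W" "\<forall>p\<in>W. perm_poly \<tau> p \<in> W" for \<sigma> \<tau>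
      using that by (simp flip: perm_poly_comp)
    show "\<forall>p\<in>W. perm_poly (cyc k) p \<in> W" using mem box[OF cyc_permutes] k by auto
    show "\<forall>p\<in>W. perm_poly (transpose 0 1) p \<in> W" using mem box[OF t[of 0 1]] k by auto
  qed
  fix p assume "p \<in> trunc F k"
  then show "p \<in> W"
  proof (induction rule: trunc.induct)
    case (mult f j)
    let ?t = "transpose 0 j"
    have "perm_poly ?t f \<in> W" using perm t[of 0 j] mult k by auto
    then have *: "sg (sg 0 1) 1 * perm_poly ?t f \<in> (\<lambda>p. sg (sg 0 1) 1 * p) ` W" by blast
    \<comment> \<open>Conjugation by the transposition of 0 and j turns multiplication by the
      indeterminate of index j into that of index 0, the only multiplication among the
      operations.\<close>
    have eq: "sg (sg 0 1) 1 * perm_poly ?t f = perm_poly ?t (sg (sg j 1) 1 * f)"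
      by (simp add: perm_poly_sg_mult)
    have "perm_poly ?t (sg (sg j 1) 1 * f) \<in> Box k"
      using mult t[of 0 j] k permutes_image[of ?t "{..<k}"] permutes_inj_on[of ?t "{..<k}"]
      by (intro Box_perm_poly[of _ k]) auto
    with * mem have "perm_poly ?t (sg (sg j 1) 1 * f) \<in> W" unfolding eq by blast
    then have "perm_poly ?t (perm_poly ?t (sg (sg j 1) 1 * f)) \<in> W" using perm t[of 0 j] mult k by auto
    then show ?case by (simp only: perm_poly_transpose_cancel)
  qed (use F W(1) perm in \<open>auto intro: mp.subspace_0 mp.subspace_add mp.subspace_scale\<close>)
qed

text \<open>\<open>Box k\<close> is intersected after forming the span, so terms of degree
  \<open>k + 1\<close> may cancel between multiples that are not in the box themselves, and a
  termwise argument fails.\<close>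

lemma op_closure_trunc: "2 \<le> k \<Longrightarrow> W \<subseteq> trunc F k \<Longrightarrow> op_closure k W \<subseteq> trunc F k"
proof
  fix p assume k: "2 \<le> k" and W: "W \<subseteq> trunc F k" and p: "p \<in> op_closure k W"
  let ?S = "W \<union> perm_poly (cyc k) ` W \<union> perm_poly (transpose 0 1) ` W"
  let ?X = "(\<lambda>p. sg (sg 0 1) 1 * p) ` W"
  text \<open>A sum of elements of \<open>?X\<close> is itself the multiple of an element of the truncation.\<close>
  define T where "T = {a + sg (sg 0 1) 1 * b | a b. a \<in> trunc F k \<and> b \<in> trunc F k}"
  have "mp.subspace T"
    unfolding mp.subspace_def
  proof (intro conjI allI ballI)
    show "0 \<in> T" unfolding T_def by (auto intro!: exI[of _ 0] trunc.zero)
  next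
    fix x y assume "x \<in> T" "y \<in> T"
    then obtain a b c d where "x = a + sg (sg 0 1) 1 * b" "y = c + sg (sg 0 1) 1 * d"
      "a \<in> trunc F k" "b \<in> trunc F k" "c \<in> trunc F k" "d \<in> trunc F k" unfolding T_def by blast
    then show "x + y \<in> T" unfolding T_def
      by (intro CollectI exI[of _ "a + c"] exI[of _ "b + d"]) (simp add: trunc.add algebra_simps)
  next
    fix c x assume "x \<in> T"
    then obtain a b where "x = a + sg (sg 0 1) 1 * b" "a \<in> trunc F k" "b \<in> trunc F k" unfolding T_def by blast
    then show "scl c x \<in> T" unfolding T_def
      by (intro CollectI exI[of _ "scl c a"] exI[of _ "scl c b"]) (simp add: trunc.scl mp.scale_right_distrib scl_mult)
  qed
  moreover have "?S \<union> ?X \<subseteq> T"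
  proof -
    have "?S \<subseteq> trunc F k"
    proof -
      have "cyc k permutes {..<k}" "transpose 0 1 permutes {..<k}"
        using k by (auto intro: cyc_permutes permutes_swap_id)
      then have "perm_poly (cyc k) p \<in> trunc F k" "perm_poly (transpose 0 1) p \<in> trunc F k" if "p \<in> W" for p
        using that W by (auto intro: trunc.perm)
      with W show ?thesis by blast
    qed
    moreover have "a \<in> T" if "a \<in> trunc F k" for a
      unfolding T_def using that trunc.zero by (intro CollectI exI[of _ a] exI[of _ 0]) simp
    ultimately have "?S \<subseteq> T" by blast
    moreover have "?X \<subseteq> T"
    proof (rule image_subsetI)
      fix b assume "b \<in> W"
      then show "sg (sg 0 1) 1 * b \<in> T"
        unfolding T_def using trunc.zero W by (intro CollectI exI[of _ 0] exI[of _ b]) auto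
    qed
    ultimately show ?thesis by blast
  qed
  ultimately have "p \<in> T" using p mp.span_minimal[of "?S \<union> ?X" T] unfolding op_closure_def by blast
  then obtain a b where ab: "p = a + sg (sg 0 1) 1 * b" "a \<in> trunc F k" "b \<in> trunc F k"
    unfolding T_def by blast
  have "sg (sg 0 1) 1 * b = p - a" by (simp add: ab)
  moreover have "p - a \<in> Box k"
    using p trunc_Box[OF ab(2)] unfolding op_closure_def by (intro mp.subspace_diff[OF subspace_Box]) auto
  ultimately have "sg (sg 0 1) 1 * b \<in> Box k" by simp
  with ab(3) k have "sg (sg 0 1) 1 * b \<in> trunc F k" by (intro trunc.mult) auto
  with ab show "p \<in> trunc F k" by (auto intro: trunc.add)
qed

lemma LM_mono: "W \<subseteq> W' \<Longrightarrow> LM W \<subseteq> LM W'"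
  unfolding LM_def by blast

text \<open>Division by elements of the smaller space. It makes the number of leading monomials a
  measure of dimension.\<close>

lemma eq_if_LM_eq:
  assumes W: "mp.subspace W" "mp.subspace W'" "W \<subseteq> W'" and LM: "LM W' \<subseteq> LM W"
  shows "W = W'"
proof -
  have "p \<in> W" if "p \<in> W'" for p
    using that
  proof (induction "mkey (lm p)" arbitrary: p rule: less_induct)
    case less
    show ?case
    proof (cases "p = 0")
      case False
      then have "lm p \<in> LM W" using LM less.prems by (auto simp: LM_def)
      then obtain h where "lm p = lm h" "h \<in> W - {0}" unfolding LM_def by (rule imageE)
      then have h: "h \<in> W" "h \<noteq> 0" "lm h = lm p" by auto
      define q where "q = p - scl (lk p (lm p) / lk h (lm h)) h"
      have q: "q = 0 \<or> mkey (lm q) < mkey (lm p)" unfolding q_def using False h by (intro lm_reduce)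
      have "q \<in> W'"
        unfolding q_def using h(1) W less.prems by (intro mp.subspace_diff mp.subspace_scale) auto
      with q less.hyps[of q] have "q \<in> W" using mp.subspace_0[OF W(1)] by auto
      then have "q + scl (lk p (lm p) / lk h (lm h)) h \<in> W"
        using h(1) W(1) by (intro mp.subspace_add mp.subspace_scale)
      then show ?thesis by (simp add: q_def)
    qed (simp add: mp.subspace_0[OF W(1)])
  qed
  with W(3) show ?thesis by blast
qed

text \<open>As long as the chain grows, it gains a leading monomial in each step, so n iterations
  reach the fixed point. A count known in advance spares the program a test for
  stabilisation.\<close>

lemma op_closure_iterate:
  fixes W :: "'a::field mpoly set"
  assumes k: "2 \<le> k" and W: "mp.subspace W" "W \<subseteq> Box k" "F \<subseteq> W" "W \<subseteq> trunc F k"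
    and M: "finite M" "\<And>V :: 'a mpoly set. V \<subseteq> Box k \<Longrightarrow> LM V \<subseteq> M" and n: "card M \<le> n"
  shows "(op_closure k ^^ n) W = trunc F k"
proof -
  define S where "S i = (op_closure k ^^ i) W" for i
  have S: "S 0 = W" "S (Suc i) = op_closure k (S i)" for i by (simp_all add: S_def)
  have sub: "mp.subspace (S i)" for i by (cases i) (simp_all add: S W subspace_op_closure)
  have box: "S i \<subseteq> Box k" for i by (cases i) (use W(2) in \<open>auto simp: S op_closure_def\<close>)
  have le: "S i \<subseteq> S (Suc i)" for i unfolding S by (rule op_closure_superset[OF box])
  have mono: "S i \<subseteq> S j" if "i \<le> j" for i j using that le by (rule lift_Suc_mono_le[rotated])
  have tr: "S i \<subseteq> trunc F k" for i
    by (induction i) (use W op_closure_trunc[OF k] in \<open>simp_all add: S\<close>)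
  have "\<exists>i\<le>n. S (Suc i) = S i"
  proof (rule ccontr)
    assume no: "\<not> ?thesis"
    have "i \<le> card (LM (S i))" if "i \<le> Suc n" for i
      using that
    proof (induction i)
      case (Suc i)
      have "S i \<noteq> S (Suc i)" using no Suc.prems by force
      then have "\<not> LM (S (Suc i)) \<subseteq> LM (S i)" using eq_if_LM_eq[OF sub sub le] by blast
      then have "LM (S i) \<subset> LM (S (Suc i))" using LM_mono[OF le] by blast
      moreover have "finite (LM (S (Suc i)))" by (rule finite_subset[OF M(2)[OF box] M(1)])
      ultimately have "card (LM (S i)) < card (LM (S (Suc i)))" by (rule psubset_card_mono[rotated])
      with Suc show ?case by simp
    qed simp
    from this[of "Suc n"] have "Suc n \<le> card (LM (S (Suc n)))" by simp
    also have "\<dots> \<le> card M" using M box by (intro card_mono) auto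
    finally show False using n by simp
  qed
  then obtain i where i: "i \<le> n" "S (Suc i) = S i" by blast
  have "S (i + d) = S i" for d by (induction d) (use i(2) in \<open>auto simp: S\<close>)
  from this[of "n - i"] i(1) have "S n = S i" by simp
  then have "op_closure k (S n) = S n" using i(2) by (simp add: S)
  then have "trunc F k \<subseteq> S n"
    using mono[of 0 n] W(3) k by (intro op_closed_imp_trunc sub box) (auto simp: S)
  with tr show ?thesis unfolding S_def[symmetric] by blast
qed

section \<open>Enumerating words\<close>

abbreviation mon_of :: "nat list \<Rightarrow> monomial" where
  "mon_of \<equiv> Poly_Mapping.nth"

text \<open>The last letter varies slowest and from large to small, because the largest index
  decides the order. This sorts the exponents decreasingly; \<open>box_words\<close> then puts the
  degree first.\<close>

primrec all_words :: "nat \<Rightarrow> nat \<Rightarrow> nat list list" where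
  "all_words b 0 = [[]]"
| "all_words b (Suc n) = concat (map (\<lambda>e. map (\<lambda>w. w @ [e]) (all_words b n)) (rev [0..<Suc b]))"

definition deg_words :: "nat \<Rightarrow> nat \<Rightarrow> nat list list" where
  "deg_words n d = filter (\<lambda>w. sum_list w = d) (all_words d n)"

definition box_words :: "nat \<Rightarrow> nat list list" where
  "box_words k = concat (map (deg_words k) (rev [0..<Suc k]))"

lemma set_all_words: "set (all_words b n) = {w. length w = n \<and> (\<forall>e\<in>set w. e \<le> b)}"
proof (induction n)
  case (Suc n)
  have "w \<in> set (all_words b (Suc n)) \<longleftrightarrow> length w = Suc n \<and> (\<forall>e\<in>set w. e \<le> b)" for w
    by (cases w rule: rev_cases) (auto simp: Suc simp del: upt_Suc)
  then show ?case by blast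
qed auto

lemma set_deg_words: "set (deg_words n d) = {w. length w = n \<and> sum_list w = d}"
  using member_le_sum_list by (fastforce simp: deg_words_def set_all_words)

lemma set_box_words: "set (box_words k) = {w. length w = k \<and> sum_list w \<le> k}"
  by (auto simp: box_words_def set_deg_words simp del: upt_Suc)

lemma mset_mon_of_snoc: "mset_of_mon (mon_of (w @ [e])) = mset_of_mon (mon_of w) + replicate_mset e (length w)"
  by (rule multiset_eqI) (auto simp: nth_default_def nth_append)

lemma tdeg_mon_of: "tdeg (mon_of w) = sum_list w"
proof (induction w rule: rev_induct)
  case (snoc e w)
  then show ?case by (simp add: mset_mon_of_snoc)
qed simp

lemma mon_of_Mon: "length w \<le> k \<Longrightarrow> mon_of w \<in> Mon k"
  by (rule MonI) (simp add: nth_default_def)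

lemma word_mon_of: "length w = k \<Longrightarrow> word k (mon_of w) = w"
  by (rule nth_equalityI) (auto simp: nth_default_def)

lemma mon_of_word: "m \<in> Mon k \<Longrightarrow> mon_of (word k m) = m"
  by (rule poly_mapping_eqI) (auto simp: nth_default_def Mon_lookup)

lemma mon_of_inject: "length v = length w \<Longrightarrow> mon_of v = mon_of w \<longleftrightarrow> v = w"
  using word_mon_of by metis

lemma mset_mon_of_less:
  assumes "length v = n" "length w = n" "d < e"
  shows "mset_of_mon (mon_of (v @ [d])) < mset_of_mon (mon_of (w @ [e]))"
  unfolding less_multiset\<^sub>H\<^sub>O
proof (intro conjI allI impI)
  show "mset_of_mon (mon_of (v @ [d])) \<noteq> mset_of_mon (mon_of (w @ [e]))"
    using assms by (simp add: mset_of_mon_inject mon_of_inject)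
  fix y assume "count (mset_of_mon (mon_of (w @ [e]))) y < count (mset_of_mon (mon_of (v @ [d]))) y"
  then have "y < n" using assms by (auto simp: nth_default_def nth_append split: if_splits)
  then show "\<exists>x>y. count (mset_of_mon (mon_of (v @ [d]))) x < count (mset_of_mon (mon_of (w @ [e]))) x"
    using assms by (intro exI[of _ n]) (simp add: nth_default_def nth_append)
qed

lemma sorted_all_words:
  "sorted_wrt (\<lambda>v w. mset_of_mon (mon_of w) < mset_of_mon (mon_of v)) (all_words b n)"
proof (induction n)
  case (Suc n)
  have "sorted_wrt (\<lambda>v w. mset_of_mon (mon_of w) < mset_of_mon (mon_of v))
      (concat (map (\<lambda>e. map (\<lambda>w. w @ [e]) (all_words b n)) es))" if "sorted_wrt (>) es" for es
    using that
  proof (induction es)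
    case (Cons e es)
    have "sorted_wrt (\<lambda>v w. mset_of_mon (mon_of w) < mset_of_mon (mon_of v)) (map (\<lambda>w. w @ [e]) (all_words b n))"
      unfolding sorted_wrt_map
      by (rule sorted_wrt_mono_rel[OF _ Suc]) (auto simp: mset_mon_of_snoc set_all_words)
    with Cons show ?case
      by (auto simp: sorted_wrt_append set_all_words intro!: mset_mon_of_less[of _ n])
  qed simp
  moreover have "sorted_wrt (>) (rev [0..<Suc b])"
    by (simp add: sorted_wrt_rev del: upt_Suc)
  ultimately show ?case by (simp del: upt_Suc)
qed simp

lemma sorted_box_words: "sorted_wrt (\<lambda>v w. mkey (mon_of w) < mkey (mon_of v)) (box_words k)"
proof -
  have "sorted_wrt (\<lambda>v w. mkey (mon_of w) < mkey (mon_of v)) (concat (map (deg_words k) ds))"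
    if "sorted_wrt (>) ds" for ds
    using that
  proof (induction ds)
    case (Cons d ds)
    have "sorted_wrt (\<lambda>v w. mset_of_mon (mon_of w) < mset_of_mon (mon_of v)) (deg_words k d)"
      unfolding deg_words_def by (rule sorted_wrt_filter[OF sorted_all_words])
    then have "sorted_wrt (\<lambda>v w. mkey (mon_of w) < mkey (mon_of v)) (deg_words k d)"
      by (rule sorted_wrt_mono_rel[rotated]) (auto simp: mkey_def tdeg_mon_of set_deg_words)
    with Cons show ?case
      by (auto simp: sorted_wrt_append set_deg_words mkey_def tdeg_mon_of)
  qed simp
  moreover have "sorted_wrt (>) (rev [0..<Suc k])"
    by (simp add: sorted_wrt_rev del: upt_Suc)
  ultimately show ?thesis unfolding box_words_def by blast
qed

lemma Box_iff_words: "p \<in> Box k \<longleftrightarrow> mkeys p \<subseteq> mon_of ` set (box_words k)"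
proof -
  have "m \<in> Mon k \<and> tdeg m \<le> k \<longleftrightarrow> m \<in> mon_of ` set (box_words k)" for m
  proof
    assume "m \<in> Mon k \<and> tdeg m \<le> k"
    then show "m \<in> mon_of ` set (box_words k)"
      using tdeg_mon_of[of "word k m"] mon_of_word[of m k]
      by (intro image_eqI[of _ _ "word k m"]) (auto simp: set_box_words)
  qed (auto simp: set_box_words tdeg_mon_of mon_of_Mon)
  then show ?thesis by (auto simp: Box_def)
qed

section \<open>Elimination\<close>

text \<open>Terms need not be collected, so a word may occur repeatedly and its coefficients are
  added.\<close>

definition coef :: "nat list \<Rightarrow> 'a::field poly_expr \<Rightarrow> 'a" where
  "coef w p = (\<Sum>(c, v)\<leftarrow>p. if v = w then c else 0)"

definition scale_expr :: "'a::field \<Rightarrow> 'a poly_expr \<Rightarrow> 'a poly_expr" where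
  "scale_expr c p = map (\<lambda>(d, w). (c * d, w)) p"

definition map_words :: "(nat list \<Rightarrow> nat list) \<Rightarrow> 'a poly_expr \<Rightarrow> 'a poly_expr" where
  "map_words f p = map (\<lambda>(c, w). (c, f w)) p"

text \<open>Cross-multiplication eliminates w without division. Applied to the pivot itself it gives
  an expression of 0, so the pivot drops out of the span.\<close>

definition cross :: "nat list \<Rightarrow> 'a::field poly_expr \<Rightarrow> 'a poly_expr \<Rightarrow> 'a poly_expr" where
  "cross w p q = scale_expr (coef w p) q @ scale_expr (- coef w q) p"

definition elim_word :: "nat list \<Rightarrow> 'a::field poly_expr list \<Rightarrow> 'a poly_expr list" where
  "elim_word w L = (case filter (\<lambda>p. coef w p \<noteq> 0) L of [] \<Rightarrow> L | p # _ \<Rightarrow> map (cross w p) L)"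

definition leads_step :: "nat list \<Rightarrow> 'a::field poly_expr list \<times> nat list list \<Rightarrow> 'a poly_expr list \<times> nat list list" where
  "leads_step w s = (elim_word w (fst s),
     if filter (\<lambda>p. coef w p \<noteq> 0) (fst s) = [] then snd s else w # snd s)"

lemma leads_step_Pair:
  "leads_step w (L, acc) = (elim_word w L, if filter (\<lambda>p. coef w p \<noteq> 0) L = [] then acc else w # acc)"
  by (simp add: leads_step_def)

definition leads :: "nat list list \<Rightarrow> 'a::field poly_expr list \<Rightarrow> nat list list" where
  "leads ws L = snd (fold leads_step ws (L, []))"

definition has_length :: "nat \<Rightarrow> 'a poly_expr \<Rightarrow> bool" where
  "has_length k p \<longleftrightarrow> (\<forall>(c, w)\<in>set p. length w = k)"

abbreviation polys :: "'a::field poly_expr list \<Rightarrow> 'a mpoly set" where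
  "polys L \<equiv> poly_of_expr ` set L"

lemma poly_of_expr_simps [simp]:
  "poly_of_expr [] = 0"
  "poly_of_expr ((c, w) # p) = sg (mon_of w) c + poly_of_expr p"
  "poly_of_expr (p @ q) = poly_of_expr p + poly_of_expr q"
  by (simp_all add: poly_of_expr_def)

lemma lookup_poly_of_expr:
  "has_length k p \<Longrightarrow> length w = k \<Longrightarrow> lk (poly_of_expr p) (mon_of w) = coef w p"
  by (induction p) (auto simp: has_length_def coef_def lookup_add lookup_single when_def mon_of_inject)

lemma poly_of_expr_scale: "poly_of_expr (scale_expr c p) = scl c (poly_of_expr p)"
  by (induction p) (auto simp: scale_expr_def scl_def mult_single distrib_left)

lemma poly_of_expr_map_words_perm:
  assumes "has_length k p" "\<And>w. length w = k \<Longrightarrow> mon_of (f w) = perm_mon \<sigma> (mon_of w)"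
  shows "poly_of_expr (map_words f p) = perm_poly \<sigma> (poly_of_expr p)"
  using assms(1) by (induction p) (auto simp: has_length_def map_words_def assms(2) perm_poly_add)

lemma poly_of_expr_map_words_mult:
  assumes "has_length k p" "\<And>w. length w = k \<Longrightarrow> mon_of (f w) = t + mon_of w"
  shows "poly_of_expr (map_words f p) = sg t 1 * poly_of_expr p"
  using assms(1) by (induction p) (auto simp: has_length_def map_words_def assms(2) mult_single distrib_left)

lemma poly_of_expr_map_words_id:
  assumes "\<forall>(c, w)\<in>set p. mon_of (f w) = mon_of w"
  shows "poly_of_expr (map_words f p) = poly_of_expr p"
  using assms by (induction p) (auto simp: map_words_def)

lemma poly_of_expr_cross:
  "poly_of_expr (cross w p q) = scl (coef w p) (poly_of_expr q) - scl (coef w q) (poly_of_expr p)"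
  by (simp add: cross_def poly_of_expr_scale)

lemma has_length_cross: "has_length k p \<Longrightarrow> has_length k q \<Longrightarrow> has_length k (cross w p q)"
  by (auto simp: has_length_def cross_def scale_expr_def)

lemma filter_eq_Cons_head: "filter P xs = x # ys \<Longrightarrow> x \<in> set xs \<and> P x"
proof -
  assume eq: "filter P xs = x # ys"
  have "x \<in> set (filter P xs)" by (simp add: eq)
  then show ?thesis by simp
qed

lemma has_length_elim_word:
  "\<forall>p\<in>set L. has_length k p \<Longrightarrow> \<forall>p\<in>set (elim_word w L). has_length k p"
  by (auto simp: elim_word_def has_length_cross dest: filter_eq_Cons_head split: list.splits)

lemma span_image_linear:
  assumes lin: "\<And>a x y. \<phi> (scl a x + y) = scl a (\<phi> x) + \<phi> y" and q: "q \<in> mp.span S"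
  shows "\<phi> q \<in> mp.span (\<phi> ` S)"
  using q
proof (induction rule: mp.span_induct_alt)
  case base
  have "\<phi> 0 = \<phi> 0 + \<phi> 0" using lin[of 1 0 0] by (simp only: mp.scale_one add_0_left)
  then have "\<phi> 0 = 0" by (simp only: add_cancel_right_right)
  then show ?case by (simp add: mp.span_zero)
next
  case (step a x y)
  show ?case
    unfolding lin by (rule mp.span_add[OF mp.span_scale[OF mp.span_base[OF imageI[OF step(1)]]] step(2)])
qed

text \<open>If there is a pivot, the list is mapped by the linear \<phi>, which kills the
  coefficient at w and multiplies by the nonzero c every polynomial that has none there.\<close>

lemma span_elim_word:
  assumes L: "\<forall>p\<in>set L. has_length k p" and w: "length w = k"
  shows "mp.span (polys (elim_word w L)) = {p \<in> mp.span (polys L). lk p (mon_of w) = 0}"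
proof (cases "filter (\<lambda>p. coef w p \<noteq> 0) L")
  case Nil
  have "lk p (mon_of w) = 0" if "p \<in> mp.span (polys L)" for p
    using that
  proof (induction rule: mp.span_induct_alt)
    case (step c b q)
    from step(1) obtain x where x: "x \<in> set L" "b = poly_of_expr x" by auto
    then have "lk b (mon_of w) = 0"
      using lookup_poly_of_expr[OF _ w, of x] L Nil by (auto simp: filter_empty_conv)
    with step(2) show ?case by (simp add: lookup_add)
  qed simp
  then show ?thesis using Nil by (auto simp: elim_word_def)
next
  case (Cons p ps)
  then have p: "p \<in> set L" "coef w p \<noteq> 0" by (auto dest: filter_eq_Cons_head)
  define P where "P = poly_of_expr p"
  define c where "c = coef w p"
  define \<phi> where "\<phi> q = scl c q - scl (lk q (mon_of w)) P" for q
  have lkP: "lk P (mon_of w) = c" unfolding P_def c_def using L p w by (intro lookup_poly_of_expr) auto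
  have lin: "\<phi> (scl a x + y) = scl a (\<phi> x) + \<phi> y" for a x y
    by (rule poly_mapping_eqI) (simp add: \<phi>_def lookup_add lookup_minus algebra_simps)
  have im: "polys (elim_word w L) = \<phi> ` polys L"
    using L by (auto simp: elim_word_def Cons poly_of_expr_cross \<phi>_def c_def P_def image_image
        lookup_poly_of_expr[OF _ w] intro!: image_cong)
  have PL: "P \<in> mp.span (polys L)" unfolding P_def using p by (intro mp.span_base) auto
  have \<phi>L: "\<phi> q \<in> mp.span (polys L)" if "q \<in> mp.span (polys L)" for q
    unfolding \<phi>_def using that PL by (intro mp.span_diff mp.span_scale)
  have \<phi>0: "lk (\<phi> q) (mon_of w) = 0" for q by (simp add: \<phi>_def lookup_minus lkP)
  show ?thesis
  proof (intro equalityI subsetI CollectI conjI)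
    fix q assume q: "q \<in> mp.span (polys (elim_word w L))"
    have "mp.subspace {q \<in> mp.span (polys L). lk q (mon_of w) = 0}"
      unfolding mp.subspace_def
      by (auto simp: mp.span_zero mp.span_add mp.span_scale lookup_add)
    then have "mp.span (polys (elim_word w L)) \<subseteq> {q \<in> mp.span (polys L). lk q (mon_of w) = 0}"
      by (intro mp.span_minimal) (auto simp: im \<phi>0 mp.span_base intro!: \<phi>L)
    with q show "q \<in> mp.span (polys L)" "lk q (mon_of w) = 0" by auto
  next
    fix q assume q: "q \<in> {q \<in> mp.span (polys L). lk q (mon_of w) = 0}"
    then have "\<phi> q \<in> mp.span (\<phi> ` polys L)" by (intro span_image_linear[OF lin]) simp
    moreover have "\<phi> q = scl c q" using q by (simp add: \<phi>_def)
    ultimately have "scl (inverse c) (scl c q) \<in> mp.span (\<phi> ` polys L)" by (metis mp.span_scale)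
    then show "q \<in> mp.span (polys (elim_word w L))" using p by (simp add: im c_def)
  qed
qed

lemma span_fold_elim_word:
  assumes "\<forall>p\<in>set L. has_length k p" "\<forall>w\<in>set ws. length w = k"
  shows "(\<forall>p\<in>set (fold elim_word ws L). has_length k p) \<and>
    mp.span (polys (fold elim_word ws L)) = {p \<in> mp.span (polys L). \<forall>w\<in>set ws. lk p (mon_of w) = 0}"
  using assms
proof (induction ws arbitrary: L)
  case (Cons w ws)
  have "\<forall>p\<in>set (elim_word w L). has_length k p" using Cons.prems by (intro has_length_elim_word) auto
  with Cons.IH[of "elim_word w L"] Cons.prems span_elim_word[of L k w] show ?case by auto
qed simp

lemma coef_nonzero_iff:
  assumes L: "\<forall>p\<in>set L. has_length k p" and w: "length w = k"
  shows "filter (\<lambda>p. coef w p \<noteq> 0) L = [] \<longleftrightarrow> (\<forall>p\<in>mp.span (polys L). lk p (mon_of w) = 0)"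
proof
  assume "filter (\<lambda>p. coef w p \<noteq> 0) L = []"
  then have "elim_word w L = L" by (simp add: elim_word_def)
  with span_elim_word[OF assms] show "\<forall>p\<in>mp.span (polys L). lk p (mon_of w) = 0" by auto
next
  assume "\<forall>p\<in>mp.span (polys L). lk p (mon_of w) = 0"
  then have "coef w p = 0" if "p \<in> set L" for p
    using that L lookup_poly_of_expr[OF _ w, of p] mp.span_base[of "poly_of_expr p" "polys L"] by auto
  then show "filter (\<lambda>p. coef w p \<noteq> 0) L = []" by (auto simp: filter_empty_conv)
qed

text \<open>As the words decrease, an element with a nonzero coefficient at the first one has it as
  leading monomial; the elements without it form the span after elimination, supported on the
  remaining words.\<close>

lemma set_fold_leads_step:
  assumes "\<forall>p\<in>set L. has_length k p" "\<forall>w\<in>set ws. length w = k"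
    and "sorted_wrt (\<lambda>v w. mkey (mon_of w) < mkey (mon_of v)) ws"
    and "\<forall>p\<in>mp.span (polys L). mkeys p \<subseteq> mon_of ` set ws"
  shows "mon_of ` set (snd (fold leads_step ws (L, acc))) = mon_of ` set acc \<union> LM (mp.span (polys L)) \<and>
    set (snd (fold leads_step ws (L, acc))) \<subseteq> set acc \<union> set ws"
  using assms
proof (induction ws arbitrary: L acc)
  case Nil
  then have "mp.span (polys L) \<subseteq> {0}" by auto
  then show ?case by (auto simp: LM_def)
next
  case (Cons w ws)
  let ?W = "mp.span (polys L)" and ?W' = "{p \<in> mp.span (polys L). lk p (mon_of w) = 0}"
  have span': "mp.span (polys (elim_word w L)) = ?W'" using Cons.prems by (intro span_elim_word) auto
  have "\<forall>p\<in>?W'. mkeys p \<subseteq> mon_of ` set ws" 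
  proof (intro ballI subsetI)
    fix p m assume p: "p \<in> ?W'" and m: "m \<in> mkeys p"
    then have "m \<noteq> mon_of w" by (auto simp: in_keys_iff)
    moreover have "m \<in> mon_of ` set (w # ws)" using Cons.prems(4) p m by blast
    ultimately show "m \<in> mon_of ` set ws" by auto
  qed
  then have IH: "mon_of ` set (snd (fold leads_step ws (elim_word w L, a))) = mon_of ` set a \<union> LM ?W' \<and>
      set (snd (fold leads_step ws (elim_word w L, a))) \<subseteq> set a \<union> set ws" for a
    unfolding span'[symmetric] using Cons.prems by (intro Cons.IH has_length_elim_word) auto
  have lmw: "lm p = mon_of w" if "p \<in> ?W" "lk p (mon_of w) \<noteq> 0" for p
  proof (rule lm_eqI)
    show "mon_of w \<in> mkeys p" using that(2) by (simp add: in_keys_iff)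
    fix s assume "s \<in> mkeys p"
    with Cons.prems(4) that(1) have "s \<in> mon_of ` set (w # ws)" by blast
    with Cons.prems(3) show "mkey s \<le> mkey (mon_of w)" by (auto intro: less_imp_le)
  qed
  show ?case
  proof (cases "filter (\<lambda>p. coef w p \<noteq> 0) L = []")
    case True
    then have "?W' = ?W" using coef_nonzero_iff[of L k w] Cons.prems by auto
    with True IH[of acc] show ?thesis by (auto simp: leads_step_Pair)
  next
    case False
    then obtain p where p: "p \<in> ?W" "lk p (mon_of w) \<noteq> 0"
      using coef_nonzero_iff[of L k w] Cons.prems by auto
    have "LM ?W = insert (mon_of w) (LM ?W')"
    proof (intro equalityI subsetI)
      fix t assume "t \<in> LM ?W"
      then obtain q where "t = lm q" "q \<in> ?W - {0}" unfolding LM_def by (rule imageE)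
      then show "t \<in> insert (mon_of w) (LM ?W')"
        using lmw[of q] by (cases "lk q (mon_of w) = 0") (auto simp: LM_def)
    next
      fix t assume "t \<in> insert (mon_of w) (LM ?W')"
      moreover have "mon_of w \<in> LM ?W"
        unfolding LM_def using p lmw[OF p] by (intro image_eqI[of _ _ p]) auto
      moreover have "LM ?W' \<subseteq> LM ?W" by (intro LM_mono) auto
      ultimately show "t \<in> LM ?W" by blast
    qed
    with False IH[of "w # acc"] show ?thesis by (auto simp: leads_step_Pair)
  qed
qed

lemma leads_box_words:
  assumes "\<forall>p\<in>set L. has_length k p" "mp.span (polys L) \<subseteq> Box k"
  shows "mon_of ` set (leads (box_words k) L) = LM (mp.span (polys L))"
    and "set (leads (box_words k) L) \<subseteq> {w. length w = k}"
proof -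
  have "mon_of ` set (snd (fold leads_step (box_words k) (L, []))) = mon_of ` set [] \<union> LM (mp.span (polys L)) \<and>
    set (snd (fold leads_step (box_words k) (L, []))) \<subseteq> set [] \<union> set (box_words k)"
  proof (rule set_fold_leads_step)
    show "\<forall>p\<in>mp.span (polys L). mkeys p \<subseteq> mon_of ` set (box_words k)"
      using assms(2) Box_iff_words by blast
  qed (use assms(1) in \<open>auto simp: set_box_words sorted_box_words\<close>)
  then show "mon_of ` set (leads (box_words k) L) = LM (mp.span (polys L))"
    and "set (leads (box_words k) L) \<subseteq> {w. length w = k}"
    by (auto simp: leads_def set_box_words)
qed

section \<open>The algorithm\<close>

fun swap_word :: "nat list \<Rightarrow> nat list" where
  "swap_word (a # b # w) = b # a # w" | "swap_word w = w"

fun inc_word :: "nat list \<Rightarrow> nat list" where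
  "inc_word (a # w) = Suc a # w" | "inc_word [] = []"

text \<open>For lists in the box the new multiples have degree at most \<open>k + 1\<close>, so
  eliminating the words of exactly this degree intersects the span with the box.\<close>

definition step_exprs :: "nat \<Rightarrow> 'a::field poly_expr list \<Rightarrow> 'a poly_expr list" where
  "step_exprs k L = fold elim_word (deg_words k (Suc k))
     (L @ map (map_words rotate1) L @ map (map_words swap_word) L @ map (map_words inc_word) L)"

text \<open>The iteration count is the number of monomials of the box, which bounds the number of
  leading monomials.\<close>

definition basis :: "nat \<Rightarrow> 'a::field poly_expr list \<Rightarrow> 'a poly_expr list" where
  "basis k L = (step_exprs k ^^ length (box_words k)) L"

definition pad :: "nat \<Rightarrow> nat list \<Rightarrow> nat list" where
  "pad k w = take k (w @ replicate k 0)"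

text \<open>Greedy subword test: the letters of u are matched in turn, each with the earliest letter
  of v that is large enough; the value is the unmatched rest.\<close>

definition remainder :: "nat list \<Rightarrow> nat list \<Rightarrow> nat list" where
  "remainder u v = fold (\<lambda>b u. case u of [] \<Rightarrow> [] | a # u' \<Rightarrow> if a \<le> b then u' else u) v u"

text \<open>Filters stand for quantifiers, to keep the test computable. The zeros z appended to each
  word give room for index maps that go beyond its length.\<close>

definition covers_words :: "nat list \<Rightarrow> nat list list \<Rightarrow> nat list list \<Rightarrow> bool" where
  "covers_words z U W \<longleftrightarrow> filter (\<lambda>w. filter (\<lambda>u. remainder u (w @ z) = []) U = []) W = []"

definition trunc_basis :: "nat \<Rightarrow> 'a::field poly_expr list \<Rightarrow> 'a poly_expr list" where
  "trunc_basis k tss = basis k (map (map_words (pad k)) tss)"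

definition trunc_leads :: "nat \<Rightarrow> 'a::field poly_expr list \<Rightarrow> nat list list" where
  "trunc_leads k tss = leads (box_words k) (trunc_basis k tss)"

definition ext_leads :: "nat \<Rightarrow> 'a::field poly_expr list \<Rightarrow> 'a poly_expr \<Rightarrow> nat list list" where
  "ext_leads k tss ts = leads (box_words k) (map_words (pad k) ts # trunc_basis k tss)"

text \<open>A crude bound on the length and the degree of every term, hence on the box that holds
  the polynomial.\<close>

definition expr_size :: "'a poly_expr \<Rightarrow> nat" where
  "expr_size p = (\<Sum>(c, w)\<leftarrow>p. length w + sum_list w)"

text \<open>The summand 2 puts both indices that the swap exchanges, 0 and 1, below k.\<close>

definition start :: "'a poly_expr list \<Rightarrow> 'a poly_expr \<Rightarrow> nat" where
  "start tss ts = 2 + (expr_size ts + (\<Sum>p\<leftarrow>tss. expr_size p))"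

definition accepts :: "'a::field poly_expr list \<Rightarrow> 'a poly_expr \<Rightarrow> nat \<Rightarrow> bool" where
  "accepts tss ts k \<longleftrightarrow> covers_words [] (trunc_leads k tss) (ext_leads k tss ts)"

definition decided :: "'a::field poly_expr list \<Rightarrow> 'a poly_expr \<Rightarrow> nat \<Rightarrow> bool" where
  "decided tss ts k \<longleftrightarrow> covers_words [] (trunc_leads k tss) (trunc_leads (k + k) tss) \<and>
     (accepts tss ts k \<or> \<not> covers_words (replicate k 0) (trunc_leads k tss) (ext_leads k tss ts))"

definition decide :: "'a::field poly_expr list \<Rightarrow> 'a poly_expr \<Rightarrow> bool" where
  "decide tss ts \<longleftrightarrow> accepts tss ts (start tss ts + (LEAST n. decided tss ts (start tss ts + n)))"

text \<open>Greedy matching is optimal: if \<open>a \<le> b\<close>, an embedding of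
  \<open>a # u'\<close> that skips b can be changed to use b for a.\<close>

lemma remainder_eq_Nil_iff: "remainder u v = [] \<longleftrightarrow> emb u v"
proof (induction v arbitrary: u)
  case Nil
  then show ?case by (cases u) (auto simp: remainder_def)
next
  case (Cons b v)
  show ?case
  proof (cases u)
    case Nil
    then show ?thesis using Cons[of "[]"] by (simp add: remainder_def)
  next
    case u: (Cons a u')
    have "emb (a # u') (b # v) \<longleftrightarrow> (if a \<le> b then emb u' v else emb (a # u') v)"
      by (auto elim: list_emb.cases intro: list_emb_Cons2 dest: list_emb_ConsD)
    then show ?thesis using Cons[of u'] Cons[of "a # u'"] u by (simp add: remainder_def)
  qed
qed

section \<open>Exponent words under the three operations\<close>

lemma perm_mon_eqI:
  assumes "\<sigma> permutes {..<k}" "m \<in> Mon k" "m' \<in> Mon k" "\<And>i. i < k \<Longrightarrow> lk m' (\<sigma> i) = lk m i"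
  shows "m' = perm_mon \<sigma> m"
proof (rule poly_mapping_eqI)
  fix j
  have im: "\<sigma> ` {..<k} = {..<k}" by (rule permutes_image[OF assms(1)])
  show "lk m' j = lk (perm_mon \<sigma> m) j"
  proof (cases "j < k")
    case True
    with im obtain i where i: "i < k" "j = \<sigma> i" by auto
    then show ?thesis using lookup_perm_mon[OF permutes_inj_on[OF assms(1)] assms(2) i(1)] assms(4) by simp
  next
    case False
    then have "lk (perm_mon \<sigma> m) j = 0" by (intro lookup_perm_mon_notin[OF assms(2)]) (simp add: im)
    with False show ?thesis using Mon_lookup[OF assms(3)] by simp
  qed
qed

lemma mon_of_rotate1: "length w = k \<Longrightarrow> 0 < k \<Longrightarrow> mon_of (rotate1 w) = perm_mon (cyc k) (mon_of w)"
proof (rule perm_mon_eqI[OF cyc_permutes])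
  fix i assume "length w = k" "0 < k" "i < k"
  then show "lk (mon_of (rotate1 w)) (cyc k i) = lk (mon_of w) i"
    by (auto simp: nth_default_def cyc_def nth_rotate1)
qed (auto intro: mon_of_Mon)

lemma length_swap_word [simp]: "length (swap_word w) = length w"
  by (cases w rule: swap_word.cases) auto

lemma mon_of_swap_word: "length w = k \<Longrightarrow> 2 \<le> k \<Longrightarrow> mon_of (swap_word w) = perm_mon (transpose 0 1) (mon_of w)"
proof (rule perm_mon_eqI[of _ k])
  fix i assume k: "length w = k" "2 \<le> k" "i < k"
  then obtain a b v where "w = a # b # v" by (metis Suc_le_length_iff numeral_2_eq_2)
  then show "lk (mon_of (swap_word w)) (transpose 0 1 i) = lk (mon_of w) i"
    by (auto simp: nth_default_def transpose_def nth_Cons' split: if_splits)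
next
  assume "length w = k" "2 \<le> k"
  then show "mon_of (swap_word w) \<in> Mon k" by (intro mon_of_Mon) simp
qed (auto intro: mon_of_Mon permutes_swap_id)

lemma mon_of_inc_word: "w \<noteq> [] \<Longrightarrow> mon_of (inc_word w) = sg 0 1 + mon_of w"
proof (rule poly_mapping_eqI)
  fix i assume "w \<noteq> []"
  then show "lk (mon_of (inc_word w)) i = lk (sg 0 1 + mon_of w) i"
    by (cases w; cases i) (simp_all add: lookup_add lookup_single del: single_one)
qed

lemma length_inc_word [simp]: "length (inc_word w) = length w"
  by (cases w) auto

lemma has_length_map_words:
  "has_length k p \<Longrightarrow> (\<And>w. length w = k \<Longrightarrow> length (f w) = k) \<Longrightarrow> has_length k (map_words f p)"
  by (auto simp: has_length_def map_words_def)

lemma step_exprs: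
  assumes L: "\<forall>p\<in>set L. has_length k p" and box: "polys L \<subseteq> Box k" and k: "2 \<le> k"
  shows "(\<forall>p\<in>set (step_exprs k L). has_length k p) \<and>
    mp.span (polys (step_exprs k L)) = op_closure k (mp.span (polys L))"
proof -
  let ?L = "L @ map (map_words rotate1) L @ map (map_words swap_word) L @ map (map_words inc_word) L"
  let ?c = "perm_poly (cyc k)" and ?t = "perm_poly (transpose 0 1)" and ?x = "\<lambda>p. sg (sg 0 1) 1 * p"
  have len: "\<forall>p\<in>set ?L. has_length k p" using L by (auto intro!: has_length_map_words)
  have "poly_of_expr (map_words rotate1 p) = ?c (poly_of_expr p)"
    "poly_of_expr (map_words swap_word p) = ?t (poly_of_expr p)"
    "poly_of_expr (map_words inc_word p) = ?x (poly_of_expr p)" if "p \<in> set L" for p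
  proof -
    have p: "has_length k p" using that L by blast
    have "mon_of (inc_word w) = sg 0 1 + mon_of w" if "length w = k" for w
      using that k by (intro mon_of_inc_word) auto
    then show "poly_of_expr (map_words inc_word p) = ?x (poly_of_expr p)"
      by (rule poly_of_expr_map_words_mult[OF p])
    show "poly_of_expr (map_words rotate1 p) = ?c (poly_of_expr p)"
      using k by (intro poly_of_expr_map_words_perm[OF p] mon_of_rotate1) auto
    show "poly_of_expr (map_words swap_word p) = ?t (poly_of_expr p)"
      using k by (intro poly_of_expr_map_words_perm[OF p] mon_of_swap_word)
  qed
  then have polys: "polys ?L = polys L \<union> ?c ` polys L \<union> ?t ` polys L \<union> ?x ` polys L"
    unfolding set_append set_map image_Un image_image by (auto simp: image_iff)
  let ?W = "mp.span (polys L)"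
  have span: "mp.span (polys ?L) = mp.span (?W \<union> ?c ` ?W \<union> ?t ` ?W \<union> ?x ` ?W)"
  proof (rule antisym)
    show "mp.span (polys ?L) \<subseteq> mp.span (?W \<union> ?c ` ?W \<union> ?t ` ?W \<union> ?x ` ?W)"
      unfolding polys using mp.span_superset[of "polys L"] by (intro mp.span_mono) blast
    have sub: "mp.span S \<subseteq> mp.span (polys ?L)" if "S \<subseteq> polys ?L" for S
      using that by (rule mp.span_mono)
    have lin: "?c (scl a p + q) = scl a (?c p) + ?c q" "?t (scl a p + q) = scl a (?t p) + ?t q"
      "?x (scl a p + q) = scl a (?x p) + ?x q" for a p q
      by (simp_all only: perm_poly_add perm_poly_scl distrib_left scl_mult)
    have "?W \<union> ?c ` ?W \<union> ?t ` ?W \<union> ?x ` ?W \<subseteq> mp.span (polys ?L)"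
    proof (intro Un_least image_subsetI)
      show "?W \<subseteq> mp.span (polys ?L)" by (rule sub) (simp only: polys Un_assoc Un_upper1)
      fix p assume p: "p \<in> ?W"
      show "?c p \<in> mp.span (polys ?L)"
        by (rule subsetD[OF sub span_image_linear[OF lin(1) p]]) (unfold polys, blast)
      show "?t p \<in> mp.span (polys ?L)"
        by (rule subsetD[OF sub span_image_linear[OF lin(2) p]]) (unfold polys, blast)
      show "?x p \<in> mp.span (polys ?L)"
        by (rule subsetD[OF sub span_image_linear[OF lin(3) p]]) (unfold polys, blast)
    qed
    then show "mp.span (?W \<union> ?c ` ?W \<union> ?t ` ?W \<union> ?x ` ?W) \<subseteq> mp.span (polys ?L)"
      by (rule mp.span_minimal) (rule mp.subspace_span)
  qed
  let ?B = "{p. \<forall>m\<in>mkeys p. m \<in> Mon k \<and> tdeg m \<le> Suc k}"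
  have "mp.subspace ?B"
    unfolding mp.subspace_def by (auto simp: in_keys_iff lookup_add)
  moreover have "polys ?L \<subseteq> ?B"
  proof -
    have c: "?c p \<in> Box k" if "p \<in> Box k" for p
      using that permutes_image[OF cyc_permutes] permutes_inj_on[OF cyc_permutes] k
      by (intro Box_perm_poly[of _ k]) auto
    have t: "?t p \<in> Box k" if "p \<in> Box k" for p
    proof -
      have "transpose 0 1 permutes {..<k}" using k by (auto intro: permutes_swap_id)
      from permutes_image[OF this] permutes_inj_on[OF this] that show ?thesis
        by (intro Box_perm_poly[of _ k]) auto
    qed
    have "sg 0 (1::nat) \<in> Mon k" using k by (simp add: Mon_def)
    then have x: "?x p \<in> ?B" if "p \<in> Box k" for p
      using that by (auto simp: Box_def keys_sg_mult Mon_add_iff tdeg_add mset_of_mon_single simp del: single_one)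
    have B: "p \<in> ?B" if "p \<in> Box k" for p using that by (auto simp: Box_def)
    have "polys L \<union> ?c ` polys L \<union> ?t ` polys L \<subseteq> Box k" using box c t by blast
    then have "polys L \<union> ?c ` polys L \<union> ?t ` polys L \<subseteq> ?B" using B by (rule subset_trans[OF _ subsetI])
    moreover have "?x ` polys L \<subseteq> ?B" by (rule image_subsetI) (rule x[OF subsetD[OF box]])
    ultimately show ?thesis unfolding polys by (rule Un_least)
  qed
  ultimately have low: "mp.span (polys ?L) \<subseteq> ?B" by (rule mp.span_minimal[rotated])
  have box_iff: "(\<forall>w\<in>set (deg_words k (Suc k)). lk p (mon_of w) = 0) \<longleftrightarrow> p \<in> Box k" if "p \<in> ?B" for p
  proof
    assume z: "\<forall>w\<in>set (deg_words k (Suc k)). lk p (mon_of w) = 0"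
    have "tdeg m \<noteq> Suc k" if m: "m \<in> mkeys p" for m
    proof
      assume d: "tdeg m = Suc k"
      have "m \<in> Mon k" using m \<open>p \<in> ?B\<close> by blast
      then have mw: "mon_of (word k m) = m" by (rule mon_of_word)
      then have "word k m \<in> set (deg_words k (Suc k))" using d tdeg_mon_of[of "word k m"] by (simp add: set_deg_words)
      with z mw have "lk p m = 0" by fastforce
      with m show False by (simp add: in_keys_iff)
    qed
    with that show "p \<in> Box k" by (fastforce simp: Box_def le_Suc_eq)
  next
    assume p: "p \<in> Box k"
    show "\<forall>w\<in>set (deg_words k (Suc k)). lk p (mon_of w) = 0"
    proof
      fix w assume "w \<in> set (deg_words k (Suc k))"
      then have "tdeg (mon_of w) = Suc k" by (simp add: set_deg_words tdeg_mon_of)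
      then have "mon_of w \<notin> mkeys p" using p by (force simp: Box_def)
      then show "lk p (mon_of w) = 0" by (simp add: in_keys_iff)
    qed
  qed
  have "\<forall>w\<in>set (deg_words k (Suc k)). length w = k" by (simp add: set_deg_words)
  note res = span_fold_elim_word[OF len this, folded step_exprs_def]
  have "mp.span (polys (step_exprs k L)) = mp.span (polys ?L) \<inter> Box k"
  proof (rule set_eqI)
    fix p
    show "p \<in> mp.span (polys (step_exprs k L)) \<longleftrightarrow> p \<in> mp.span (polys ?L) \<inter> Box k"
      unfolding res[THEN conjunct2] mem_Collect_eq Int_iff
      using box_iff[OF subsetD[OF low]] by (rule conj_cong[OF refl])
  qed
  then have "mp.span (polys (step_exprs k L)) = op_closure k ?W"
    unfolding span op_closure_def .
  with res[THEN conjunct1] show ?thesis by (rule conjI)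
qed

lemma basis:
  assumes L: "\<forall>p\<in>set L. has_length k p" and box: "polys L \<subseteq> Box k" and k: "2 \<le> k"
  shows "\<forall>p\<in>set (basis k L). has_length k p" "mp.span (polys (basis k L)) = trunc (polys L) k"
proof -
  let ?W = "mp.span (polys L)"
  have W: "?W \<subseteq> Box k" using box subspace_Box by (rule mp.span_minimal)
  have "(\<forall>p\<in>set ((step_exprs k ^^ n) L). has_length k p) \<and>
      mp.span (polys ((step_exprs k ^^ n) L)) = (op_closure k ^^ n) ?W \<and> polys ((step_exprs k ^^ n) L) \<subseteq> Box k" for n
  proof (induction n)
    case (Suc n)
    then have *: "(\<forall>p\<in>set ((step_exprs k ^^ Suc n) L). has_length k p) \<and>
      mp.span (polys ((step_exprs k ^^ Suc n) L)) = (op_closure k ^^ Suc n) ?W"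
      using step_exprs[of "(step_exprs k ^^ n) L" k] k by auto
    then have "polys ((step_exprs k ^^ Suc n) L) \<subseteq> Box k"
      using mp.span_superset[of "polys ((step_exprs k ^^ Suc n) L)"] by (auto simp: op_closure_def)
    with * show ?case by blast
  qed (use L box in simp)
  then have "\<forall>p\<in>set (basis k L). has_length k p" "mp.span (polys (basis k L)) = (op_closure k ^^ length (box_words k)) ?W"
    unfolding basis_def by blast+
  moreover have "(op_closure k ^^ length (box_words k)) ?W = trunc (polys L) k"
  proof (rule op_closure_iterate[OF k])
    show "mp.subspace ?W" by (rule mp.subspace_span)
    show "?W \<subseteq> Box k" by (rule W)
    show "polys L \<subseteq> ?W" by (rule mp.span_superset)
    show "?W \<subseteq> trunc (polys L) k"
      using box by (intro mp.span_minimal subspace_trunc) (auto intro: trunc.gen)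
    show "finite (mon_of ` set (box_words k))" by simp
    show "LM V \<subseteq> mon_of ` set (box_words k)" if "V \<subseteq> Box k" for V :: "'a mpoly set"
    proof
      fix t assume "t \<in> LM V"
      then obtain p where "t = lm p" "p \<in> V - {0}" unfolding LM_def by (rule imageE)
      with that show "t \<in> mon_of ` set (box_words k)" using lm_in[of p] Box_iff_words[of p k] by blast
    qed
    show "card (mon_of ` set (box_words k)) \<le> length (box_words k)"
      using card_image_le[of "set (box_words k)" mon_of] card_length[of "box_words k"] by simp
  qed
  ultimately show "\<forall>p\<in>set (basis k L). has_length k p" "mp.span (polys (basis k L)) = trunc (polys L) k"
    by auto
qed

section \<open>Correctness of the decision procedure\<close>

lemma mon_of_pad: "length w \<le> k \<Longrightarrow> mon_of (pad k w) = mon_of w"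
  by (rule poly_mapping_eqI) (auto simp: pad_def nth_default_def nth_append)

lemma pad_expr:
  assumes "expr_size p \<le> k"
  shows "has_length k (map_words (pad k) p)" "poly_of_expr (map_words (pad k) p) = poly_of_expr p"
    "poly_of_expr p \<in> Box k"
proof -
  have sz: "length w \<le> k \<and> sum_list w \<le> k" if "(c, w) \<in> set p" for c w
  proof -
    have "length w + sum_list w \<in> set (map (\<lambda>(c, w). length w + sum_list w) p)"
      using that by force
    then have "length w + sum_list w \<le> expr_size p" unfolding expr_size_def by (rule member_le_sum_list) simp
    with assms show ?thesis by simp
  qed
  show "has_length k (map_words (pad k) p)" by (auto simp: has_length_def map_words_def pad_def)
  show "poly_of_expr (map_words (pad k) p) = poly_of_expr p"
    using sz by (intro poly_of_expr_map_words_id) (auto intro: mon_of_pad)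
  show "poly_of_expr p \<in> Box k"
    using sz
  proof (induction p)
    case (Cons x p)
    obtain c w where x: "x = (c, w)" by fastforce
    have "sg (mon_of w) c \<in> Box k"
      using Cons.prems[of c w] by (auto simp: x Box_def tdeg_mon_of intro: mon_of_Mon)
    moreover have "poly_of_expr p \<in> Box k" using Cons by auto
    ultimately show ?case by (simp add: x mp.subspace_add[OF subspace_Box])
  qed (simp add: mp.subspace_0[OF subspace_Box])
qed

lemma covers_words_iff:
  assumes "\<forall>u\<in>set U. length u = k" "\<forall>w\<in>set W. length w = n"
  shows "covers_words (replicate z 0) U W \<longleftrightarrow> covered k {..<n + z} (mon_of ` set U) (mon_of ` set W)"
proof -
  have "remainder u (w @ replicate z 0) = [] \<longleftrightarrow> covers k {..<n + z} (mon_of u) (mon_of w)"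
    if "u \<in> set U" "w \<in> set W" for u w
  proof -
    have l: "length u = k" "length w = n" using that assms by auto
    have "word (n + z) (mon_of w) = w @ replicate z 0"
      using l(2) by (simp add: word_add mon_of_Mon word_mon_of)
    then show ?thesis
      using l by (simp add: remainder_eq_Nil_iff covers_iff_emb mon_of_Mon word_mon_of)
  qed
  then show ?thesis unfolding covers_words_def covered_def by (auto simp: filter_empty_conv)
qed

lemma
  assumes k: "2 \<le> k" and sz: "\<forall>p\<in>set tss. expr_size p \<le> k"
  defines "F \<equiv> polys tss"
  shows trunc_leads: "mon_of ` set (trunc_leads k tss) = LM (trunc F k)" "\<forall>w\<in>set (trunc_leads k tss). length w = k"
    and ext_leads: "expr_size ts \<le> k \<Longrightarrow>
      mon_of ` set (ext_leads k tss ts) = LM (ext_trunc F (poly_of_expr ts) k) \<and> (\<forall>w\<in>set (ext_leads k tss ts). length w = k)"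
proof -
  have F: "polys (map (map_words (pad k)) tss) = F"
    unfolding F_def using sz by (auto simp: pad_expr image_iff)
  have len: "\<forall>p\<in>set (map (map_words (pad k)) tss). has_length k p" using sz by (auto simp: pad_expr)
  have box: "polys (map (map_words (pad k)) tss) \<subseteq> Box k" unfolding F using sz by (auto simp: F_def pad_expr)
  note B = basis[OF len box k, folded trunc_basis_def, unfolded F]
  have "mp.span (polys (trunc_basis k tss)) \<subseteq> Box k" unfolding B(2) using trunc_Box by blast
  from leads_box_words[OF B(1) this]
  show "mon_of ` set (trunc_leads k tss) = LM (trunc F k)" "\<forall>w\<in>set (trunc_leads k tss). length w = k"
    unfolding trunc_leads_def B(2) by auto
  assume ts: "expr_size ts \<le> k"
  have l: "\<forall>p\<in>set (map_words (pad k) ts # trunc_basis k tss). has_length k p" using B(1) ts by (simp add: pad_expr)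
  have "polys (map_words (pad k) ts # trunc_basis k tss) = insert (poly_of_expr ts) (polys (trunc_basis k tss))"
    using ts by (simp add: pad_expr)
  then have s: "mp.span (polys (map_words (pad k) ts # trunc_basis k tss)) = ext_trunc F (poly_of_expr ts) k"
    by (simp only: mp.span_insert mp.span_span B(2)[symmetric])
  have "ext_trunc F (poly_of_expr ts) k \<subseteq> Box k"
    using trunc_Box pad_expr(3)[OF ts] by (intro mp.span_minimal subspace_Box) blast
  from leads_box_words[OF l this[folded s]]
  show "mon_of ` set (ext_leads k tss ts) = LM (ext_trunc F (poly_of_expr ts) k) \<and> (\<forall>w\<in>set (ext_leads k tss ts). length w = k)"
    unfolding ext_leads_def s by auto
qed

lemma size_le_start:
  assumes "start tss ts \<le> k"
  shows "2 \<le> k" "expr_size ts \<le> k" "p \<in> set tss \<Longrightarrow> expr_size p \<le> k"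
proof -
  show "2 \<le> k" "expr_size ts \<le> k" using assms by (auto simp: start_def)
  assume "p \<in> set tss"
  then have "expr_size p \<le> (\<Sum>p\<leftarrow>tss. expr_size p)" by (intro member_le_sum_list) auto
  with assms show "expr_size p \<le> k" by (simp add: start_def)
qed

lemma
  assumes k: "start tss ts \<le> k"
  shows accepts_iff: "accepts tss ts k \<longleftrightarrow>
      covered k {..<k} (LM (trunc (polys tss) k)) (LM (ext_trunc (polys tss) (poly_of_expr ts) k))"
    and decided_iff: "decided tss ts k \<longleftrightarrow> conclusive (polys tss) (poly_of_expr ts) k"
proof -
  note sz = size_le_start[OF k]
  have sz': "\<forall>p\<in>set tss. expr_size p \<le> k" "\<forall>p\<in>set tss. expr_size p \<le> k + k" "2 \<le> k + k"
    using sz(1,3) by (auto intro: trans_le_add1)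
  note t = trunc_leads[OF sz(1) sz'(1)] and t2 = trunc_leads[OF sz'(3,2)]
  note e = ext_leads[OF sz(1) sz'(1) sz(2), THEN conjunct1] ext_leads[OF sz(1) sz'(1) sz(2), THEN conjunct2]
  show acc: "accepts tss ts k \<longleftrightarrow>
      covered k {..<k} (LM (trunc (polys tss) k)) (LM (ext_trunc (polys tss) (poly_of_expr ts) k))"
    using covers_words_iff[OF t(2) e(2), of 0] unfolding accepts_def t(1) e(1) by simp
  \<comment> \<open>The k appended zeros admit maps with values below \<open>k + k\<close>, which by
    \<open>covers_UNIV_iff\<close> amounts to admitting all increasing maps.\<close>
  have "covered k {..<k + k} (LM (trunc (polys tss) k)) (LM (ext_trunc (polys tss) (poly_of_expr ts) k)) \<longleftrightarrow>
      covered k UNIV (LM (trunc (polys tss) k)) (LM (ext_trunc (polys tss) (poly_of_expr ts) k))"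
  proof -
    have "u \<in> Mon k" if "u \<in> LM (trunc (polys tss) k)" for u using that by (rule LM_trunc_Mon)
    moreover have "v \<in> Mon k" if "v \<in> LM (ext_trunc (polys tss) (poly_of_expr ts) k)" for v
      using that e mon_of_Mon[of _ k] by (metis imageE order_refl)
    ultimately show ?thesis unfolding covered_def by (intro ball_cong bex_cong refl covers_UNIV_iff[symmetric])
  qed
  then show "decided tss ts k \<longleftrightarrow> conclusive (polys tss) (poly_of_expr ts) k"
    using covers_words_iff[OF t(2) t2(2), of 0] covers_words_iff[OF t(2) e(2), of k]
    unfolding decided_def conclusive_def stable_def acc t(1) t2(1) e(1) by (simp add: mult_2)
qed

lemma ex_decided: "\<exists>n. decided tss ts (start tss ts + n)"
proof -
  have "polys tss \<subseteq> Box (start tss ts)"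
    using size_le_start(3)[OF order_refl] by (auto intro!: pad_expr(3))
  then obtain k where k: "start tss ts \<le> k" "conclusive (polys tss) (poly_of_expr ts) k"
    using ex_conclusive by blast
  then obtain n where "k = start tss ts + n" using le_Suc_ex by blast
  with k show ?thesis using decided_iff[OF k(1)] by blast
qed

lemma decide_correct: "decide tss ts \<longleftrightarrow> poly_of_expr ts \<in> group_ring_span (polys tss)"
proof -
  define k where "k = start tss ts + (LEAST n. decided tss ts (start tss ts + n))"
  have k: "start tss ts \<le> k" by (simp add: k_def)
  have "decided tss ts k" unfolding k_def by (rule LeastI_ex[OF ex_decided])
  then have "conclusive (polys tss) (poly_of_expr ts) k" using decided_iff[OF k] by simp
  moreover have "polys tss \<subseteq> Box k" "poly_of_expr ts \<in> Box k"
    using size_le_start[OF k] by (auto intro!: pad_expr(3))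
  ultimately show ?thesis
    unfolding decide_def k_def[symmetric] accepts_iff[OF k] by (intro conclusive_correct)
qed

section \<open>Functions computed by programs\<close>

text \<open>One program for all inputs, hidden behind an existential quantifier: beyond the basic
  rules, computability is derived along the structure of the defining terms and no program is
  written out.\<close>

definition computable :: "('e \<Rightarrow> 'k::field tree) \<Rightarrow> ('b \<Rightarrow> 'k tree) \<Rightarrow> ('e \<Rightarrow> 'b) \<Rightarrow> bool" where
  "computable A B f \<longleftrightarrow> (\<exists>P. \<forall>x. runs P (A x) (B (f x)))"

fun pair_enc :: "('b \<Rightarrow> 'k tree) \<Rightarrow> ('c \<Rightarrow> 'k tree) \<Rightarrow> 'b \<times> 'c \<Rightarrow> 'k tree" where
  "pair_enc B C (x, y) = Node (B x) (C y)"

abbreviation (input) list_enc :: "('b \<Rightarrow> 'k tree) \<Rightarrow> 'b list \<Rightarrow> 'k tree" where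
  "list_enc \<equiv> tree_of_list"

abbreviation (input) nat_enc :: "nat \<Rightarrow> 'k tree" where
  "nat_enc \<equiv> tree_of_nat"

abbreviation (input) bool_enc :: "bool \<Rightarrow> 'k tree" where
  "bool_enc \<equiv> tree_of_bool"

lemma computableI: "(\<And>x. runs P (A x) (B (f x))) \<Longrightarrow> computable A B f"
  unfolding computable_def by blast

lemma comp_id: "computable A A (\<lambda>x. x)"
  by (rule computableI) (rule runs.intros)

lemma comp_then:
  assumes "computable A B f" "computable B C g"
  shows "computable A C (\<lambda>x. g (f x))"
proof -
  obtain P Q where "\<And>x. runs P (A x) (B (f x))" "\<And>x. runs Q (B x) (C (g x))"
    using assms unfolding computable_def by blast
  then show ?thesis by (intro computableI[of "Then P Q"]) (rule runs.intros)
qed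

lemma comp_Pair:
  assumes "computable A B f" "computable A C g"
  shows "computable A (pair_enc B C) (\<lambda>x. (f x, g x))"
proof -
  obtain P Q where "\<And>x. runs P (A x) (B (f x))" "\<And>x. runs Q (A x) (C (g x))"
    using assms unfolding computable_def by blast
  then show ?thesis
    by (intro computableI[of "Pairing P Q"]) (simp add: runs.intros)
qed

lemma comp_fst:
  assumes "computable A (pair_enc B C) f"
  shows "computable A B (\<lambda>x. fst (f x))"
proof (rule comp_then[OF assms], rule computableI)
  fix x show "runs Left (pair_enc B C x) (B (fst x))"
    using runs.intros(3)[of "pair_enc B C x"] by (cases x) simp
qed

lemma comp_snd:
  assumes "computable A (pair_enc B C) f"
  shows "computable A C (\<lambda>x. snd (f x))"
proof (rule comp_then[OF assms], rule computableI)
  fix x show "runs Right (pair_enc B C x) (C (snd x))"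
    using runs.intros(4)[of "pair_enc B C x"] by (cases x) simp
qed

lemma comp_Nil: "computable A (list_enc B) (\<lambda>x. [])"
  by (rule computableI[of MkLeaf]) (simp add: runs.intros)

lemma comp_0: "computable A nat_enc (\<lambda>x. 0)"
  by (rule computableI[of MkLeaf]) (simp add: runs.intros)

lemma comp_False: "computable A bool_enc (\<lambda>x. False)"
  by (rule computableI[of MkLeaf]) (simp add: tree_of_bool_def runs.intros)

lemma comp_True: "computable A bool_enc (\<lambda>x. True)"
  by (rule computableI[of "Pairing MkLeaf MkLeaf"]) (simp add: tree_of_bool_def runs.intros)

lemma comp_Cons:
  assumes "computable A B f" "computable A (list_enc B) g"
  shows "computable A (list_enc B) (\<lambda>x. f x # g x)"
proof -
  obtain P Q where "\<And>x. runs P (A x) (B (f x))" "\<And>x. runs Q (A x) (list_enc B (g x))"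
    using assms unfolding computable_def by blast
  then show ?thesis
    by (intro computableI[of "Pairing P Q"]) (simp add: runs.intros)
qed

lemma comp_Suc:
  assumes "computable A nat_enc f"
  shows "computable A nat_enc (\<lambda>x. Suc (f x))"
proof -
  obtain P where "\<And>x. runs P (A x) (nat_enc (f x))" using assms unfolding computable_def by blast
  then show ?thesis
    by (intro computableI[of "Pairing MkLeaf P"]) (simp add: runs.intros)
qed

lemma comp_pred:
  assumes "computable A nat_enc f"
  shows "computable A nat_enc (\<lambda>x. f x - 1)"
proof (rule comp_then[OF assms], rule computableI)
  fix x :: nat show "runs Right (nat_enc x) (nat_enc (x - 1))"
    using runs.intros(4)[of "nat_enc x"] by (cases x) simp_all
qed

lemma comp_tl:
  assumes "computable A (list_enc B) f"
  shows "computable A (list_enc B) (\<lambda>x. tl (f x))"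
proof (rule comp_then[OF assms], rule computableI)
  fix x show "runs Right (list_enc B x) (list_enc B (tl x))"
    using runs.intros(4)[of "list_enc B x"] by (cases x) simp_all
qed

lemma runs_Left_Node: "runs Left (Node s t) s"
  and runs_Right_Node: "runs Right (Node s t) t"
  using runs.intros(3)[of "Node s t"] runs.intros(4)[of "Node s t"] by simp_all

lemma runs_Cond:
  assumes "runs C s c" "c \<noteq> Leaf \<Longrightarrow> runs P s t" "c = Leaf \<Longrightarrow> runs Q s t"
  shows "runs (Cond C P Q) s t"
  using assms by (cases "c = Leaf") (auto intro: runs.intros)

lemma comp_if:
  assumes "computable A bool_enc c" "computable A B f" "computable A B g"
  shows "computable A B (\<lambda>x. if c x then f x else g x)"
proof -
  obtain C P Q where "\<And>x. runs C (A x) (bool_enc (c x))" "\<And>x. runs P (A x) (B (f x))" "\<And>x. runs Q (A x) (B (g x))"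
    using assms unfolding computable_def by blast
  then show ?thesis
    by (intro computableI[of "Cond C P Q"] runs_Cond) (auto simp: tree_of_bool_def)
qed

text \<open>A program sees only one tree, so the branch for a nonempty list receives the environment
  x paired with head and tail.\<close>

lemma comp_case_list:
  assumes xs: "computable A (list_enc B) xs" and f: "computable A C f"
    and g: "computable (pair_enc A (pair_enc B (list_enc B))) C (\<lambda>p. g (fst p) (fst (snd p)) (snd (snd p)))"
  shows "computable A C (\<lambda>x. case xs x of [] \<Rightarrow> f x | y # ys \<Rightarrow> g x y ys)"
proof -
  obtain X P Q where X: "\<And>x. runs X (A x) (list_enc B (xs x))" and P: "\<And>x. runs P (A x) (C (f x))"
    and Q: "\<And>p. runs Q (pair_enc A (pair_enc B (list_enc B)) p) (C (g (fst p) (fst (snd p)) (snd (snd p))))"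
    using assms unfolding computable_def by blast
  show ?thesis
  proof (rule computableI[of "Cond X (Then (Pairing Ident X) Q) P"], rule runs_Cond[OF X])
    fix x assume "list_enc B (xs x) \<noteq> Leaf"
    then obtain y ys where xs: "xs x = y # ys" by (cases "xs x") auto
    have "runs (Pairing Ident X) (A x) (pair_enc A (pair_enc B (list_enc B)) (x, y, ys))"
      using X[of x] by (simp add: xs runs.intros)
    from runs.intros(13)[OF this Q]
    show "runs (Then (Pairing Ident X) Q) (A x) (C (case xs x of [] \<Rightarrow> f x | y # ys \<Rightarrow> g x y ys))"
      by (simp add: xs)
  next
    fix x assume "list_enc B (xs x) = Leaf"
    then have "xs x = []" by (cases "xs x") auto
    then show "runs P (A x) (C (case xs x of [] \<Rightarrow> f x | y # ys \<Rightarrow> g x y ys))" using P[of x] by simp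
  qed
qed

lemma comp_null:
  assumes "computable A (list_enc B) f"
  shows "computable A bool_enc (\<lambda>x. f x = [])"
proof -
  have "computable A bool_enc (\<lambda>x. case f x of [] \<Rightarrow> True | y # ys \<Rightarrow> False)"
    by (rule comp_case_list[OF assms comp_True comp_False])
  moreover have "(case f x of [] \<Rightarrow> True | y # ys \<Rightarrow> False) \<longleftrightarrow> f x = []" for x by (cases "f x") auto
  ultimately show ?thesis by simp
qed

text \<open>The state of the loop consists of the environment, the rest of the list and the accumulator.\<close>

lemma comp_fold:
  assumes h: "computable (pair_enc A (pair_enc B C)) C (\<lambda>p. h (fst p) (fst (snd p)) (snd (snd p)))"
    and xs: "computable A (list_enc B) xs" and a: "computable A C a"
  shows "computable A C (\<lambda>x. fold (h x) (xs x) (a x))"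
proof -
  obtain H X P where H: "\<And>p. runs H (pair_enc A (pair_enc B C) p) (C (h (fst p) (fst (snd p)) (snd (snd p))))"
    and X: "\<And>x. runs X (A x) (list_enc B (xs x))" and P: "\<And>x. runs P (A x) (C (a x))"
    using assms unfolding computable_def by blast
  \<comment> \<open>T selects the rest of the list. A nonempty list is a \<open>Node\<close> and the
    empty one is \<open>Leaf\<close>, so the rest itself is the loop test.\<close>
  define T where "T = Then Right Left"
  define body where "body = Pairing Left (Pairing (Then T Right)
      (Then (Pairing Left (Pairing (Then T Left) (Then Right Right))) H))"
  note LR = runs_Left_Node runs_Right_Node
  have T: "runs T (Node r (Node s t)) s" for r s t
    unfolding T_def by (rule runs.intros(13)[OF LR(2) LR(1)])
  have loop: "runs (Loop T body) (Node (A x) (Node (list_enc B ys) (C c))) (Node (A x) (Node Leaf (C (fold (h x) ys c))))" for x ys c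
  proof (induction ys arbitrary: c)
    case Nil
    show ?case using runs.intros(16)[OF T[of "A x" Leaf "C c"]] by simp
  next
    case (Cons y ys)
    let ?s = "Node (A x) (Node (list_enc B (y # ys)) (C c))"
    have s: "list_enc B (y # ys) = Node (B y) (list_enc B ys)" by simp
    have "runs (Pairing Left (Pairing (Then T Left) (Then Right Right))) ?s (pair_enc A (pair_enc B C) (x, y, c))"
      unfolding s pair_enc.simps by (rule runs.intros(12,13) LR T)+
    from runs.intros(13)[OF this H]
    have "runs (Then (Pairing Left (Pairing (Then T Left) (Then Right Right))) H) ?s (C (h x y c))" by simp
    then have "runs body ?s (Node (A x) (Node (list_enc B ys) (C (h x y c))))"
      unfolding body_def s by (intro runs.intros(12) LR(1)) (rule runs.intros(13)[OF T LR(2)])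
    from runs.intros(17)[OF T _ this Cons] show ?case by simp
  qed
  have "runs (Then (Pairing Ident (Pairing X P)) (Then (Loop T body) (Then Right Right))) (A x) (C (fold (h x) (xs x) (a x)))" for x
  proof -
    have "runs (Pairing Ident (Pairing X P)) (A x) (Node (A x) (Node (list_enc B (xs x)) (C (a x))))"
      by (intro runs.intros(12) X P runs.intros(1))
    then show ?thesis
      by (rule runs.intros(13)) (rule runs.intros(13)[OF loop], rule runs.intros(13)[OF LR(2) LR(2)])
  qed
  then show ?thesis by (rule computableI)
qed

lemma nat_enc_eq_list_enc: "nat_enc n = list_enc (\<lambda>_. Leaf) (replicate n ())"
  by (induction n) auto

text \<open>A number is encoded as the list of as many leaves, so iteration is a fold whose step
  ignores the list element.\<close>

lemma comp_funpow:
  assumes h: "computable (pair_enc A C) C (\<lambda>p. h (fst p) (snd p))"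
    and n: "computable A nat_enc n" and a: "computable A C a"
  shows "computable A C (\<lambda>x. (h x ^^ n x) (a x))"
proof -
  have "computable (pair_enc A (pair_enc (\<lambda>_::unit. Leaf) C)) C (\<lambda>p. h (fst p) (snd (snd p)))"
  proof -
    have "computable (pair_enc A (pair_enc (\<lambda>_::unit. Leaf) C)) (pair_enc A C) (\<lambda>p. (fst p, snd (snd p)))"
      by (rule comp_Pair comp_fst comp_snd comp_id)+
    from comp_then[OF this h] show ?thesis by simp
  qed
  moreover have "computable A (list_enc (\<lambda>_. Leaf)) (\<lambda>x. replicate (n x) ())"
    using n by (simp add: computable_def nat_enc_eq_list_enc)
  ultimately have "computable A C (\<lambda>x. fold (\<lambda>_. h x) (replicate (n x) ()) (a x))"
    using a by (intro comp_fold)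
  moreover have "fold (\<lambda>_. g) (replicate m ()) = g ^^ m" for g :: "'c \<Rightarrow> 'c" and m
    by (induction m) (auto simp: funpow_swap1 fun_eq_iff)
  ultimately show ?thesis by simp
qed

lemma comp_Not:
  assumes "computable A bool_enc f" shows "computable A bool_enc (\<lambda>x. \<not> f x)"
proof -
  have "computable A bool_enc (\<lambda>x. if f x then False else True)"
    by (intro comp_if assms comp_True comp_False)
  moreover have "(if f x then False else True) \<longleftrightarrow> \<not> f x" for x by simp
  ultimately show ?thesis by simp
qed

lemma comp_conj:
  assumes "computable A bool_enc f" "computable A bool_enc g"
  shows "computable A bool_enc (\<lambda>x. f x \<and> g x)"
proof -
  have "computable A bool_enc (\<lambda>x. if f x then g x else False)"
    by (intro comp_if assms comp_False)
  moreover have "(if f x then g x else False) \<longleftrightarrow> f x \<and> g x" for x by simp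
  ultimately show ?thesis by simp
qed

lemma comp_disj:
  assumes "computable A bool_enc f" "computable A bool_enc g"
  shows "computable A bool_enc (\<lambda>x. f x \<or> g x)"
  using comp_Not[OF comp_conj[OF comp_Not[OF assms(1)] comp_Not[OF assms(2)]]] by simp

text \<open>Unbounded search, whose termination rests on the existence assumption. The loop is
  analysed backwards, by induction on the distance d to the least number.\<close>

lemma comp_Least:
  assumes P: "computable (pair_enc A nat_enc) bool_enc (\<lambda>p. P (fst p) (snd p))" and ex: "\<And>x. \<exists>n. P x n"
  shows "computable A nat_enc (\<lambda>x. LEAST n. P x n)"
proof -
  obtain T where T: "\<And>p. runs T (pair_enc A nat_enc p) (bool_enc (\<not> P (fst p) (snd p)))"
    using comp_Not[OF P] unfolding computable_def by blast
  define body where "body = Pairing Left (Pairing MkLeaf Right)"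
  note LR = runs_Left_Node runs_Right_Node
  have body: "runs body (Node (A x) (nat_enc n)) (Node (A x) (nat_enc (Suc n)))" for x n
    unfolding body_def tree_of_nat.simps by (intro runs.intros(12) LR runs.intros(2))
  have loop: "runs (Loop T body) (Node (A x) (nat_enc (l - d))) (Node (A x) (nat_enc l))"
    if l: "l = (LEAST n. P x n)" and d: "d \<le> l" for x l d
    using d
  proof (induction d)
    case 0
    have "P x l" unfolding l by (rule LeastI_ex[OF ex])
    then show ?case using runs.intros(16)[of T] T[of "(x, l)"] by (simp add: tree_of_bool_def)
  next
    case (Suc d)
    then have "\<not> P x (l - Suc d)" unfolding l by (intro not_less_Least) simp
    then have "runs T (Node (A x) (nat_enc (l - Suc d))) (Node Leaf Leaf)"
      using T[of "(x, l - Suc d)"] by (simp add: tree_of_bool_def)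
    moreover have "runs (Loop T body) (Node (A x) (nat_enc (Suc (l - Suc d)))) (Node (A x) (nat_enc l))"
      using Suc by (simp add: Suc_diff_Suc)
    ultimately show ?case using body by (blast intro: runs.intros(17))
  qed
  have "runs (Then (Pairing Ident MkLeaf) (Then (Loop T body) Right)) (A x) (nat_enc (LEAST n. P x n))" for x
  proof -
    have "runs (Pairing Ident MkLeaf) (A x) (Node (A x) (nat_enc 0))"
      by (simp add: runs.intros)
    moreover have "runs (Loop T body) (Node (A x) (nat_enc 0)) (Node (A x) (nat_enc (LEAST n. P x n)))"
      using loop[OF refl order_refl] by simp
    ultimately show ?thesis using LR(2) by (blast intro: runs.intros(13))
  qed
  then show ?thesis by (rule computableI)
qed

section \<open>Scalar operations\<close>

lemma comp_zero: "computable A Scalar (\<lambda>x. 0)"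
  by (rule computableI) (rule runs.intros)

lemma runs_binary:
  assumes "runs P s (Scalar a)" "runs Q s (Scalar b)"
  shows "runs (Then (Pairing P Q) AddOp) s (Scalar (a + b))"
    "runs (Then (Pairing P Q) MultOp) s (Scalar (a * b))"
    "runs (Then (Pairing P Q) EqOp) s (tree_of_bool (a = b))"
proof -
  have pq: "runs (Pairing P Q) s (Node (Scalar a) (Scalar b))" using assms by (rule runs.intros)
  show "runs (Then (Pairing P Q) AddOp) s (Scalar (a + b))"
    using runs.intros(13)[OF pq runs.intros(7)] by simp
  show "runs (Then (Pairing P Q) MultOp) s (Scalar (a * b))"
    using runs.intros(13)[OF pq runs.intros(8)] by simp
  show "runs (Then (Pairing P Q) EqOp) s (tree_of_bool (a = b))"
    using runs.intros(13)[OF pq runs.intros(11)] by simp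
qed

lemma
  assumes "computable A Scalar f" "computable A Scalar g"
  shows comp_add: "computable A Scalar (\<lambda>x. f x + g x)"
    and comp_mult: "computable A Scalar (\<lambda>x. f x * g x)"
    and comp_eq: "computable A bool_enc (\<lambda>x. f x = g x)"
proof -
  obtain P Q where "\<And>x. runs P (A x) (Scalar (f x))" "\<And>x. runs Q (A x) (Scalar (g x))"
    using assms unfolding computable_def by blast
  then show "computable A Scalar (\<lambda>x. f x + g x)" "computable A Scalar (\<lambda>x. f x * g x)"
    "computable A bool_enc (\<lambda>x. f x = g x)"
    using runs_binary by (blast intro: computableI)+
qed

lemma comp_uminus:
  assumes "computable A Scalar f"
  shows "computable A Scalar (\<lambda>x. - f x)"
proof (rule comp_then[OF assms], rule computableI)
  fix a :: 'b show "runs NegOp (Scalar a) (Scalar (- a))"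
    using runs.intros(9)[of "Scalar a"] by simp
qed

text \<open>This rule and the next two substitute computed arguments into a function whose
  computability is stated on nested pairs.\<close>

lemma comp1: "computable B C h \<Longrightarrow> computable A B f \<Longrightarrow> computable A C (\<lambda>x. h (f x))"
  by (rule comp_then)

lemma comp2:
  assumes "computable (pair_enc B C) D (\<lambda>p. h (fst p) (snd p))" "computable A B f" "computable A C g"
  shows "computable A D (\<lambda>x. h (f x) (g x))"
  using comp_then[OF comp_Pair[OF assms(2,3)] assms(1)] by simp

lemma comp3:
  assumes "computable (pair_enc B (pair_enc C D)) E (\<lambda>p. h (fst p) (fst (snd p)) (snd (snd p)))"
    "computable A B f" "computable A C g" "computable A D k"
  shows "computable A E (\<lambda>x. h (f x) (g x) (k x))"
  using comp_then[OF comp_Pair[OF assms(2) comp_Pair[OF assms(3,4)]] assms(1)] by simp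

lemmas comp_basic = comp_id comp_Pair comp_fst comp_snd comp_Nil comp_0 comp_False comp_True comp_Cons comp_Suc
  comp_tl comp_if comp_case_list comp_null comp_fold comp_funpow comp_Not comp_conj comp_disj comp_zero comp_add
  comp_mult comp_eq comp_uminus

section \<open>Computability of list functions\<close>

text \<open>The pattern of most of the following proofs: c derives the computability of a term built
  from folds and iterations by the rules so far, and e identifies this term with the intended
  function.\<close>

lemma comp_rev0: "computable (list_enc B) (list_enc B) rev"
proof -
  have c: "computable (list_enc B) (list_enc B) (\<lambda>x. fold (\<lambda>y a. y # a) x [])"
    by (rule comp_basic)+
  have e: "(\<lambda>x. fold (\<lambda>y a. y # a) x []) = rev"
    by (rule ext) (simp add: rev_conv_fold)
  show ?thesis using c unfolding e by simp
qed

lemmas comp_rev = comp1[OF comp_rev0]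

lemma comp_append0: "computable (pair_enc (list_enc B) (list_enc B)) (list_enc B) (\<lambda>p. fst p @ snd p)"
proof -
  have c: "computable (pair_enc (list_enc B) (list_enc B)) (list_enc B) (\<lambda>p. fold (\<lambda>y a. y # a) (rev (fst p)) (snd p))"
    by (rule comp_basic comp_rev)+
  have e: "fold (\<lambda>y a. y # a) (rev xs) ys = xs @ ys" for xs ys :: "'a list"
    by (simp add: fold_Cons_rev[unfolded fun_eq_iff o_def])
  show ?thesis using c unfolding e by simp
qed

lemmas comp_append = comp2[OF comp_append0]

lemma comp_map:
  assumes h: "computable (pair_enc A B) C (\<lambda>p. h (fst p) (snd p))" and xs: "computable A (list_enc B) xs"
  shows "computable A (list_enc C) (\<lambda>x. map (h x) (xs x))"
proof -
  have c: "computable A (list_enc C) (\<lambda>x. rev (fold (\<lambda>y a. h x y # a) (xs x) []))"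
    by (rule comp_basic comp_rev xs comp2[OF h])+
  have e: "rev (fold (\<lambda>y a. g y # a) ys zs) = rev zs @ map g ys" for g ys zs
    by (induction ys arbitrary: zs) auto
  show ?thesis using c unfolding e by simp
qed

lemma comp_filter:
  assumes h: "computable (pair_enc A B) bool_enc (\<lambda>p. h (fst p) (snd p))" and xs: "computable A (list_enc B) xs"
  shows "computable A (list_enc B) (\<lambda>x. filter (h x) (xs x))"
proof -
  have c: "computable A (list_enc B) (\<lambda>x. rev (fold (\<lambda>y a. if h x y then y # a else a) (xs x) []))"
    by (rule comp_basic comp_rev xs comp2[OF h])+
  have e: "rev (fold (\<lambda>y a. if g y then y # a else a) ys zs) = rev zs @ filter g ys" for g ys zs
    by (induction ys arbitrary: zs) auto
  show ?thesis using c unfolding e by simp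
qed

lemma comp_concat0: "computable (list_enc (list_enc B)) (list_enc B) concat"
proof -
  have c: "computable (list_enc (list_enc B)) (list_enc B) (\<lambda>x. fold (\<lambda>ys a. a @ ys) x [])"
    by (rule comp_basic comp_append)+
  have e: "fold (\<lambda>ys a. a @ ys) xss zs = zs @ concat xss" for xss and zs :: "'a list"
    by (induction xss arbitrary: zs) auto
  show ?thesis using c unfolding e by simp
qed

lemmas comp_concat = comp1[OF comp_concat0]

lemma comp_length0: "computable (list_enc B) nat_enc length"
proof -
  have c: "computable (list_enc B) nat_enc (\<lambda>x. fold (\<lambda>y a. Suc a) x 0)"
    by (rule comp_basic)+
  have e: "fold (\<lambda>y a. Suc a) xs m = m + length xs" for xs :: "'a list" and m
    by (induction xs arbitrary: m) auto
  show ?thesis using c unfolding e by simp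
qed

lemmas comp_length = comp1[OF comp_length0]

lemma comp_plus0: "computable (pair_enc nat_enc nat_enc) nat_enc (\<lambda>p. fst p + snd p)"
proof -
  have c: "computable (pair_enc nat_enc nat_enc) nat_enc (\<lambda>p. ((\<lambda>a. Suc a) ^^ fst p) (snd p))"
    by (rule comp_basic)+
  have e: "((\<lambda>a. Suc a) ^^ m) n = m + n" for m n by (induction m) auto
  show ?thesis using c unfolding e by simp
qed

lemmas comp_plus = comp2[OF comp_plus0]

lemma comp_minus0: "computable (pair_enc nat_enc nat_enc) nat_enc (\<lambda>p. fst p - snd p)"
proof -
  have c: "computable (pair_enc nat_enc nat_enc) nat_enc (\<lambda>p. ((\<lambda>a. a - 1) ^^ snd p) (fst p))"
    by (rule comp_basic comp_pred)+
  have e: "((\<lambda>a. a - 1) ^^ m) n = n - m" for m n :: nat by (induction m) auto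
  show ?thesis using c unfolding e by simp
qed

lemmas comp_minus = comp2[OF comp_minus0]

text \<open>A constant function applied at least once replaces the start value True.\<close>

lemma comp_is_0_0: "computable nat_enc bool_enc (\<lambda>n. n = 0)"
proof -
  have c: "computable nat_enc bool_enc (\<lambda>n. ((\<lambda>a. False) ^^ n) True)"
    by (rule comp_basic)+
  have e: "((\<lambda>a. False) ^^ n) True \<longleftrightarrow> n = 0" for n by (cases n) auto
  show ?thesis using c unfolding e by simp
qed

lemmas comp_is_0 = comp1[OF comp_is_0_0]

lemma comp_le0: "computable (pair_enc nat_enc nat_enc) bool_enc (\<lambda>p. fst p \<le> snd p)"
proof -
  have c: "computable (pair_enc nat_enc nat_enc) bool_enc (\<lambda>p. fst p - snd p = 0)"
    by (rule comp_is_0 comp_minus comp_fst comp_snd comp_id)+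
  then show ?thesis by simp
qed

lemmas comp_le = comp2[OF comp_le0]

lemma comp_nat_eq0: "computable (pair_enc nat_enc nat_enc) bool_enc (\<lambda>p. fst p = snd p)"
proof -
  have c: "computable (pair_enc nat_enc nat_enc) bool_enc (\<lambda>p. fst p \<le> snd p \<and> snd p \<le> fst p)"
    by (rule comp_conj comp_le comp_fst comp_snd comp_id)+
  then show ?thesis by (simp add: order_eq_iff)
qed

lemmas comp_nat_eq = comp2[OF comp_nat_eq0]

abbreviation word_enc :: "nat list \<Rightarrow> 'k tree" where
  "word_enc \<equiv> list_enc nat_enc"

abbreviation expr_enc :: "'k poly_expr \<Rightarrow> 'k tree" where
  "expr_enc \<equiv> list_enc (pair_enc Scalar word_enc)"

lemma comp_word_eq0: "computable (pair_enc word_enc word_enc) bool_enc (\<lambda>p. fst p = snd p)"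
proof -
  \<comment> \<open>The state holds the verdict so far and the unread part of the second word. If
    that part runs out too early, the verdict becomes False and remains so.\<close>
  let ?f = "\<lambda>e (s :: bool \<times> nat list). case snd s of [] \<Rightarrow> (False, []) | c # r \<Rightarrow> (fst s \<and> e = c, r)"
  have c: "computable (pair_enc word_enc word_enc) bool_enc
      (\<lambda>p. fst (fold ?f (fst p) (True, snd p)) \<and> snd (fold ?f (fst p) (True, snd p)) = [])"
    by (rule comp_basic comp_nat_eq)+
  have e: "fst (fold ?f v (b, w)) \<and> snd (fold ?f v (b, w)) = [] \<longleftrightarrow> b \<and> v = w" for v w b
  proof (induction v arbitrary: w b)
    case (Cons e v)
    have "\<not> fst (fold ?f v (False, []))" using Cons[of False "[]"] by (induction v) auto
    with Cons show ?case by (cases w) auto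
  qed auto
  show ?thesis using c unfolding e by simp
qed

lemmas comp_word_eq = comp2[OF comp_word_eq0]

lemmas comp_list = comp_basic comp_rev comp_append comp_map comp_filter comp_concat comp_length comp_plus comp_minus
  comp_is_0 comp_le comp_nat_eq comp_word_eq

lemma comp_downs0: "computable nat_enc word_enc (\<lambda>n. rev [0..<n])"
proof -
  have c: "computable nat_enc word_enc (\<lambda>n. ((\<lambda>a. length a # a) ^^ n) [])"
    by (rule comp_list)+
  have e: "((\<lambda>a. length a # a) ^^ n) [] = rev [0..<n]" for n by (induction n) auto
  show ?thesis using c unfolding e by simp
qed

lemmas comp_downs = comp1[OF comp_downs0]

lemma comp_zeros0: "computable nat_enc word_enc (\<lambda>n. replicate n 0)"
proof -
  have c: "computable nat_enc word_enc (\<lambda>n. ((\<lambda>a. 0 # a) ^^ n) [])"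
    by (rule comp_list)+
  have e: "((\<lambda>a. 0 # a) ^^ n) [] = replicate n (0::nat)" for n by (induction n) auto
  show ?thesis using c unfolding e by simp
qed

lemmas comp_zeros = comp1[OF comp_zeros0]

lemma comp_take0: "computable (pair_enc nat_enc (list_enc B)) (list_enc B) (\<lambda>p. take (fst p) (snd p))"
proof -
  \<comment> \<open>The state holds the elements taken so far, in reverse, and the rest of the
    list.\<close>
  let ?f = "\<lambda>s. case snd s of [] \<Rightarrow> s | c # r \<Rightarrow> (c # fst s, r)"
  have c: "computable (pair_enc nat_enc (list_enc B)) (list_enc B) (\<lambda>p. rev (fst ((?f ^^ fst p) ([], snd p))))"
    by (rule comp_list)+
  have e: "(?f ^^ n) (ys, xs) = (rev (take n xs) @ ys, drop n xs)" for n and xs ys :: "'a list"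
  proof (induction n arbitrary: xs ys)
    case (Suc n)
    then show ?case by (cases xs) (simp_all add: funpow_Suc_right del: funpow.simps(2))
  qed simp
  show ?thesis using c unfolding e by simp
qed

lemmas comp_take = comp2[OF comp_take0]

lemma comp_sum_list0: "computable word_enc nat_enc sum_list"
proof -
  have c: "computable word_enc nat_enc (\<lambda>x. fold (\<lambda>y a. a + y) x 0)"
    by (rule comp_list)+
  have e: "fold (\<lambda>y a. a + y) xs m = m + sum_list xs" for xs :: "nat list" and m
    by (induction xs arbitrary: m) auto
  show ?thesis using c unfolding e by simp
qed

lemmas comp_sum_list = comp1[OF comp_sum_list0]

lemma comp_rotate1_0: "computable (list_enc B) (list_enc B) rotate1"
proof -
  have c: "computable (list_enc B) (list_enc B) (\<lambda>x. case x of [] \<Rightarrow> [] | y # ys \<Rightarrow> ys @ [y])"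
    by (rule comp_list)+
  have e: "(\<lambda>x. case x of [] \<Rightarrow> [] | y # ys \<Rightarrow> ys @ [y]) = rotate1"
    by (rule ext) (auto split: list.splits)
  show ?thesis using c unfolding e by simp
qed

section \<open>Computability of the algorithm\<close>

lemma comp_swap_word0: "computable word_enc word_enc swap_word"
proof -
  have c: "computable word_enc word_enc (\<lambda>x. case x of [] \<Rightarrow> x | a # y \<Rightarrow> (case y of [] \<Rightarrow> x | b # w \<Rightarrow> b # a # w))"
    by (rule comp_list)+
  have e: "(\<lambda>x. case x of [] \<Rightarrow> x | a # y \<Rightarrow> (case y of [] \<Rightarrow> x | b # w \<Rightarrow> b # a # w)) = swap_word"
    by (rule ext) (auto split: list.splits)
  show ?thesis using c unfolding e by simp
qed

lemma comp_inc_word0: "computable word_enc word_enc inc_word"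
proof -
  have c: "computable word_enc word_enc (\<lambda>x. case x of [] \<Rightarrow> [] | a # w \<Rightarrow> Suc a # w)"
    by (rule comp_list)+
  have e: "(\<lambda>x. case x of [] \<Rightarrow> [] | a # w \<Rightarrow> Suc a # w) = inc_word"
    by (rule ext) (auto split: list.splits)
  show ?thesis using c unfolding e by simp
qed

lemma comp_all_words0: "computable (pair_enc nat_enc nat_enc) (list_enc word_enc) (\<lambda>p. all_words (fst p) (snd p))"
proof -
  have c: "computable (pair_enc nat_enc nat_enc) (list_enc word_enc)
     (\<lambda>p. ((\<lambda>W. concat (map (\<lambda>e. map (\<lambda>w. w @ [e]) W) (rev [0..<Suc (fst p)]))) ^^ snd p) [[]])"
    by (rule comp_downs comp_list)+
  have e: "((\<lambda>W. concat (map (\<lambda>e. map (\<lambda>w. w @ [e]) W) (rev [0..<Suc b]))) ^^ n) [[]] = all_words b n" for b n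
    by (induction n) simp_all
  show ?thesis using c unfolding e by simp
qed

lemmas comp_all_words = comp2[OF comp_all_words0]

lemma comp_deg_words0: "computable (pair_enc nat_enc nat_enc) (list_enc word_enc) (\<lambda>p. deg_words (fst p) (snd p))"
  unfolding deg_words_def by (rule comp_all_words comp_sum_list comp_list)+

lemmas comp_deg_words = comp2[OF comp_deg_words0]

lemma comp_box_words0: "computable nat_enc (list_enc word_enc) box_words"
  unfolding box_words_def[abs_def] by (rule comp_deg_words comp_downs comp_list)+

lemmas comp_box_words = comp1[OF comp_box_words0]

lemma comp_coef0: "computable (pair_enc word_enc expr_enc) Scalar (\<lambda>p. coef (fst p) (snd p) :: 'k::field)"
proof -
  have c: "computable (pair_enc word_enc expr_enc) Scalar
      (\<lambda>p. fold (\<lambda>t a. if snd t = fst p then a + fst t else a) (snd p) (0::'k))"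
    by (rule comp_list)+
  have e: "fold (\<lambda>t a. if snd t = w then a + fst t else a) p c = c + coef w p" for w p and c :: 'k
    by (induction p arbitrary: c) (auto simp: coef_def)
  show ?thesis using c unfolding e by simp
qed

lemmas comp_coef = comp2[OF comp_coef0]

lemma comp_scale_expr0: "computable (pair_enc Scalar expr_enc) expr_enc (\<lambda>p. scale_expr (fst p) (snd p) :: 'k::field poly_expr)"
  unfolding scale_expr_def case_prod_beta by (rule comp_list)+

lemmas comp_scale_expr = comp2[OF comp_scale_expr0]

lemma comp_map_words:
  assumes "computable (pair_enc A word_enc) word_enc (\<lambda>p. h (fst p) (snd p))" "computable A expr_enc f"
  shows "computable A expr_enc (\<lambda>x. map_words (h x) (f x))"
  unfolding map_words_def case_prod_beta by (rule assms comp2[OF assms(1)] comp_list)+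

lemma comp_cross0:
  "computable (pair_enc word_enc (pair_enc expr_enc expr_enc)) expr_enc (\<lambda>p. cross (fst p) (fst (snd p)) (snd (snd p)) :: 'k::field poly_expr)"
  unfolding cross_def by (rule comp_scale_expr comp_coef comp_list)+

lemmas comp_cross = comp3[OF comp_cross0]

lemma comp_elim_word0:
  "computable (pair_enc word_enc (list_enc expr_enc)) (list_enc expr_enc) (\<lambda>p. elim_word (fst p) (snd p) :: 'k::field poly_expr list)"
  unfolding elim_word_def by (rule comp_cross comp_coef comp_list)+

lemmas comp_elim_word = comp2[OF comp_elim_word0]

lemma comp_leads0:
  "computable (pair_enc (list_enc word_enc) (list_enc (expr_enc :: 'k::field poly_expr \<Rightarrow> _))) (list_enc word_enc) (\<lambda>p. leads (fst p) (snd p))"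
  unfolding leads_def leads_step_def[abs_def] by (rule comp_elim_word comp_coef comp_list)+

lemmas comp_leads = comp2[OF comp_leads0]

lemma comp_step_exprs0:
  "computable (pair_enc nat_enc (list_enc expr_enc)) (list_enc expr_enc) (\<lambda>p. step_exprs (fst p) (snd p) :: 'k::field poly_expr list)"
  unfolding step_exprs_def
  by (rule comp_elim_word comp_deg_words comp_map_words comp1[OF comp_rotate1_0] comp1[OF comp_swap_word0]
      comp1[OF comp_inc_word0] comp_list)+

lemmas comp_step_exprs = comp2[OF comp_step_exprs0]

lemma comp_basis0:
  "computable (pair_enc nat_enc (list_enc expr_enc)) (list_enc expr_enc) (\<lambda>p. basis (fst p) (snd p) :: 'k::field poly_expr list)"
  unfolding basis_def by (rule comp_step_exprs comp_box_words comp_list)+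

lemmas comp_basis = comp2[OF comp_basis0]

lemma comp_pad0: "computable (pair_enc nat_enc word_enc) word_enc (\<lambda>p. pad (fst p) (snd p))"
  unfolding pad_def by (rule comp_take comp_zeros comp_list)+

lemmas comp_pad = comp2[OF comp_pad0]

lemma comp_remainder0: "computable (pair_enc word_enc word_enc) word_enc (\<lambda>p. remainder (fst p) (snd p))"
  unfolding remainder_def by (rule comp_list)+

lemmas comp_remainder = comp2[OF comp_remainder0]

lemma comp_covers_words0:
  "computable (pair_enc word_enc (pair_enc (list_enc word_enc) (list_enc word_enc))) bool_enc
    (\<lambda>p. covers_words (fst p) (fst (snd p)) (snd (snd p)))"
  unfolding covers_words_def by (rule comp_remainder comp_list)+

lemmas comp_covers_words = comp3[OF comp_covers_words0]

lemma comp_trunc_basis0: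
  "computable (pair_enc nat_enc (list_enc expr_enc)) (list_enc expr_enc) (\<lambda>p. trunc_basis (fst p) (snd p) :: 'k::field poly_expr list)"
  unfolding trunc_basis_def by (rule comp_basis comp_map_words comp_pad comp_list)+

lemmas comp_trunc_basis = comp2[OF comp_trunc_basis0]

lemma comp_trunc_leads0:
  "computable (pair_enc nat_enc (list_enc (expr_enc :: 'k::field poly_expr \<Rightarrow> _))) (list_enc word_enc) (\<lambda>p. trunc_leads (fst p) (snd p))"
  unfolding trunc_leads_def by (rule comp_leads comp_box_words comp_trunc_basis comp_list)+

lemmas comp_trunc_leads = comp2[OF comp_trunc_leads0]

lemma comp_ext_leads0:
  "computable (pair_enc nat_enc (pair_enc (list_enc (expr_enc :: 'k::field poly_expr \<Rightarrow> _)) expr_enc)) (list_enc word_enc)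
    (\<lambda>p. ext_leads (fst p) (fst (snd p)) (snd (snd p)))"
  unfolding ext_leads_def by (rule comp_leads comp_box_words comp_trunc_basis comp_map_words comp_pad comp_list)+

lemmas comp_ext_leads = comp3[OF comp_ext_leads0]

lemma comp_expr_size0: "computable (expr_enc :: 'k::field poly_expr \<Rightarrow> _) nat_enc expr_size"
  unfolding expr_size_def[abs_def] case_prod_beta by (rule comp_sum_list comp_list)+

lemmas comp_expr_size = comp1[OF comp_expr_size0]

abbreviation input_enc :: "'k poly_expr list \<times> 'k poly_expr \<Rightarrow> 'k tree" where
  "input_enc \<equiv> pair_enc (list_enc expr_enc) expr_enc"

lemma comp_start0: "computable (input_enc :: 'k::field poly_expr list \<times> _ \<Rightarrow> _) nat_enc (\<lambda>p. start (fst p) (snd p))"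
  unfolding start_def numeral_2_eq_2 by (rule comp_expr_size comp_sum_list comp_list)+

lemmas comp_start = comp2[OF comp_start0]

lemma comp_accepts0:
  "computable (pair_enc (list_enc (expr_enc :: 'k::field poly_expr \<Rightarrow> _)) (pair_enc expr_enc nat_enc)) bool_enc
    (\<lambda>p. accepts (fst p) (fst (snd p)) (snd (snd p)))"
  unfolding accepts_def by (rule comp_covers_words comp_trunc_leads comp_ext_leads comp_list)+

lemmas comp_accepts = comp3[OF comp_accepts0]

lemma comp_decided0:
  "computable (pair_enc (list_enc (expr_enc :: 'k::field poly_expr \<Rightarrow> _)) (pair_enc expr_enc nat_enc)) bool_enc
    (\<lambda>p. decided (fst p) (fst (snd p)) (snd (snd p)))"
  unfolding decided_def
  by (rule comp_covers_words comp_trunc_leads comp_ext_leads comp_accepts comp_zeros comp_list)+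

lemmas comp_decided = comp3[OF comp_decided0]

lemma comp_decide:
  "computable (input_enc :: 'k::field poly_expr list \<times> _ \<Rightarrow> _) bool_enc (\<lambda>p. decide (fst p) (snd p))"
proof -
  have c: "computable (input_enc :: 'k poly_expr list \<times> _ \<Rightarrow> _) nat_enc
      (\<lambda>p. LEAST n. decided (fst p) (snd p) (start (fst p) (snd p) + n))"
    by (rule comp_Least[OF _ ex_decided]) (rule comp_decided comp_start comp_list)+
  \<comment> \<open>The search yields the offset of the decisive k from the start; the acceptance
    test is then evaluated once more at this k.\<close>
  from comp3[OF comp_accepts0 comp_fst[OF comp_id] comp_snd[OF comp_id] comp_plus[OF comp_start0 this]]
  show ?thesis unfolding decide_def .
qed

lemma tree_of_expr_eq: "tree_of_expr = expr_enc"
  unfolding tree_of_expr_def by (rule arg_cong[where f = tree_of_list]) auto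

lemma membership_input_eq: "membership_input tss ts = input_enc (tss, ts)"
  by (simp add: membership_input_def tree_of_expr_eq)

text \<open>All expressions of the same polynomials get the same answer, because
  \<open>decide_correct\<close> characterises the answer by the polynomials represented.\<close>

theorem corollary2p5:
  shows "\<exists>P :: prog. \<forall>(fs :: 'a::field mpoly list) (f :: 'a mpoly) tss ts.
           map poly_of_expr tss = fs \<and> poly_of_expr ts = f \<longrightarrow>
           runs P (membership_input tss ts) (tree_of_bool (f \<in> group_ring_span (set fs)))"
proof -
  obtain P where P: "runs P (input_enc p) (tree_of_bool (decide (fst p) (snd p)))"
    for p :: "'a poly_expr list \<times> 'a poly_expr"
    using comp_decide unfolding computable_def by blast
  show ?thesis
  proof (intro exI[of _ P] allI impI)
    fix fs :: "'a mpoly list" and f :: "'a mpoly" and tss ts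
    assume "map poly_of_expr tss = fs \<and> poly_of_expr ts = f"
    then have "decide tss ts \<longleftrightarrow> f \<in> group_ring_span (set fs)"
      by (auto simp: decide_correct)
    with P[of "(tss, ts)"] show "runs P (membership_input tss ts) (tree_of_bool (f \<in> group_ring_span (set fs)))"
      by (simp add: membership_input_eq)
  qed
qed

end
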